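(* Every knot type and every link type in $\mathbb{R}^3$ can be represented by a $\mathcal{C}^2$ curve of constant curvature. That is, for every tame link $L\subset\mathbb{R}^3$ with $m\ge 1$ components (a knot being the case $m=1$), there exist a constant $\kappa>0$, lengths $\ell_1,\dots,\ell_m>0$, and maps $\gamma_i:\mathbb{R}\to\mathbb{R}^3$ ($1\le i\le m$) such that: each $\gamma_i$ is of class $\mathcal{C}^2$ and $\ell_i$-periodic, with $|\gamma_i'(s)|=1$ and $|\gamma_i''(s)|=\kappa$ for all $s\in\mathbb{R}$; each $\gamma_i$ is injective on $[0,\ell_i)$; the images $\gamma_1(\mathbb{R}),\dots,\gamma_m(\mathbb{R})$ are pairwise disjoint; and the link $\gamma_1(\mathbb{R})\cup\dots\cup\gamma_m(\mathbb{R})$ is ambient isotopic to $L$ in $\mathbb{R}^3$.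
   Context: A link with $m$ components is a disjoint union of $m$ simple closed curves in $\mathbb{R}^3$. It is tame if it is ambient isotopic to a union of finitely many disjoint simple closed polygons. A knot is a link with one component. Two links have the same type if they are ambient isotopic in $\mathbb{R}^3$. For a $\mathcal{C}^2$ curve $\gamma$ parametrized by arclength, the curvature at $\gamma(s)$ is $|\gamma''(s)|$. A closed $\mathcal{C}^2$ curve is required to be $\mathcal{C}^2$ also at the point where it closes up, which is expressed by the periodicity of the parametrization. *)

theory Defs
  imports "HOL-Analysis.Analysis"
begin

definition simple_closed_curve :: "(real^3) set \<Rightarrow> bool" where
  "simple_closed_curve C \<longleftrightarrow>
     (\<exists>g. simple_path g \<and> pathfinish g = pathstart g \<and> C = path_image g)"

fun polygonal_path :: "(real^3) list \<Rightarrow> real \<Rightarrow> real^3" where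
  "polygonal_path [] = linepath 0 0"
| "polygonal_path [a] = linepath a a"
| "polygonal_path [a, b] = linepath a b"
| "polygonal_path (a # b # c # vs) = linepath a b +++ polygonal_path (b # c # vs)"

text \<open>The first vertex is repeated at the end of the vertex list. Simplicity of the path
  excludes degenerate edges and polygons with fewer than three edges.\<close>

definition simple_closed_polygon :: "(real^3) set \<Rightarrow> bool" where
  "simple_closed_polygon P \<longleftrightarrow>
     (\<exists>vs. simple_path (polygonal_path vs) \<and>
           pathfinish (polygonal_path vs) = pathstart (polygonal_path vs) \<and>
           P = path_image (polygonal_path vs))"

definition ambient_isotopic :: "(real^3) set \<Rightarrow> (real^3) set \<Rightarrow> bool" where
  "ambient_isotopic A B \<longleftrightarrow>
     (\<exists>H :: real \<times> (real^3) \<Rightarrow> real^3.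
        continuous_on ({0..1} \<times> UNIV) H \<and>
        (\<forall>t\<in>{0..1}. \<exists>G. homeomorphism UNIV UNIV (\<lambda>x. H (t, x)) G) \<and>
        (\<forall>x. H (0, x) = x) \<and>
        (\<lambda>x. H (1, x)) ` A = B)"

definition link :: "nat \<Rightarrow> (real^3) set \<Rightarrow> bool" where
  "link m L \<longleftrightarrow>
     (\<exists>\<C>. finite \<C> \<and> card \<C> = m \<and> (\<forall>C\<in>\<C>. simple_closed_curve C) \<and>
          pairwise disjnt \<C> \<and> L = \<Union>\<C>)"

definition tame :: "(real^3) set \<Rightarrow> bool" where
  "tame L \<longleftrightarrow>
     (\<exists>\<P>. finite \<P> \<and> (\<forall>P\<in>\<P>. simple_closed_polygon P) \<and>
          pairwise disjnt \<P> \<and> ambient_isotopic L (\<Union>\<P>))"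

abbreviation curve_deriv :: "(real \<Rightarrow> real^3) \<Rightarrow> real \<Rightarrow> real^3" where
  "curve_deriv \<gamma> \<equiv> (\<lambda>s. vector_derivative \<gamma> (at s))"

definition C2_curve :: "(real \<Rightarrow> real^3) \<Rightarrow> bool" where
  "C2_curve \<gamma> \<longleftrightarrow>
     \<gamma> C1_differentiable_on UNIV \<and> curve_deriv \<gamma> C1_differentiable_on UNIV"

end

theory Submission
  imports Defs
begin

text \<open>The tangent of an arclength curve of curvature 1 is a path of unit speed on the unit sphere, and
  the curve is the integral of that path. Over an edge of direction \<open>a\<close> of a polygon we let the tangent
  run around a small circle with axis \<open>a\<close>, interrupted at four points by many small figure eights. A
  figure eight at \<open>x\<close> advances the curve exactly along \<open>x\<close>, by an amount that can be tuned, so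
  that the curve ends exactly at the next (rescaled) vertex. A great circle tangent to the circles of two
  consecutive axes makes the turn between two edges. Rescaling yields curves of large curvature that follow
  the polygon and, near each vertex, advance in a common direction with it. Hence the straight-line
  homotopy between curve and polygon moves through embeddings; cut into short steps, each step
  displaces points by a map that extends to a contraction \<open>u\<close> of space, and \<open>id + t u\<close> is an ambient
  isotopy.\<close>

subsection \<open>Ambient isotopies\<close>

text \<open>Constant curvature and class C^2 together mean that the tangent moves at constant speed
  on the sphere with continuous velocity. Two arcs may therefore be joined only where both tangent
  and acceleration agree, so arcs of circles on the sphere can follow each other only at points of
  tangency. Figure eights escape this difficulty: each returns to the state in which it began and
  can be inserted anywhere. The displacement of a turn is never computed; it is subtracted in
  advance from the target of the straight part. Closeness to the polygon alone would not determine
  the knot type, since a close curve may carry small local knots. The first-order condition that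
  curve and polygon advance along the sum of the two edge directions at a vertex excludes them. The
  construction works for every curvature above a threshold, which lets all components share one
  value. The contractions come from extending Lipschitz maps coordinate by coordinate, which costs
  the factor 3, the dimension of space.\<close>

lemma ambient_isotopicE:
  assumes "ambient_isotopic A B"
  obtains H :: "real \<times> (real^3) \<Rightarrow> real^3" where
    "continuous_on ({0..1} \<times> UNIV) H"
    "\<And>t. t \<in> {0..1} \<Longrightarrow> \<exists>G. homeomorphism UNIV UNIV (\<lambda>x. H (t, x)) G"
    "\<And>x. H (0, x) = x" "(\<lambda>x. H (1, x)) ` A = B"
  using assms unfolding ambient_isotopic_def by auto

lemma ambient_isotopic_sym:
  assumes "ambient_isotopic A B"
  shows "ambient_isotopic B A"
proof -
  obtain H :: "real \<times> (real^3) \<Rightarrow> real^3" where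
    cont: "continuous_on ({0..1} \<times> UNIV) H" and
    homeo: "\<And>t. t \<in> {0..1} \<Longrightarrow> \<exists>G. homeomorphism UNIV UNIV (\<lambda>x. H (t, x)) G" and
    H0: "\<And>x. H (0, x) = x" and H1: "(\<lambda>x. H (1, x)) ` A = B"
    using assms unfolding ambient_isotopic_def by auto
  obtain G where G: "homeomorphism UNIV UNIV (\<lambda>x. H (1, x)) G"
    using homeo[of 1] by auto
  \<comment> \<open>\<open>K\<close> undoes the final map and then follows the isotopy backwards
    from time 1. Only the inverse at time 1 enters, so joint continuity of the inverses in
    \<open>t\<close> and \<open>x\<close> is never an issue.\<close>
  define K where "K = (\<lambda>p. H (1 - fst p, G (snd p)))"
  have contG: "continuous_on UNIV G"
    using G by (rule homeomorphism_cont2)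
  have "continuous_on ({0..1} \<times> UNIV) K"
    unfolding K_def
    by (rule continuous_on_compose2[OF cont])
      (auto intro!: continuous_intros continuous_on_compose2[OF contG])
  moreover have "\<exists>F. homeomorphism UNIV UNIV (\<lambda>x. K (t, x)) F" if t: "t \<in> {0..1}" for t
  proof -
    obtain F where F: "homeomorphism UNIV UNIV (\<lambda>x. H (1 - t, x)) F"
      using homeo[of "1 - t"] t by auto
    have "homeomorphism UNIV UNIV G (\<lambda>x. H (1, x))"
      using G by (rule homeomorphism_symD)
    from homeomorphism_compose[OF this F] show ?thesis
      by (auto simp: K_def o_def)
  qed
  moreover have "K (0, x) = x" for x
    using homeomorphism_apply2[OF G] by (simp add: K_def)
  moreover have "(\<lambda>x. K (1, x)) ` B = A"
    using homeomorphism_apply1[OF G] by (force simp: K_def H0 H1[symmetric] image_image)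
  ultimately show ?thesis
    unfolding ambient_isotopic_def by blast
qed

lemma ambient_isotopic_trans:
  assumes "ambient_isotopic A B" "ambient_isotopic B C"
  shows "ambient_isotopic A C"
proof -
  obtain H :: "real \<times> (real^3) \<Rightarrow> real^3" where
    contH: "continuous_on ({0..1} \<times> UNIV) H" and
    homH: "\<And>t. t \<in> {0..1} \<Longrightarrow> \<exists>G. homeomorphism UNIV UNIV (\<lambda>x. H (t, x)) G" and
    H0: "\<And>x. H (0, x) = x" and H1: "(\<lambda>x. H (1, x)) ` A = B"
    using assms(1) unfolding ambient_isotopic_def by auto
  obtain K :: "real \<times> (real^3) \<Rightarrow> real^3" where
    contK: "continuous_on ({0..1} \<times> UNIV) K" and
    homK: "\<And>t. t \<in> {0..1} \<Longrightarrow> \<exists>G. homeomorphism UNIV UNIV (\<lambda>x. K (t, x)) G" and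
    K0: "\<And>x. K (0, x) = x" and K1: "(\<lambda>x. K (1, x)) ` B = C"
    using assms(2) unfolding ambient_isotopic_def by auto
  define J where "J = (\<lambda>p :: real \<times> (real^3). if fst p \<le> 1/2 then H (2 * fst p, snd p)
                            else K (2 * fst p - 1, H (1, snd p)))"
  have cH1: "continuous_on UNIV (\<lambda>x. H (1, x))"
    by (rule continuous_on_compose2[OF contH]) (auto intro!: continuous_intros)
  have split: "{0..1::real} \<times> UNIV =
      ({0..1/2} \<times> UNIV) \<union> ({1/2..1} \<times> (UNIV :: (real^3) set))"
    by auto
  have "continuous_on (({0..1/2} \<times> UNIV) \<union> ({1/2..1} \<times> UNIV)) J"
    unfolding J_def
  proof (rule continuous_on_cases)
    show "closed ({0..1/2::real} \<times> (UNIV :: (real^3) set))" by (simp add: closed_Times)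
    show "closed ({1/2..1::real} \<times> (UNIV :: (real^3) set))" by (simp add: closed_Times)
    show "continuous_on ({0..1/2} \<times> UNIV) (\<lambda>p. H (2 * fst p, snd p))"
      by (rule continuous_on_compose2[OF contH]) (auto intro!: continuous_intros)
    show "continuous_on ({1/2..1} \<times> UNIV) (\<lambda>p. K (2 * fst p - 1, H (1, snd p)))"
      by (rule continuous_on_compose2[OF contK])
        (auto intro!: continuous_intros continuous_on_compose2[OF cH1])
    have "H (2 * fst p, snd p) = K (2 * fst p - 1, H (1, snd p))" if "fst p = 1/2" for p
      unfolding that by (simp add: K0)
    then show "\<forall>p. p \<in> {0..1/2} \<times> UNIV \<and> \<not> fst p \<le> 1/2 \<or> p \<in> {1/2..1} \<times> UNIV \<and> fst p \<le> 1/2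
        \<longrightarrow> H (2 * fst p, snd p) = K (2 * fst p - 1, H (1, snd p))"
      by force
  qed
  then have "continuous_on ({0..1} \<times> UNIV) J" by (simp add: split)
  moreover have "\<exists>F. homeomorphism UNIV UNIV (\<lambda>x. J (t, x)) F" if t: "t \<in> {0..1}" for t
  proof (cases "t \<le> 1/2")
    case True
    then show ?thesis using homH[of "2 * t"] that by (simp add: J_def)
  next
    case False
    obtain G where G: "homeomorphism UNIV UNIV (\<lambda>x. H (1, x)) G"
      using homH[of 1] by auto
    obtain F where F: "homeomorphism UNIV UNIV (\<lambda>x. K (2 * t - 1, x)) F"
      using homK[of "2 * t - 1"] t False by auto
    from homeomorphism_compose[OF G F] show ?thesis
      using False by (auto simp: J_def o_def)
  qed
  moreover have "J (0, x) = x" for x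
    by (simp add: J_def H0)
  moreover have "(\<lambda>x. J (1, x)) ` A = C"
    by (simp add: J_def H1[symmetric] K1[symmetric] image_image)
  ultimately show ?thesis
    unfolding ambient_isotopic_def by blast
qed

lemma ambient_isotopic_refl: "ambient_isotopic A A"
  unfolding ambient_isotopic_def
  by (rule exI[of _ snd]) (auto intro!: continuous_intros homeomorphism_ident)

text \<open>Solving \<open>x + u x = y\<close> means finding a fixed point of
  \<open>y - u x\<close>, which Banach's theorem supplies. The inverse is continuous because
  \<open>id + u\<close> shrinks no distance below \<open>1 - c\<close> times its value.\<close>

lemma homeomorphism_id_plus_contraction:
  fixes u :: "'a::euclidean_space \<Rightarrow> 'a"
  assumes "c < 1" and lip: "c-lipschitz_on UNIV u"
  shows "\<exists>G. homeomorphism UNIV UNIV (\<lambda>x. x + u x) G"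
proof -
  have c0: "0 \<le> c" using lip by (rule lipschitz_on_nonneg)
  have lip': "dist (u x) (u y) \<le> c * dist x y" for x y
    using lipschitz_onD[OF lip] by simp
  have surj: "\<exists>x. x + u x = y" for y
  proof -
    have "\<exists>!x. y - u x = x"
      by (rule banach_fix_type[of c]) (use c0 assms(1) lip' in \<open>auto simp: dist_norm norm_minus_commute\<close>)
    then obtain x where "y - u x = x" by auto
    then have "x + u x = y" by (simp add: algebra_simps)
    then show ?thesis by blast
  qed
  have expand: "(1 - c) * dist x y \<le> dist (x + u x) (y + u y)" for x y
  proof -
    have "dist x y \<le> dist (x + u x) (y + u y) + dist (u x) (u y)"
      using norm_triangle_ineq4[of "(x + u x) - (y + u y)" "u x - u y"]
      by (simp add: dist_norm algebra_simps)
    then show ?thesis using lip'[of x y] by (simp add: algebra_simps)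
  qed
  define G where "G = (\<lambda>y. SOME x. x + u x = y)"
  have G2: "G y + u (G y) = y" for y
    unfolding G_def by (rule someI_ex[OF surj])
  have G1: "G (x + u x) = x" for x
    using expand[of "G (x + u x)" x] assms(1) by (simp add: G2 mult_le_0_iff)
  have "(1 / (1 - c))-lipschitz_on UNIV G"
  proof (rule lipschitz_onI)
    fix x y
    show "dist (G x) (G y) \<le> 1 / (1 - c) * dist x y"
      using expand[of "G x" "G y"] assms(1) by (simp add: G2 field_simps)
  qed (use assms(1) in auto)
  then have "continuous_on UNIV G" by (rule lipschitz_on_continuous_on)
  moreover have "continuous_on UNIV (\<lambda>x. x + u x)"
    by (intro continuous_intros lipschitz_on_continuous_on[OF lip])
  ultimately have "homeomorphism UNIV UNIV (\<lambda>x. x + u x) G"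
    by (intro homeomorphismI) (auto simp: G1 G2)
  then show ?thesis by blast
qed

lemma ambient_isotopic_id_plus_contraction:
  fixes u :: "real^3 \<Rightarrow> real^3"
  assumes "c < 1" and lip: "c-lipschitz_on UNIV u"
  shows "ambient_isotopic A ((\<lambda>x. x + u x) ` A)"
proof -
  have cu: "continuous_on UNIV u" by (rule lipschitz_on_continuous_on[OF lip])
  have c0: "0 \<le> c" using lip by (rule lipschitz_on_nonneg)
  have "\<exists>G. homeomorphism UNIV UNIV (\<lambda>x. x + t *\<^sub>R u x) G" if "t \<in> {0..1}" for t
  proof (rule homeomorphism_id_plus_contraction)
    show "t * c < 1" using that assms(1) c0 mult_left_le_one_le[of c t] by auto
    show "(t * c)-lipschitz_on UNIV (\<lambda>x. t *\<^sub>R u x)"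
      using lipschitz_on_cmult[OF lip, of t] that by simp
  qed
  then show ?thesis
    unfolding ambient_isotopic_def
    by (intro exI[of _ "\<lambda>p. snd p + fst p *\<^sub>R u (snd p)"])
      (auto intro!: continuous_intros continuous_on_compose2[OF cu])
qed

section \<open>Lipschitz extensions and straight-line homotopies\<close>

lemma lipschitz_extension_real:
  fixes F :: "'i \<Rightarrow> 'a::metric_space" and h :: "'i \<Rightarrow> real"
  assumes "0 \<le> c" and lip: "\<And>x y. x \<in> X \<Longrightarrow> y \<in> X \<Longrightarrow> \<bar>h x - h y\<bar> \<le> c * dist (F x) (F y)"
  shows "\<exists>k. c-lipschitz_on UNIV k \<and> (\<forall>x\<in>X. k (F x) = h x)"
proof (cases "X = {}")
  case True
  then show ?thesis using assms(1)
    by (intro exI[of _ "\<lambda>_. 0"]) (auto intro: lipschitz_onI)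
next
  case False
  then obtain x0 where x0: "x0 \<in> X" by auto
  \<comment> \<open>McShane's extension: the infimum of the upward cones of slope \<open>c\<close>
    with vertices at the data. The data may be indexed by \<open>F\<close>, since \<open>lip\<close>
    forces \<open>h x = h y\<close> whenever \<open>F x = F y\<close>.\<close>
  define k where "k = (\<lambda>z. INF x\<in>X. h x + c * dist z (F x))"
  have bdd: "bdd_below ((\<lambda>x. h x + c * dist z (F x)) ` X)" for z
  proof (rule bdd_belowI2)
    fix x assume "x \<in> X"
    have "\<bar>h x - h x0\<bar> \<le> c * dist (F x) (F x0)" using lip \<open>x \<in> X\<close> x0 by blast
    also have "\<dots> \<le> c * (dist z (F x) + dist z (F x0))"
      using dist_triangle3[of "F x" "F x0" z] assms(1) by (intro mult_left_mono) auto
    finally show "h x0 - c * dist z (F x0) \<le> h x + c * dist z (F x)"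
      by (simp add: algebra_simps)
  qed
  have le: "k z \<le> k w + c * dist z w" for z w
  proof -
    have "k z - c * dist z w \<le> k w"
      unfolding k_def
    proof (rule cINF_greatest[OF False])
      fix x assume "x \<in> X"
      have "(INF x\<in>X. h x + c * dist z (F x)) \<le> h x + c * dist z (F x)"
        by (rule cINF_lower[OF bdd \<open>x \<in> X\<close>])
      also have "\<dots> \<le> h x + c * (dist w (F x) + dist z w)"
        using dist_triangle[of z "F x" w] assms(1)
        by (intro add_left_mono mult_left_mono) (auto simp: algebra_simps)
      finally show "(INF x\<in>X. h x + c * dist z (F x)) - c * dist z w \<le> h x + c * dist w (F x)"
        by (simp add: algebra_simps)
    qed
    then show ?thesis by simp
  qed
  have "c-lipschitz_on UNIV k"
  proof (rule lipschitz_onI)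
    fix z w
    show "dist (k z) (k w) \<le> c * dist z w"
      using le[of z w] le[of w z] by (simp add: dist_real_def abs_le_iff dist_commute)
  qed (rule assms(1))
  moreover have "k (F x) = h x" if "x \<in> X" for x
  proof (rule antisym)
    show "k (F x) \<le> h x"
      unfolding k_def using cINF_lower[OF bdd that, of "F x"] by simp
    show "h x \<le> k (F x)"
      unfolding k_def
    proof (rule cINF_greatest[OF False])
      fix y assume "y \<in> X"
      show "h x \<le> h y + c * dist (F x) (F y)" using lip[OF that \<open>y \<in> X\<close>] by simp
    qed
  qed
  ultimately show ?thesis by blast
qed

text \<open>Each coordinate is extended separately and the norm is bounded by the l1 norm, which is
  where the factor \<open>CARD('n)\<close> comes from. In dimension 3 it leads to the threshold
  \<open>1/3\<close> for displacements below.\<close>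

lemma lipschitz_extension_cart:
  fixes F :: "'i \<Rightarrow> 'a::metric_space" and h :: "'i \<Rightarrow> real^'n" and c :: real
  assumes "0 \<le> c" and lip: "\<And>x y. x \<in> X \<Longrightarrow> y \<in> X \<Longrightarrow> norm (h x - h y) \<le> c * dist (F x) (F y)"
  shows "\<exists>k. (CARD('n) * c)-lipschitz_on UNIV k \<and> (\<forall>x\<in>X. k (F x) = h x)"
proof -
  have "\<exists>k. c-lipschitz_on UNIV k \<and> (\<forall>x\<in>X. k (F x) = h x $ i)" for i
  proof (rule lipschitz_extension_real[OF assms(1)])
    fix x y assume "x \<in> X" "y \<in> X"
    then show "\<bar>h x $ i - h y $ i\<bar> \<le> c * dist (F x) (F y)"
      using lip[of x y] component_le_norm_cart[of "h x - h y" i] by simp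
  qed
  then obtain k where k: "\<And>i. c-lipschitz_on UNIV (k i)" "\<And>i x. x \<in> X \<Longrightarrow> k i (F x) = h x $ i"
    by metis
  have "(CARD('n) * c)-lipschitz_on UNIV (\<lambda>z. \<chi> i. k i z)"
  proof (rule lipschitz_onI)
    fix z w
    have "dist (\<chi> i. k i z) (\<chi> i. k i w) \<le> (\<Sum>i\<in>UNIV. \<bar>k i z - k i w\<bar>)"
      using norm_le_l1_cart[of "(\<chi> i. k i z) - (\<chi> i. k i w)"] by (simp add: dist_norm)
    also have "\<dots> \<le> (\<Sum>i\<in>(UNIV::'n set). c * dist z w)"
      using lipschitz_onD[OF k(1)] by (intro sum_mono) (auto simp: dist_real_def)
    finally show "dist (\<chi> i. k i z) (\<chi> i. k i w) \<le> CARD('n) * c * dist z w" by simp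
  qed (use assms(1) in auto)
  then show ?thesis using k(2) by (intro exI[of _ "\<lambda>z. \<chi> i. k i z"]) (auto simp: vec_eq_iff)
qed

lemma ambient_isotopic_small_displacement:
  fixes F G :: "'i \<Rightarrow> real^3"
  assumes "0 \<le> c" "c < 1/3"
    and lip: "\<And>x y. x \<in> X \<Longrightarrow> y \<in> X \<Longrightarrow> norm ((G x - F x) - (G y - F y)) \<le> c * dist (F x) (F y)"
  shows "ambient_isotopic (F ` X) (G ` X)"
proof -
  obtain u where u: "(CARD(3) * c)-lipschitz_on UNIV u" "\<And>x. x \<in> X \<Longrightarrow> u (F x) = G x - F x"
    using lipschitz_extension_cart[of c X "\<lambda>x. G x - F x" F] assms by metis
  have "ambient_isotopic (F ` X) ((\<lambda>x. x + u x) ` (F ` X))"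
    by (rule ambient_isotopic_id_plus_contraction[OF _ u(1)]) (use assms(2) in simp)
  also have "(\<lambda>x. x + u x) ` (F ` X) = G ` X"
    using u(2) by (force simp: image_image)
  finally show ?thesis .
qed

text \<open>The straight-line homotopy is cut into steps so short that each one displaces points by a
  contraction.\<close>
lemma ambient_isotopic_linear_homotopy:
  fixes F G :: "'i \<Rightarrow> real^3"
  assumes "0 < c"
    and sep: "\<And>x y t. x \<in> X \<Longrightarrow> y \<in> X \<Longrightarrow> 0 \<le> t \<Longrightarrow> t \<le> 1 \<Longrightarrow>
       c * norm ((G x - F x) - (G y - F y)) \<le> norm ((F x - F y) + t *\<^sub>R ((G x - F x) - (G y - F y)))"
  shows "ambient_isotopic (F ` X) (G ` X)"
proof -
  \<comment> \<open>With \<open>N > 4 / c\<close> one step changes relative positions by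
    \<open>norm d / N\<close>, at most a quarter of the distance \<open>c * norm d\<close> that
    \<open>sep\<close> guarantees at \<open>t = k / N\<close>; and \<open>1/4 < 1/3\<close>.\<close>
  obtain N :: nat where N: "4 / c < real N" using reals_Archimedean2 by blast
  then have N0: "N > 0" using assms(1) by (cases N) (auto simp: field_simps)
  define S where "S = (\<lambda>k x. F x + (real k / real N) *\<^sub>R (G x - F x))"
  have step: "ambient_isotopic (S k ` X) (S (Suc k) ` X)" if "k < N" for k
  proof (rule ambient_isotopic_small_displacement[of "1/4"])
    fix x y assume xy: "x \<in> X" "y \<in> X"
    define d where "d = (G x - F x) - (G y - F y)"
    have 1: "(S (Suc k) x - S k x) - (S (Suc k) y - S k y) = (1 / real N) *\<^sub>R d"
      unfolding S_def d_def by (simp add: add_divide_distrib algebra_simps)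
    have 2: "S k x - S k y = (F x - F y) + (real k / real N) *\<^sub>R d"
      unfolding S_def d_def by (simp add: algebra_simps)
    have "c * norm d \<le> dist (S k x) (S k y)"
      unfolding dist_norm 2 unfolding d_def by (rule sep[OF xy]) (use that in auto)
    moreover have "norm d / real N \<le> 1/4 * (c * norm d)"
    proof -
      have "4 \<le> c * real N" using N assms(1) by (simp add: field_simps)
      then have "4 * norm d \<le> (c * real N) * norm d" by (intro mult_right_mono) auto
      then show ?thesis using N0 by (simp add: field_simps)
    qed
    ultimately show "norm ((S (Suc k) x - S k x) - (S (Suc k) y - S k y)) \<le> 1/4 * dist (S k x) (S k y)"
      unfolding 1 by simp
  qed auto
  have "ambient_isotopic (S 0 ` X) (S k ` X)" if "k \<le> N" for k
    using that
  proof (induction k)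
    case 0
    show ?case by (rule ambient_isotopic_refl)
  next
    case (Suc k)
    then show ?case using ambient_isotopic_trans step by (meson Suc_le_lessD less_imp_le)
  qed
  from this[of N] show ?thesis using N0 by (simp add: S_def)
qed

subsection \<open>Components of links\<close>

text \<open>The other members form a closed set disjoint from the closed set \<open>C\<close>, so a
  connected set that contains \<open>C\<close> and stays in the union cannot reach them: each member
  is a maximal connected subset.\<close>

lemma components_Union_disjoint_compact:
  fixes \<C> :: "'a::t2_space set set"
  assumes "finite \<C>" "\<And>C. C \<in> \<C> \<Longrightarrow> compact C \<and> connected C \<and> C \<noteq> {}" "pairwise disjnt \<C>"
  shows "components (\<Union>\<C>) = \<C>"
proof -
  have sub: "\<C> \<subseteq> components (\<Union>\<C>)"
  proof
    fix C assume C: "C \<in> \<C>"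
    have "D \<subseteq> C" if D: "connected D" "C \<subseteq> D" "D \<subseteq> \<Union>\<C>" for D
    proof -
      have "closed C" "closed (\<Union>(\<C> - {C}))"
        using assms C by (auto intro!: compact_imp_closed compact_Union)
      moreover have "C \<inter> \<Union>(\<C> - {C}) = {}"
        using assms(3) C by (auto simp: pairwise_def disjnt_def)
      moreover have "D \<subseteq> C \<union> \<Union>(\<C> - {C})" using D(3) by auto
      moreover have "C \<inter> D \<noteq> {}" using assms(2)[OF C] D(2) by auto
      ultimately have "\<Union>(\<C> - {C}) \<inter> D = {}"
        using D(1) unfolding connected_closed by blast
      then show ?thesis using D(3) by fast
    qed
    then show "C \<in> components (\<Union>\<C>)"
      using assms(2)[OF C] C by (auto simp: in_components_maximal)
  qed
  have "components (\<Union>\<C>) \<subseteq> \<C>"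
  proof
    fix D assume D: "D \<in> components (\<Union>\<C>)"
    then obtain x where "x \<in> D" using in_components_nonempty by blast
    then obtain C where "C \<in> \<C>" "x \<in> C" using in_components_subset[OF D] by auto
    then have "C = D" using components_eq[of C "\<Union>\<C>" D] D sub \<open>x \<in> D\<close> by auto
    then show "D \<in> \<C>" using \<open>C \<in> \<C>\<close> by simp
  qed
  with sub show ?thesis by auto
qed

lemma card_eq_if_homeomorphic_Unions:
  fixes h :: "'a::t2_space \<Rightarrow> 'b::t2_space"
  assumes fin: "finite \<C>" "finite \<P>"
    and C: "\<And>C. C \<in> \<C> \<Longrightarrow> compact C \<and> connected C \<and> C \<noteq> {}" "pairwise disjnt \<C>"
    and P: "\<And>C. C \<in> \<P> \<Longrightarrow> compact C \<and> connected C \<and> C \<noteq> {}" "pairwise disjnt \<P>"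
    and h: "homeomorphism UNIV UNIV h k" "h ` \<Union>\<C> = \<Union>\<P>"
  shows "card \<C> = card \<P>"
proof -
  have inj: "inj h" using homeomorphism_apply1[OF h(1)] by (metis UNIV_I injI)
  have cont: "continuous_on UNIV h" using h(1) by (rule homeomorphism_cont1)
  define \<D> where "\<D> = (`) h ` \<C>"
  have "components (\<Union>\<D>) = \<D>"
  proof (rule components_Union_disjoint_compact)
    show "pairwise disjnt \<D>"
      unfolding pairwise_def disjnt_def \<D>_def
    proof (clarify)
      fix A B assume "A \<in> \<C>" "B \<in> \<C>" "h ` A \<noteq> h ` B"
      then have "A \<inter> B = {}" using C(2) unfolding pairwise_def disjnt_def by metis
      then show "h ` A \<inter> h ` B = {}" using image_Int[OF inj, of A B] by simp
    qed
    show "compact D \<and> connected D \<and> D \<noteq> {}" if "D \<in> \<D>" for D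
      using that C(1) unfolding \<D>_def
      by (auto intro!: compact_continuous_image connected_continuous_image
          continuous_on_subset[OF cont])
  qed (use fin in \<open>simp add: \<D>_def\<close>)
  moreover have "\<Union>\<D> = \<Union>\<P>" unfolding \<D>_def h(2)[symmetric] by auto
  moreover have "components (\<Union>\<P>) = \<P>"
    by (rule components_Union_disjoint_compact) (use fin P in auto)
  ultimately have "\<D> = \<P>" by simp
  moreover have "card \<D> = card \<C>"
    unfolding \<D>_def by (rule card_image) (meson inj inj_image_eq_iff inj_onI)
  ultimately show ?thesis by simp
qed

lemma simple_closed_curve_topology:
  assumes "simple_closed_curve C"
  shows "compact C \<and> connected C \<and> C \<noteq> {}"
proof -
  obtain g where "simple_path g" "C = path_image g"
    using assms unfolding simple_closed_curve_def by auto
  then show ?thesis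
    by (simp add: compact_simple_path_image connected_simple_path_image)
qed

lemma simple_closed_polygon_imp_curve: "simple_closed_polygon P \<Longrightarrow> simple_closed_curve P"
  unfolding simple_closed_curve_def simple_closed_polygon_def by blast

text \<open>\<open>tame\<close> does not say how many polygons there are. Their number is recovered
  as the number of connected components, which the final homeomorphism of the isotopy
  preserves.\<close>

lemma tame_link_polygons:
  assumes "link m L" "tame L"
  obtains \<P> where "finite \<P>" "card \<P> = m" "\<And>P. P \<in> \<P> \<Longrightarrow> simple_closed_polygon P"
    "pairwise disjnt \<P>" "ambient_isotopic L (\<Union>\<P>)"
proof -
  obtain \<C> where C: "finite \<C>" "card \<C> = m" "\<And>C. C\<in>\<C> \<Longrightarrow> simple_closed_curve C"
    "pairwise disjnt \<C>" "L = \<Union>\<C>" using assms(1) unfolding link_def by blast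
  obtain \<P> where P: "finite \<P>" "\<And>P. P\<in>\<P> \<Longrightarrow> simple_closed_polygon P"
    "pairwise disjnt \<P>" "ambient_isotopic L (\<Union>\<P>)"
    using assms(2) unfolding tame_def by blast
  obtain H :: "real \<times> (real^3) \<Rightarrow> real^3" where
    "continuous_on ({0..1} \<times> UNIV) H" and
    H: "\<And>t. t \<in> {0..1} \<Longrightarrow> \<exists>G. homeomorphism UNIV UNIV (\<lambda>x. H (t, x)) G"
    and "\<And>x. H (0, x) = x" and HL: "(\<lambda>x. H (1, x)) ` L = \<Union>\<P>"
    using ambient_isotopicE[OF P(4)] by metis
  obtain G where G: "homeomorphism UNIV UNIV (\<lambda>x. H (1, x)) G"
    using H[of 1] by auto
  have "card \<C> = card \<P>"
  proof (rule card_eq_if_homeomorphic_Unions)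
    show "compact C \<and> connected C \<and> C \<noteq> {}" if "C \<in> \<C>" for C
      by (rule simple_closed_curve_topology[OF C(3)[OF that]])
    show "compact C \<and> connected C \<and> C \<noteq> {}" if "C \<in> \<P>" for C
      by (rule simple_closed_curve_topology[OF simple_closed_polygon_imp_curve[OF P(2)[OF that]]])
    show "(\<lambda>x. H (1, x)) ` \<Union>\<C> = \<Union>\<P>" using HL C(5) by simp
  qed (fact C P G)+
  then show ?thesis using that[of \<P>] P C by simp
qed

subsection \<open>Polygons\<close>

text \<open>Vertices are indexed by all integers, so that for a periodic \<open>v\<close> the vertex
  where the polygon closes up is like any other. Applied to a sequence of reals, the same definition
  gives piecewise linear time changes.\<close>

definition broken_line :: "(int \<Rightarrow> 'a::real_vector) \<Rightarrow> real \<Rightarrow> 'a" where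
  "broken_line v s = v \<lfloor>s\<rfloor> + (s - of_int \<lfloor>s\<rfloor>) *\<^sub>R (v (\<lfloor>s\<rfloor> + 1) - v \<lfloor>s\<rfloor>)"

lemma broken_line_eq:
  assumes "of_int i \<le> s" "s \<le> of_int i + 1"
  shows "broken_line v s = v i + (s - of_int i) *\<^sub>R (v (i + 1) - v i)"
proof (cases "s = of_int i + 1")
  case True
  then have "\<lfloor>s\<rfloor> = i + 1" by linarith
  then show ?thesis using True by (simp add: broken_line_def)
next
  case False
  then have "\<lfloor>s\<rfloor> = i" using assms by linarith
  then show ?thesis by (simp add: broken_line_def)
qed

lemma shift_periodic_int:
  fixes v :: "int \<Rightarrow> 'a"
  assumes "\<And>i. v (i + n) = v i"
  shows "v (i + k * n) = v i"
proof -
  have *: "v (i + int j * n) = v i" for i j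
  proof (induction j)
    case (Suc j)
    then show ?case using assms[of "i + int j * n"] by (simp add: algebra_simps)
  qed simp
  show ?thesis
  proof (cases "k \<ge> 0")
    case True
    then show ?thesis using *[of i "nat k"] by simp
  next
    case False
    then show ?thesis using *[of "i + k * n" "nat (- k)"] by simp
  qed
qed

lemma broken_line_shift:
  assumes "\<And>i. v (i + n) = v i"
  shows "broken_line v (s + of_int k * of_int n) = broken_line v s"
proof -
  have *: "\<lfloor>s + of_int k * of_int n\<rfloor> = \<lfloor>s\<rfloor> + k * n"
    by (metis floor_add_int of_int_mult)
  have "v (\<lfloor>s\<rfloor> + k * n + 1) = v (\<lfloor>s\<rfloor> + 1)"
    using shift_periodic_int[of v n "\<lfloor>s\<rfloor> + 1" k] assms by (simp add: algebra_simps)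
  then show ?thesis
    unfolding broken_line_def * using shift_periodic_int[of v n "\<lfloor>s\<rfloor>" k] assms by simp
qed

text \<open>Each \<open>+++\<close> spends half of the parameter interval on the first edge and
  squeezes all others into the second half; \<phi> undoes this and gives every edge unit time. A
  list of \<open>k + 2\<close> vertices has \<open>k + 1\<close> edges, numbered from 0 to
  \<open>k\<close>.\<close>

lemma polygonal_path_reparam:
  assumes "length vs = Suc (Suc k)"
  shows "\<exists>\<phi>. \<phi> 0 = 0 \<and> \<phi> (real k + 1) = (1::real) \<and> strict_mono_on {0..real k + 1} \<phi> \<and>
    continuous_on {0..real k + 1} \<phi> \<and>
    (\<forall>i\<le>k. \<forall>u\<in>{0..1}. polygonal_path vs (\<phi> (real i + u)) = linepath (vs ! i) (vs ! Suc i) u)"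
  using assms
proof (induction k arbitrary: vs)
  case 0
  then obtain a b where "vs = [a, b]" by (auto simp: length_Suc_conv)
  then show ?case by (intro exI[of _ "\<lambda>s. s"]) (auto simp: strict_mono_on_def)
next
  case (Suc k)
  then obtain a b c ws where vs: "vs = a # b # c # ws" by (auto simp: length_Suc_conv)
  obtain \<psi> where \<psi>: "\<psi> 0 = 0" "\<psi> (real k + 1) = (1::real)" "strict_mono_on {0..real k + 1} \<psi>"
    "continuous_on {0..real k + 1} \<psi>"
    and pw: "\<And>i u. i \<le> k \<Longrightarrow> u \<in> {0..1} \<Longrightarrow>
      polygonal_path (b # c # ws) (\<psi> (real i + u)) = linepath ((b # c # ws) ! i) ((b # c # ws) ! Suc i) u"
    using Suc.IH[of "b # c # ws"] Suc.prems vs by auto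
  have pos: "0 < \<psi> s" if "0 < s" "s \<le> real k + 1" for s
    using strict_mono_onD[OF \<psi>(3), of 0 s] that \<psi>(1) by auto
  define \<phi> where "\<phi> = (\<lambda>s. if s \<le> 1 then s / 2 else 1/2 + \<psi> (s - 1) / 2)"
  have sm: "strict_mono_on {0..real (Suc k) + 1} \<phi>"
  proof (rule strict_mono_onI)
    fix r s assume rs: "r \<in> {0..real (Suc k) + 1}" "s \<in> {0..real (Suc k) + 1}" "r < s"
    consider "s \<le> 1" | "r \<le> 1" "1 < s" | "1 < r" by linarith
    then show "\<phi> r < \<phi> s"
    proof cases
      case 2
      then show ?thesis using pos[of "s - 1"] rs by (auto simp: \<phi>_def)
    next
      case 3
      then show ?thesis using strict_mono_onD[OF \<psi>(3), of "r - 1" "s - 1"] rs by (auto simp: \<phi>_def)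
    qed (use rs in \<open>auto simp: \<phi>_def\<close>)
  qed
  have "continuous_on ({0..1} \<union> {1..real (Suc k) + 1}) \<phi>"
    unfolding \<phi>_def
  proof (rule continuous_on_cases)
    show "continuous_on {1..real (Suc k) + 1} (\<lambda>s. 1/2 + \<psi> (s - 1) / 2)"
      by (intro continuous_intros continuous_on_compose2[OF \<psi>(4)]) auto
    have "s = 1" if "s \<in> {0..1} \<and> \<not> s \<le> 1 \<or> s \<in> {1..real (Suc k) + 1} \<and> s \<le> 1" for s
      using that by auto
    then show "\<forall>s. s \<in> {0..1} \<and> \<not> s \<le> 1 \<or> s \<in> {1..real (Suc k) + 1} \<and> s \<le> 1 \<longrightarrow>
        s / 2 = 1/2 + \<psi> (s - 1) / 2"
      using \<psi>(1) by force
  qed (auto intro!: continuous_intros)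
  moreover have "{0..1} \<union> {1..real (Suc k) + 1} = {0..real (Suc k) + 1}" by auto
  ultimately have cont: "continuous_on {0..real (Suc k) + 1} \<phi>" by simp
  have "polygonal_path vs (\<phi> (real i + u)) = linepath (vs ! i) (vs ! Suc i) u"
    if iu: "i \<le> Suc k" "u \<in> {0..1}" for i u
  proof (cases i)
    case 0
    then show ?thesis using iu by (auto simp: \<phi>_def vs joinpaths_def)
  next
    case (Suc j)
    show ?thesis
    \<comment> \<open>In this case \<phi> takes the value 1/2, which \<open>joinpaths\<close>
      assigns to the first edge, so the common vertex is read off as the end of that edge and not as
      the start of the rest.\<close>
    proof (cases "j = 0 \<and> u = 0")
      case True
      then show ?thesis using Suc by (simp add: \<phi>_def vs joinpaths_def linepath_def)
    next
      case False
      then have "real j + u > 0" using iu by (metis add_cancel_right_left add_nonneg_pos add_pos_nonneg atLeastAtMost_iff less_eq_real_def of_nat_0_less_iff gr0I of_nat_0_le_iff)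
      moreover have "real j + u \<le> real k + 1" using iu Suc by auto
      ultimately have "0 < \<psi> (real j + u)" using pos by auto
      moreover have "polygonal_path (b # c # ws) (\<psi> (real j + u)) = linepath ((b # c # ws) ! j) ((b # c # ws) ! Suc j) u"
        using pw iu Suc by auto
      ultimately show ?thesis
        using Suc \<open>real j + u > 0\<close> by (simp add: \<phi>_def vs joinpaths_def)
    qed
  qed
  then have "\<forall>i\<le>Suc k. \<forall>u\<in>{0..1}. polygonal_path vs (\<phi> (real i + u)) = linepath (vs ! i) (vs ! Suc i) u"
    by blast
  moreover have "\<phi> 0 = 0" "\<phi> (real (Suc k) + 1) = 1" using \<psi>(2) by (auto simp: \<phi>_def add.commute)
  ultimately show ?case using sm cont by blast
qed

text \<open>Simplicity becomes injectivity modulo the period. After reduction of both parameters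
  into \<open>[0, n)\<close> the values of \<phi> stay below 1, so the pair 0, 1 that
  \<open>loop_free\<close> exempts cannot occur.\<close>

lemma simple_closed_polygon_broken_line:
  assumes "simple_closed_polygon P"
  obtains n :: int and v where "n > 0" "\<And>i. v (i + n) = v i" "P = range (broken_line v)"
    "\<And>s t. broken_line v s = broken_line v t \<Longrightarrow> \<exists>k. s - t = of_int k * of_int n"
proof -
  obtain vs where vs: "simple_path (polygonal_path vs)"
    "pathfinish (polygonal_path vs) = pathstart (polygonal_path vs)"
    "P = path_image (polygonal_path vs)"
    using assms unfolding simple_closed_polygon_def by blast
  have const: "\<not> simple_path (linepath a a :: real \<Rightarrow> real^3)" for a
  proof
    assume "simple_path (linepath a a)"
    then show False
      unfolding simple_path_def loop_free_def linepath_refl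
      by (metis (no_types) atLeastAtMost_iff half_gt_zero_iff less_eq_real_def linorder_not_le
          field_sum_of_halves less_add_same_cancel1 zero_less_one zero_neq_one half_bounded_equal)
  qed
  have "length vs \<noteq> 0" "length vs \<noteq> 1"
    using vs(1) const[of 0] const[of "hd vs"] by (auto simp: length_Suc_conv)
  then obtain k where k: "length vs = Suc (Suc k)"
    by (metis One_nat_def not0_implies_Suc)
  define Q where "Q = polygonal_path vs"
  obtain \<phi> where \<phi>: "\<phi> 0 = 0" "\<phi> (real k + 1) = (1::real)" "strict_mono_on {0..real k + 1} \<phi>"
    "continuous_on {0..real k + 1} \<phi>"
    and pw: "\<And>i u. i \<le> k \<Longrightarrow> u \<in> {0..1} \<Longrightarrow> Q (\<phi> (real i + u)) = linepath (vs ! i) (vs ! Suc i) u"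
    using polygonal_path_reparam[OF k] unfolding Q_def by blast
  define n where "n = int k + 1"
  have n0: "n > 0" by (simp add: n_def)
  \<comment> \<open>The last entry of \<open>vs\<close> has index \<open>n\<close> and repeats entry
    0, so the indices modulo \<open>n\<close> list the vertices of the closed polygon without that
    repetition.\<close>
  define v where "v = (\<lambda>i. vs ! nat (i mod n))"
  have per: "v (i + n) = v i" for i by (simp add: v_def)
  have lin: "linepath a b u = a + u *\<^sub>R (b - a)" for a b :: "real^3" and u
    by (simp add: linepath_def algebra_simps)
  have Q0: "Q (\<phi> 0) = vs ! 0" using pw[of 0 0] by (simp add: linepath_def)
  have Qn: "Q (\<phi> (real k + 1)) = vs ! Suc k" using pw[of k 1] by (simp add: linepath_def)
  have closed: "vs ! Suc k = vs ! 0"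
    using vs(2) Q0 Qn \<phi> unfolding Q_def pathfinish_def pathstart_def by simp
  have plQ: "broken_line v s = Q (\<phi> s)" if s: "0 \<le> s" "s \<le> real k + 1" for s
  proof (cases "s = real k + 1")
    case True
    then have "s = of_int n" by (simp add: n_def)
    then have "broken_line v s = v n" using broken_line_eq[of n s v] by simp
    then show ?thesis using True Qn closed by (simp add: v_def)
  next
    case False
    define i where "i = nat \<lfloor>s\<rfloor>"
    have i: "int i = \<lfloor>s\<rfloor>" using s by (simp add: i_def)
    then have ik: "i \<le> k" using s False by linarith
    have "broken_line v s = v (int i) + (s - real i) *\<^sub>R (v (int i + 1) - v (int i))"
      by (simp add: broken_line_def i[symmetric])
    moreover have "v (int i) = vs ! i" using ik by (simp add: v_def n_def)
    moreover have "v (int i + 1) = vs ! Suc i"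
    proof (cases "i = k")
      case True
      then have "v (int i + 1) = v n" by (simp add: n_def)
      then show ?thesis using True closed by (simp add: v_def)
    next
      case False
      then show ?thesis using ik by (simp add: v_def n_def nat_add_distrib)
    qed
    moreover have "Q (\<phi> s) = linepath (vs ! i) (vs ! Suc i) (s - real i)"
      using pw[OF ik, of "s - real i"] i s by (simp add: of_int_floor_le) linarith
    ultimately show ?thesis by (simp add: lin)
  qed
  define red where "red = (\<lambda>s. s - of_int \<lfloor>s / of_int n\<rfloor> * (of_int n :: real))"
  have red: "0 \<le> red s" "red s < real k + 1" "broken_line v (red s) = broken_line v s" for s
  proof -
    have "of_int \<lfloor>s / of_int n\<rfloor> \<le> s / of_int n" "s / of_int n < of_int \<lfloor>s / of_int n\<rfloor> + 1"
      by linarith+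
    then have "of_int \<lfloor>s / of_int n\<rfloor> * of_int n \<le> s" "s < (of_int \<lfloor>s / of_int n\<rfloor> + 1) * of_int n"
      using pos_le_divide_eq[of "of_int n :: real"] pos_divide_less_eq[of "of_int n :: real"] n0
      by (auto simp only: of_int_0_less_iff)
    then show "0 \<le> red s" "red s < real k + 1" by (auto simp: red_def n_def algebra_simps)
    show "broken_line v (red s) = broken_line v s"
      using broken_line_shift[of v n s "- \<lfloor>s / of_int n\<rfloor>"] per by (simp add: red_def)
  qed
  have \<phi>_mono: "\<phi> s < \<phi> t" if "0 \<le> s" "s < t" "t \<le> real k + 1" for s t
    using strict_mono_onD[OF \<phi>(3), of s t] that by auto
  have \<phi>_range: "0 \<le> \<phi> s" "\<phi> s < 1" if "0 \<le> s" "s < real k + 1" for s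
    using \<phi>_mono[of 0 s] \<phi>_mono[of s "real k + 1"] that \<phi>(1,2) by (cases "s = 0", auto)+
  have "\<exists>k. s - t = of_int k * of_int n" if st: "broken_line v s = broken_line v t" for s t
  proof -
    have "Q (\<phi> (red s)) = Q (\<phi> (red t))" using st red plQ by (metis less_eq_real_def)
    then have "\<phi> (red s) = \<phi> (red t)"
      using vs(1) \<phi>_range red unfolding simple_path_def loop_free_def Q_def
      by (metis (no_types, lifting) atLeastAtMost_iff less_eq_real_def order_less_irrefl)
    then have "red s = red t"
      using \<phi>_mono red by (metis less_eq_real_def linorder_neqE_linordered_idom order_less_irrefl)
    then have "s - t = of_int (\<lfloor>s / of_int n\<rfloor> - \<lfloor>t / of_int n\<rfloor>) * of_int n"
      by (simp add: red_def algebra_simps)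
    then show ?thesis by blast
  qed
  moreover have "P = range (broken_line v)"
  proof
    show "range (broken_line v) \<subseteq> P"
    proof clarify
      fix s
      have "\<phi> (red s) \<in> {0..1}" using \<phi>_range[of "red s"] red[of s] by auto
      moreover have "broken_line v s = Q (\<phi> (red s))" using plQ[of "red s"] red[of s] by auto
      ultimately show "broken_line v s \<in> P" unfolding vs(3) path_image_def Q_def by blast
    qed
    show "P \<subseteq> range (broken_line v)"
    proof
      fix x assume "x \<in> P"
      then obtain u where u: "0 \<le> u" "u \<le> 1" "x = Q u"
        unfolding vs(3) path_image_def Q_def by auto
      then obtain s where "0 \<le> s" "s \<le> real k + 1" "\<phi> s = u"
        using IVT'[of \<phi> 0 u "real k + 1"] \<phi> by auto
      then show "x \<in> range (broken_line v)" using u plQ by (metis rangeI)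
    qed
  qed
  ultimately show ?thesis using that[OF n0, of v] per by blast
qed

text \<open>A degenerate edge or a reversal of direction would give the same point at two parameters
  less than 1 apart, whereas parameters of equal points differ by a multiple of the integer
  \<open>n \<ge> 1\<close>.\<close>

lemma broken_line_injective_edges:
  fixes v :: "int \<Rightarrow> 'a::real_normed_vector"
  assumes n: "n > 0"
    and inj: "\<And>s t. broken_line v s = broken_line v t \<Longrightarrow> \<exists>k. s - t = of_int k * of_int n"
  shows "v (i + 1) \<noteq> v i" and "sgn (v (i + 2) - v (i + 1)) \<noteq> - sgn (v (i + 1) - v i)"
proof -
  have small: "broken_line v s \<noteq> broken_line v t" if "0 < s - t" "s - t < 1" for s t
  proof
    assume "broken_line v s = broken_line v t"
    then obtain k :: int where k: "s - t = of_int k * of_int n" using inj by blast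
    then have "0 < (of_int (k * n) :: real)" "(of_int (k * n) :: real) < 1" using that by simp_all
    then have "0 < k * n" "k * n < 1" by (simp_all only: of_int_0_less_iff of_int_less_1_iff)
    then show False by linarith
  qed
  have edge: "broken_line v s = v i + (s - of_int i) *\<^sub>R (v (i + 1) - v i)" if "of_int i \<le> s" "s \<le> of_int i + 1" for s i
    using broken_line_eq that by blast
  show ne: "v (i + 1) \<noteq> v i" for i
  proof
    assume "v (i + 1) = v i"
    then have "broken_line v (of_int i + 1/2) = broken_line v (of_int i)" by (simp add: edge[of i])
    then show False using small[of "of_int i + 1/2" "of_int i"] by simp
  qed
  show "sgn (v (i + 2) - v (i + 1)) \<noteq> - sgn (v (i + 1) - v i)"
  proof
    assume opp: "sgn (v (i + 2) - v (i + 1)) = - sgn (v (i + 1) - v i)"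
    define p where "p = norm (v (i + 1) - v i)"
    define q where "q = norm (v (i + 2) - v (i + 1))"
    have pq: "p > 0" "q > 0" using ne[of i] ne[of "i + 1"] by (auto simp: p_def q_def algebra_simps)
    \<comment> \<open>A length that fits into a third of either edge: the parameters reached by
      going back \<open>u\<close> on the incoming edge and forward \<open>u\<close> on the outgoing
      one differ by at most 2/3.\<close>
    define u where "u = min p q / 3"
    have u: "0 < u" "u / p \<le> 1/3" "u / q \<le> 1/3" using pq by (auto simp: u_def field_simps)
    have 1: "v (i + 1) - v i = p *\<^sub>R sgn (v (i + 1) - v i)"
      using ne[of i] by (simp add: p_def sgn_div_norm)
    have 2: "v (i + 2) - v (i + 1) = - q *\<^sub>R sgn (v (i + 1) - v i)"
    proof -
      have "v (i + 2) - v (i + 1) = q *\<^sub>R sgn (v (i + 2) - v (i + 1))"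
        using pq by (simp add: q_def sgn_div_norm)
      then show ?thesis unfolding opp by simp
    qed
    have "broken_line v (of_int i + 1 + u / q) = v (i + 1) + (u / q) *\<^sub>R (v (i + 2) - v (i + 1))"
      using edge[of "i + 1" "of_int i + 1 + u / q"] u pq by (simp add: add.assoc)
    also have "\<dots> = v (i + 1) - u *\<^sub>R sgn (v (i + 1) - v i)"
      unfolding 2 using pq by simp
    also have "\<dots> = v i + (1 - u / p) *\<^sub>R (v (i + 1) - v i)"
    proof -
      have "v (i + 1) - u *\<^sub>R sgn (v (i + 1) - v i) = v i + (v (i + 1) - v i) - (u / p) *\<^sub>R (p *\<^sub>R sgn (v (i + 1) - v i))"
        using pq by simp
      then show ?thesis unfolding 1[symmetric] by (simp add: algebra_simps)
    qed
    also have "\<dots> = broken_line v (of_int i + 1 - u / p)"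
      using edge[of i "of_int i + 1 - u / p"] u pq by (simp add: algebra_simps)
    finally have "broken_line v (of_int i + 1 + u / q) = broken_line v (of_int i + 1 - u / p)" .
    moreover have "0 < u / q" "0 < u / p" using u pq by simp_all
    ultimately show False using small[of "of_int i + 1 + u / q" "of_int i + 1 - u / p"] u(2,3) by simp
  qed
qed

subsection \<open>Curves of curvature 1\<close>

definition join :: "real \<Rightarrow> (real \<Rightarrow> 'a) \<Rightarrow> (real \<Rightarrow> 'a) \<Rightarrow> real \<Rightarrow> 'a" where
  "join l f g s = (if s \<le> l then f s else g (s - l))"

lemma join_simps:
  assumes "0 \<le> l" "f l = g 0"
  shows "s \<le> l \<Longrightarrow> join l f g s = f s" "l \<le> s \<Longrightarrow> join l f g s = g (s - l)"
  using assms by (auto simp: join_def)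

lemma continuous_on_join:
  assumes "0 \<le> l" "0 \<le> m" "continuous_on {0..l} f" "continuous_on {0..m} g" "f l = g 0"
  shows "continuous_on {0..l + m} (join l f g)"
proof -
  have "continuous_on ({0..l} \<union> {l..l + m}) (join l f g)"
    unfolding join_def
  proof (rule continuous_on_cases)
    show "continuous_on {l..l + m} (\<lambda>s. g (s - l))"
      by (intro continuous_on_compose2[OF assms(4)] continuous_intros) auto
    have "s = l" if "s \<in> {0..l} \<and> \<not> s \<le> l \<or> s \<in> {l..l + m} \<and> s \<le> l" for s
      using that by auto
    then show "\<forall>s. s \<in> {0..l} \<and> \<not> s \<le> l \<or> s \<in> {l..l + m} \<and> s \<le> l \<longrightarrow> f s = g (s - l)"
      using assms(5) by force
  qed (use assms in auto)
  moreover have "{0..l} \<union> {l..l + m} = {0..l + m}" using assms by auto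
  ultimately show ?thesis by simp
qed

lemma has_vector_derivative_shift:
  assumes "(g has_vector_derivative d) (at (s - a) within {0..m})" "b = a + m"
  shows "((\<lambda>s. g (s - a)) has_vector_derivative d) (at s within {a..b})"
proof -
  have "(\<lambda>s. s - a) ` {a..b} \<subseteq> {0..m}" using assms(2) by auto
  then have "(g has_vector_derivative d) (at (s - a) within (\<lambda>s. s - a) ` {a..b})"
    using assms(1) has_vector_derivative_within_subset by blast
  moreover have "((\<lambda>s. s - a) has_vector_derivative 1) (at s within {a..b})"
    by (auto intro!: derivative_eq_intros)
  ultimately have "(g \<circ> (\<lambda>s. s - a) has_vector_derivative 1 *\<^sub>R d) (at s within {a..b})"
    by (rule vector_diff_chain_within[rotated])
  then show ?thesis by (simp add: o_def)
qed

lemma has_vector_derivative_join: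
  assumes lm: "0 \<le> l" "0 \<le> m"
    and f: "\<And>s. s \<in> {0..l} \<Longrightarrow> (f has_vector_derivative f' s) (at s within {0..l})"
    and g: "\<And>s. s \<in> {0..m} \<Longrightarrow> (g has_vector_derivative g' s) (at s within {0..m})"
    and eq: "f l = g 0" "f' l = g' 0" and s: "s \<in> {0..l + m}"
  shows "(join l f g has_vector_derivative join l f' g' s) (at s within {0..l + m})"
proof -
  have g2: "((\<lambda>s. g (s - l)) has_vector_derivative g' (s - l)) (at s within {l..l + m})"
    if "s \<in> {l..l + m}" for s
    using g[of "s - l"] that by (intro has_vector_derivative_shift) auto
  have un: "{0..l + m} = {0..l} \<union> {l..l + m}" using lm by auto
  have cl: "closure {0..l} \<inter> closure {l..l + m} = {l}" using lm by auto
  have "((\<lambda>s. if s \<in> {0..l} then f s else g (s - l)) has_vector_derivative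
      (if s \<in> {0..l} then f' s else g' (s - l))) (at s within {0..l + m})"
  proof (rule has_vector_derivative_If_within_closures[OF _ un])
    show "s \<in> {0..l} \<union> {l..l + m}" using s un by simp
    have "{0..l} \<union> {l} = {0..l}" "{l..l + m} \<union> {l} = {l..l + m}" using lm by auto
    then show "s \<in> {0..l} \<union> closure {0..l} \<inter> closure {l..l + m} \<Longrightarrow>
        (f has_vector_derivative f' s) (at s within {0..l} \<union> closure {0..l} \<inter> closure {l..l + m})"
      "s \<in> {l..l + m} \<union> closure {0..l} \<inter> closure {l..l + m} \<Longrightarrow>
        ((\<lambda>s. g (s - l)) has_vector_derivative g' (s - l))
          (at s within {l..l + m} \<union> closure {0..l} \<inter> closure {l..l + m})"
      unfolding cl using f[of s] g2[of s] lm by auto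
    have "s = l" if "s \<in> closure {0..l}" "s \<in> closure {l..l + m}" using that by simp
    then show "s \<in> closure {0..l} \<Longrightarrow> s \<in> closure {l..l + m} \<Longrightarrow> f s = g (s - l)"
      "s \<in> closure {0..l} \<Longrightarrow> s \<in> closure {l..l + m} \<Longrightarrow> f' s = g' (s - l)"
      using eq by auto
  qed
  then have *: "((\<lambda>s. if s \<in> {0..l} then f s else g (s - l)) has_vector_derivative
      join l f' g' s) (at s within {0..l + m})"
    using s by (simp add: join_def)
  show ?thesis
    by (rule has_vector_derivative_transform[OF s _ *]) (auto simp: join_def)
qed

text \<open>\<open>p\<close> is the position, \<open>T\<close> the tangent and \<open>D\<close> the
  acceleration; \<open>D\<close> is recorded because a joint of class C^2 requires equal
  accelerations. Derivatives within \<open>{0..l}\<close> are one-sided at the ends, and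
  \<open>l = 0\<close> is allowed for a turn between edges of equal direction.\<close>

definition unit_curvature_curve ::
  "real \<Rightarrow> (real \<Rightarrow> real^3) \<Rightarrow> (real \<Rightarrow> real^3) \<Rightarrow> (real \<Rightarrow> real^3) \<Rightarrow> bool" where
  "unit_curvature_curve l p T D \<longleftrightarrow> 0 \<le> l \<and> continuous_on {0..l} D \<and>
     (\<forall>s\<in>{0..l}. (p has_vector_derivative T s) (at s within {0..l}) \<and>
                 (T has_vector_derivative D s) (at s within {0..l}) \<and>
                 norm (T s) = 1 \<and> norm (D s) = 1)"

text \<open>A state consists of a tangent vector and its derivative; \<open>w\<close> is the displacement of the curve.\<close>
definition arc_to ::
  "(real^3) set \<Rightarrow> (real^3) \<times> (real^3) \<Rightarrow> (real^3) \<times> (real^3) \<Rightarrow> real \<Rightarrow> real^3 \<Rightarrow> bool" where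
  "arc_to U x y l w \<longleftrightarrow> (\<exists>p T D. unit_curvature_curve l p T D \<and> (T 0, D 0) = x \<and> (T l, D l) = y \<and>
     p 0 = 0 \<and> p l = w \<and> (\<forall>s\<in>{0..l}. T s \<in> U))"

lemma unit_curvature_curve_join:
  assumes "unit_curvature_curve l p T D" "unit_curvature_curve m q R E"
    and eq: "p l = q 0" "T l = R 0" "D l = E 0"
  shows "unit_curvature_curve (l + m) (join l p q) (join l T R) (join l D E)"
  using assms unfolding unit_curvature_curve_def
  by (auto intro!: continuous_on_join has_vector_derivative_join) (auto simp: join_def)

lemma unit_curvature_curve_translate:
  assumes "unit_curvature_curve l p T D"
  shows "unit_curvature_curve l (\<lambda>s. a + p s) T D"
  using assms unfolding unit_curvature_curve_def
  by (auto intro!: derivative_eq_intros)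

lemma arc_to_trans:
  assumes "arc_to U x y l w" "arc_to V y z m w'" "U \<subseteq> W" "V \<subseteq> W"
  shows "arc_to W x z (l + m) (w + w')"
proof -
  obtain p T D where 1: "unit_curvature_curve l p T D" "(T 0, D 0) = x" "(T l, D l) = y"
     "p 0 = 0" "p l = w" "\<forall>s\<in>{0..l}. T s \<in> U"
    using assms(1) unfolding arc_to_def by blast
  obtain q R E where 2: "unit_curvature_curve m q R E" "(R 0, E 0) = y" "(R m, E m) = z"
     "q 0 = 0" "q m = w'" "\<forall>s\<in>{0..m}. R s \<in> V"
    using assms(2) unfolding arc_to_def by blast
  let ?q = "\<lambda>s. w + q s"
  have lm: "0 \<le> l" "0 \<le> m" using 1(1) 2(1) by (auto simp: unit_curvature_curve_def)
  have eq: "p l = ?q 0" "T l = R 0" "D l = E 0" using 1 2 by auto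
  have "unit_curvature_curve (l + m) (join l p ?q) (join l T R) (join l D E)"
    by (rule unit_curvature_curve_join[OF 1(1) unit_curvature_curve_translate[OF 2(1)] eq])
  then show ?thesis
    unfolding arc_to_def using 1 2 lm assms(3,4) eq
    by (intro exI[of _ "join l p ?q"] exI[of _ "join l T R"] exI[of _ "join l D E"])
      (auto simp: join_simps; auto simp: join_def)
qed

lemma arc_to_mono: "arc_to U x y l w \<Longrightarrow> U \<subseteq> V \<Longrightarrow> arc_to V x y l w"
  unfolding arc_to_def by blast

lemma arc_to_refl: "x \<in> U \<Longrightarrow> norm x = 1 \<Longrightarrow> norm p = 1 \<Longrightarrow> arc_to U (x, p) (x, p) 0 0"
  unfolding arc_to_def unit_curvature_curve_def
  by (rule exI[of _ "\<lambda>s. s *\<^sub>R x"], rule exI[of _ "\<lambda>s. x + s *\<^sub>R p"], rule exI[of _ "\<lambda>s. p"])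
    (auto intro!: derivative_eq_intros)

section \<open>Circles and figure eights on the unit sphere\<close>

definition circ :: "real \<Rightarrow> real^3 \<Rightarrow> real^3 \<Rightarrow> real^3 \<Rightarrow> real \<Rightarrow> real^3" where
  "circ w x p q s = x + (sin (w * s) / w) *\<^sub>R p + ((1 - cos (w * s)) / w^2) *\<^sub>R q"

definition circ_deriv :: "real \<Rightarrow> real^3 \<Rightarrow> real^3 \<Rightarrow> real \<Rightarrow> real^3" where
  "circ_deriv w p q s = cos (w * s) *\<^sub>R p + (sin (w * s) / w) *\<^sub>R q"

text \<open>The antiderivative of \<open>circ\<close> that vanishes at 0, hence the curve itself:
  for \<open>w > 1\<close> a helix whose drift per unit length is the centre
  \<open>x + q / w^2\<close> of the tangent circle. A full turn advances by
  \<open>2 * pi / w\<close> times this centre.\<close>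

definition circ_integral :: "real \<Rightarrow> real^3 \<Rightarrow> real^3 \<Rightarrow> real^3 \<Rightarrow> real \<Rightarrow> real^3" where
  "circ_integral w x p q s =
     s *\<^sub>R x + ((1 - cos (w * s)) / w^2) *\<^sub>R p + (s / w^2 - sin (w * s) / w^3) *\<^sub>R q"

text \<open>The circle on the unit sphere through \<open>x\<close> with unit tangent \<open>p\<close> and acceleration \<open>q\<close>; its
  radius is \<open>1 / w\<close>.\<close>
lemma arc_to_circ:
  assumes w: "w > 0" and l: "l \<ge> 0"
    and "x \<bullet> x = 1" "p \<bullet> p = 1" "x \<bullet> p = 0" "x \<bullet> q = -1" "p \<bullet> q = 0" "q \<bullet> q = w^2"
    and U: "\<And>s. 0 \<le> s \<Longrightarrow> s \<le> l \<Longrightarrow> circ w x p q s \<in> U"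
  shows "arc_to U (x, p) (circ w x p q l, circ_deriv w p q l) l (circ_integral w x p q l)"
proof -
  have comm: "p \<bullet> x = 0" "q \<bullet> x = -1" "q \<bullet> p = 0" using assms by (simp_all add: inner_commute)
  \<comment> \<open>The condition \<open>x \<bullet> q = -1\<close> is what keeps the circle on the
    sphere: it is the second derivative at 0 of the equation \<open>T \<bullet> T = 1\<close>, for
    unit speed.\<close>
  have "norm (circ w x p q s) = 1" for s
  proof -
    have "circ w x p q s \<bullet> circ w x p q s =
        1 + ((sin (w * s))^2 + (1 - cos (w * s))^2 - 2 * (1 - cos (w * s))) / w^2"
      using assms comm w
      by (simp add: circ_def inner_add_left inner_add_right power2_eq_square field_simps)
    also have "(sin (w * s))^2 + (1 - cos (w * s))^2 - 2 * (1 - cos (w * s)) = 0"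
      using sin_cos_squared_add[of "w * s"] by (simp add: power2_eq_square algebra_simps)
    finally show ?thesis by (simp add: norm_eq_sqrt_inner)
  qed
  moreover have "norm (circ_deriv w p q s) = 1" for s
  proof -
    have "circ_deriv w p q s \<bullet> circ_deriv w p q s = (cos (w * s))^2 + (sin (w * s))^2"
      using assms comm w
      by (simp add: circ_deriv_def inner_add_left inner_add_right power2_eq_square)
    then show ?thesis by (simp add: norm_eq_sqrt_inner)
  qed
  moreover have "(circ w x p q has_vector_derivative circ_deriv w p q s) (at s within {0..l})" for s
    unfolding circ_def[abs_def] circ_deriv_def using w
    by (auto intro!: derivative_eq_intros simp: power2_eq_square)
  moreover have "(circ_integral w x p q has_vector_derivative circ w x p q s) (at s within {0..l})" for s
    unfolding circ_def circ_integral_def[abs_def] using w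
    by (auto intro!: derivative_eq_intros simp: power2_eq_square power3_eq_cube diff_divide_distrib)
  moreover have "continuous_on {0..l} (circ_deriv w p q)"
    unfolding circ_deriv_def[abs_def] using w by (auto intro!: continuous_intros)
  ultimately have "unit_curvature_curve l (circ_integral w x p q) (circ w x p q) (circ_deriv w p q)"
    unfolding unit_curvature_curve_def using l by auto
  then show ?thesis
    unfolding arc_to_def using U
    by (intro exI[of _ "circ_integral w x p q"] exI[of _ "circ w x p q"] exI[of _ "circ_deriv w p q"])
      (auto simp: circ_def circ_deriv_def circ_integral_def)
qed

text \<open>The bound is the diameter of the circle.\<close>

lemma norm_circ_diff:
  assumes "w > 0" "p \<bullet> p = 1" "p \<bullet> q = 0" "q \<bullet> q = w^2"
  shows "norm (circ w x p q s - x) \<le> 2 / w"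
proof -
  let ?d = "circ w x p q s - x"
  have "q \<bullet> p = 0" using assms by (simp add: inner_commute)
  then have "?d \<bullet> ?d = (sin (w * s) / w)^2 + ((1 - cos (w * s)) / w^2)^2 * w^2"
    using assms by (simp add: circ_def inner_add_left inner_add_right power2_eq_square)
  also have "\<dots> = ((sin (w * s))^2 + (1 - cos (w * s))^2) / w^2"
    using assms(1) by (simp add: power_divide add_divide_distrib) (simp add: power2_eq_square power4_eq_xxxx)
  also have "(sin (w * s))^2 + (1 - cos (w * s))^2 = 2 - 2 * cos (w * s)"
    using sin_cos_squared_add[of "w * s"] by (simp add: power2_eq_square algebra_simps)
  also have "(2 - 2 * cos (w * s)) / w^2 \<le> 4 / w^2"
  proof (rule divide_right_mono)
    show "2 - 2 * cos (w * s) \<le> 4" using cos_ge_minus_one[of "w * s"] by linarith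
  qed simp
  also have "4 / w^2 = (2 / w)^2" by (simp add: power_divide)
  finally have "(norm ?d)^2 \<le> (2 / w)^2" by (simp add: power2_norm_eq_inner)
  then show ?thesis using assms(1) power2_le_imp_le by fastforce
qed

text \<open>A tangent path that runs once around each of two mirror-image circles tangent to \<open>p\<close> at \<open>x\<close>
  returns to its initial state, and the corresponding curve advances exactly along \<open>x\<close>.\<close>
lemma arc_to_eight:
  assumes x: "norm x = 1" "norm p = 1" "x \<bullet> p = 0" and g: "g > 0" "2 / sqrt (1 + g^2) \<le> \<rho>"
  shows "\<exists>l. arc_to (cball x \<rho>) (x, p) (x, p) l ((4 * pi * g^2 / sqrt (1 + g^2) ^ 3) *\<^sub>R x)"
proof -
  define w where "w = sqrt (1 + g^2)"
  have w: "w > 0" "w^2 = 1 + g^2" by (auto simp: w_def add_pos_nonneg add_nonneg_nonneg)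
  define n where "n = cross3 x p"
  have on: "x \<bullet> x = 1" "p \<bullet> p = 1" "p \<bullet> x = 0" "x \<bullet> n = 0" "p \<bullet> n = 0" "n \<bullet> x = 0" "n \<bullet> p = 0"
    using x by (auto simp: norm_eq_1 n_def dot_cross_self inner_commute)
  have nn: "n \<bullet> n = 1"
    using norm_cross_dot[of x p] x by (simp add: n_def power2_norm_eq_inner)
  have loop: "arc_to (cball x \<rho>) (x, p) (x, p) (2 * pi / w) ((2 * pi * h / w^3) *\<^sub>R (h *\<^sub>R x + n))"
    if h: "h^2 = g^2" for h
  proof -
    \<comment> \<open>The acceleration splits into \<open>- x\<close>, which holds the path on the
      sphere, and the geodesic curvature \<open>h\<close> in the direction \<open>n\<close>; hence
      \<open>w^2 = 1 + h^2\<close>. Opposite signs of \<open>h\<close> give the two mirror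
      images.\<close>
    define q where "q = h *\<^sub>R n - x"
    have qs: "x \<bullet> q = -1" "p \<bullet> q = 0" "q \<bullet> q = w^2"
      using on nn w h by (simp_all add: q_def inner_diff_left inner_diff_right power2_eq_square)
    have "arc_to (cball x \<rho>) (x, p) (circ w x p q (2 * pi / w), circ_deriv w p q (2 * pi / w))
       (2 * pi / w) (circ_integral w x p q (2 * pi / w))"
    proof (rule arc_to_circ)
      fix s
      have "norm (circ w x p q s - x) \<le> \<rho>"
        using norm_circ_diff[OF w(1) on(2) qs(2,3), of x s] g(2) unfolding w_def by linarith
      then show "circ w x p q s \<in> cball x \<rho>" by (simp add: dist_norm norm_minus_commute)
    qed (use w on x qs in auto)
    moreover have "circ w x p q (2 * pi / w) = x" "circ_deriv w p q (2 * pi / w) = p"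
      using w by (simp_all add: circ_def circ_deriv_def)
    moreover have "circ_integral w x p q (2 * pi / w) = (2 * pi * h / w^3) *\<^sub>R (h *\<^sub>R x + n)"
    proof -
      have "circ_integral w x p q (2 * pi / w) = (2 * pi / w) *\<^sub>R x + (2 * pi / w^3) *\<^sub>R q"
        using w(1) by (simp add: circ_integral_def power3_eq_cube power2_eq_square)
      also have "(2 * pi / w) *\<^sub>R x = (2 * pi / w^3 * (1 + h^2)) *\<^sub>R x"
      proof -
        have "1 + h^2 = w^2" using w h by simp
        then show ?thesis using w(1) by (simp only: \<open>1 + h^2 = w^2\<close>) (simp add: power3_eq_cube power2_eq_square)
      qed
      finally show ?thesis by (simp add: q_def algebra_simps power2_eq_square add_divide_distrib)
    qed
    ultimately show ?thesis by simp
  qed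
  \<comment> \<open>The sideways parts of the two advances, proportional to \<open>h\<close> times
    \<open>n\<close>, cancel; the parts along \<open>x\<close>, proportional to \<open>h^2\<close>,
    add up.\<close>
  have "arc_to (cball x \<rho>) (x, p) (x, p) (2 * pi / w + 2 * pi / w)
      ((2 * pi * g / w^3) *\<^sub>R (g *\<^sub>R x + n) + (2 * pi * (- g) / w^3) *\<^sub>R ((- g) *\<^sub>R x + n))"
    by (rule arc_to_trans[OF loop loop]) auto
  moreover have "(2 * pi * g / w^3) *\<^sub>R (g *\<^sub>R x + n) + (2 * pi * (- g) / w^3) *\<^sub>R ((- g) *\<^sub>R x + n)
      = (4 * pi * g^2 / w^3) *\<^sub>R x"
    by (simp add: algebra_simps power2_eq_square scaleR_add_left[symmetric])
  ultimately show ?thesis unfolding w_def by auto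
qed

lemma arc_to_iterate:
  assumes "arc_to U x x l w" "k > 0"
  shows "\<exists>l. arc_to U x x l (real k *\<^sub>R w)"
  using assms(2)
proof (induction k rule: nat_induct_non_zero)
  case 1
  then show ?case using assms(1) by auto
next
  case (Suc k)
  then obtain m where "arc_to U x x m (real k *\<^sub>R w)" by blast
  from arc_to_trans[OF assms(1) this, of U] show ?case
    by (auto simp: algebra_simps)
qed

text \<open>The ball limits the size of the circles, by \<open>g \<ge> 2 / \<rho>\<close>, and with
  it the advance of one figure eight. A long advance is cut into \<open>k\<close> equal parts, small
  enough for the intermediate value theorem: the advance \<open>h g\<close> is continuous and tends
  to 0 as \<open>g\<close> grows.\<close>

lemma arc_to_advance:
  assumes x: "norm x = 1" "norm p = 1" "x \<bullet> p = 0" and "X > 0" "\<rho> > 0"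
  shows "\<exists>l. arc_to (cball x \<rho>) (x, p) (x, p) l (X *\<^sub>R x)"
proof -
  define h where "h = (\<lambda>g::real. 4 * pi * g^2 / sqrt (1 + g^2) ^ 3)"
  define g0 where "g0 = 2 / \<rho>"
  have g0: "g0 > 0" using assms by (simp add: g0_def)
  have sq: "sqrt (1 + g^2) > 0" "sqrt (1 + g^2) \<ge> g" for g :: real
    by (auto simp: add_pos_nonneg intro: real_le_rsqrt)
  have h0: "h g0 > 0" using g0 sq[of g0] by (simp add: h_def)
  obtain k :: nat where k: "X / h g0 < real k" using reals_Archimedean2 by blast
  then have k0: "k > 0" using assms(4) h0 by (cases k) (auto simp: field_simps)
  define y where "y = X / real k"
  have y: "0 < y" "y \<le> h g0" using k k0 h0 assms(4) by (auto simp: y_def field_simps)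
  \<comment> \<open>Chosen so that \<open>h G \<le> 4 * pi / G \<le> y\<close>; then
    \<open>y\<close> lies between the advances at \<open>G\<close> and at \<open>g0\<close>.\<close>
  define G where "G = max g0 (4 * pi / y)"
  have G: "G \<ge> g0" "G > 0" "4 * pi / y \<le> G" using g0 by (auto simp: G_def)
  have "h G \<le> 4 * pi / G"
  proof -
    have "G^3 \<le> sqrt (1 + G^2) ^ 3" using sq[of G] G by (intro power_mono) auto
    then have "h G \<le> 4 * pi * G^2 / G^3"
      unfolding h_def using G sq[of G] by (intro divide_left_mono) auto
    then show ?thesis using G by (simp add: power2_eq_square power3_eq_cube)
  qed
  also have "\<dots> \<le> y" using G y by (simp add: field_simps)
  finally have "h G \<le> y" .
  moreover have "isCont h g" for g
    unfolding h_def using sq[of g] by (intro continuous_intros) auto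
  then have "continuous_on {g0..G} h" by (simp add: continuous_at_imp_continuous_on)
  ultimately obtain g where g: "g0 \<le> g" "h g = y"
    using IVT2'[of h G y g0] y G by blast
  have "2 / sqrt (1 + g^2) \<le> 2 / g"
    using sq[of g] g g0 by (intro divide_left_mono) auto
  also have "\<dots> \<le> 2 / g0" using g g0 by (intro divide_left_mono) auto
  also have "\<dots> = \<rho>" using assms(5) by (simp add: g0_def)
  finally have "\<exists>l. arc_to (cball x \<rho>) (x, p) (x, p) l (y *\<^sub>R x)"
    using arc_to_eight[OF x, of g \<rho>] g g0 unfolding h_def by auto
  then obtain l where "arc_to (cball x \<rho>) (x, p) (x, p) l (y *\<^sub>R x)" ..
  from arc_to_iterate[OF this k0] show ?thesis using k0 by (simp add: y_def)
qed

section \<open>Orthonormal frames and circles of latitude\<close>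

lemma orthonormal_cross3:
  assumes "norm a = 1" "norm u = 1" "a \<bullet> u = 0"
  shows "norm (cross3 a u) = 1" "a \<bullet> cross3 a u = 0" "u \<bullet> cross3 a u = 0"
    "cross3 a (cross3 a u) = - u" "cross3 u (cross3 a u) = a"
proof -
  have "(norm (cross3 a u))^2 = 1" using norm_cross_dot[of a u] assms by simp
  then show "norm (cross3 a u) = 1" 
    by (metis norm_ge_zero one_power2 power2_eq_iff_nonneg zero_le_one)
  show "a \<bullet> cross3 a u = 0" "u \<bullet> cross3 a u = 0" by (simp_all add: dot_cross_self)
  show "cross3 a (cross3 a u) = - u" "cross3 u (cross3 a u) = a"
    using assms by (simp_all add: Lagrange norm_eq_1 inner_commute)
qed

text \<open>The remainder \<open>y\<close> is orthogonal to \<open>a\<close>, \<open>u\<close> and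
  \<open>v\<close>. By Lagrange's formula its cross product with \<open>v\<close> vanishes too, so
  \<open>norm y * norm v = 0\<close>.\<close>

lemma orthonormal_expansion:
  assumes "norm a = 1" "norm u = 1" "a \<bullet> u = 0"
  shows "z = (z \<bullet> a) *\<^sub>R a + (z \<bullet> u) *\<^sub>R u + (z \<bullet> cross3 a u) *\<^sub>R cross3 a u"
proof -
  note on = orthonormal_cross3[OF assms]
  define v where "v = cross3 a u"
  define y where "y = z - ((z \<bullet> a) *\<^sub>R a + (z \<bullet> u) *\<^sub>R u + (z \<bullet> v) *\<^sub>R v)"
  have "a \<bullet> a = 1" "u \<bullet> u = 1" "v \<bullet> v = 1" "a \<bullet> u = 0" "u \<bullet> a = 0" "a \<bullet> v = 0" "v \<bullet> a = 0"
    "u \<bullet> v = 0" "v \<bullet> u = 0"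
    using assms on by (simp_all add: v_def norm_eq_1 inner_commute)
  then have "y \<bullet> a = 0" "y \<bullet> u = 0" "y \<bullet> v = 0"
    by (simp_all add: y_def inner_diff_left inner_add_left)
  moreover from this have "cross3 y v = 0" unfolding v_def by (simp add: Lagrange)
  ultimately have "y = 0" using norm_cross_dot[of y v] on(1) v_def by simp
  then show ?thesis by (simp add: y_def v_def)
qed

text \<open>"Parallel" in the geographical sense: a circle of latitude on the unit sphere, with axis
  \<open>a\<close>.\<close>

definition parallel :: "real^3 \<Rightarrow> real \<Rightarrow> (real^3) set" where
  "parallel a c = {x. norm x = 1 \<and> x \<bullet> a = c}"

text \<open>\<open>r\<close> is the radius of the parallel through \<open>x\<close>, so the second component is a unit tangent.\<close>
definition state :: "real^3 \<Rightarrow> real \<Rightarrow> real^3 \<Rightarrow> (real^3) \<times> (real^3)" where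
  "state a r x = (x, (1 / r) *\<^sub>R cross3 a x)"

lemma parallel_iff:
  assumes a: "norm a = 1" and cr: "r > 0" "c^2 + r^2 = 1"
  shows "x \<in> parallel a c \<longleftrightarrow> (\<exists>u. norm u = 1 \<and> a \<bullet> u = 0 \<and> x = c *\<^sub>R a + r *\<^sub>R u)"
proof
  assume "x \<in> parallel a c"
  then have x: "x \<bullet> x = 1" "x \<bullet> a = c" "a \<bullet> x = c" by (auto simp: parallel_def norm_eq_1 inner_commute)
  have aa: "a \<bullet> a = 1" using a by (simp add: norm_eq_1)
  define y where "y = x - c *\<^sub>R a"
  have "y \<bullet> y = r^2"
    using x aa cr(2) by (simp add: y_def inner_diff_left inner_diff_right power2_eq_square)
  then have "norm y = r" using cr(1) by (simp add: norm_eq_sqrt_inner)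
  then have "norm ((1 / r) *\<^sub>R y) = 1" using cr(1) by simp
  moreover have "a \<bullet> ((1 / r) *\<^sub>R y) = 0" using x aa by (simp add: y_def inner_diff_right)
  moreover have "x = c *\<^sub>R a + r *\<^sub>R ((1 / r) *\<^sub>R y)" using cr(1) by (simp add: y_def)
  ultimately show "\<exists>u. norm u = 1 \<and> a \<bullet> u = 0 \<and> x = c *\<^sub>R a + r *\<^sub>R u" by blast
next
  assume "\<exists>u. norm u = 1 \<and> a \<bullet> u = 0 \<and> x = c *\<^sub>R a + r *\<^sub>R u"
  then obtain u where u: "u \<bullet> u = 1" "a \<bullet> u = 0" "u \<bullet> a = 0" "x = c *\<^sub>R a + r *\<^sub>R u"
    by (auto simp: norm_eq_1 inner_commute)
  have aa: "a \<bullet> a = 1" using a by (simp add: norm_eq_1)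
  then show "x \<in> parallel a c"
    using u cr(2) by (simp add: parallel_def norm_eq_1 inner_add_left inner_add_right power2_eq_square)
qed

lemma state_parallel:
  assumes "norm a = 1" "r > 0" "norm u = 1" "a \<bullet> u = 0"
  shows "state a r (c *\<^sub>R a + r *\<^sub>R u) = (c *\<^sub>R a + r *\<^sub>R u, cross3 a u)"
  using assms by (simp add: state_def cross_add_right cross_mult_right)

text \<open>In both states the derivative points in the positive sense of rotation about
  \<open>a\<close>, so running forward through the angle from the first point to the second ends in
  the required state. The angle is taken nonnegative, as a length must be.\<close>

lemma arc_to_parallel:
  assumes a: "norm a = 1" and cr: "r > 0" "c^2 + r^2 = 1"
    and "x \<in> parallel a c" "y \<in> parallel a c"
  shows "\<exists>l w. arc_to (parallel a c) (state a r x) (state a r y) l w"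
proof -
  obtain u where u: "norm u = 1" "a \<bullet> u = 0" "x = c *\<^sub>R a + r *\<^sub>R u"
    using assms parallel_iff by blast
  obtain z where z: "norm z = 1" "a \<bullet> z = 0" "y = c *\<^sub>R a + r *\<^sub>R z"
    using assms parallel_iff by blast
  define v where "v = cross3 a u"
  note on = orthonormal_cross3[OF a u(1,2), folded v_def]
  have z_exp: "z = (z \<bullet> u) *\<^sub>R u + (z \<bullet> v) *\<^sub>R v"
    using orthonormal_expansion[OF a u(1,2), of z] z(2) by (simp add: v_def inner_commute)
  have inner: "u \<bullet> u = 1" "v \<bullet> v = 1" "a \<bullet> a = 1" "u \<bullet> v = 0" "v \<bullet> u = 0" "a \<bullet> v = 0" "v \<bullet> a = 0" "u \<bullet> a = 0"
    using u on a by (auto simp: norm_eq_1 inner_commute)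
  have "z \<bullet> z = (z \<bullet> u)^2 + (z \<bullet> v)^2"
    by (subst z_exp, subst (2) z_exp) (simp add: inner inner_add_left inner_add_right power2_eq_square)
  then have "(z \<bullet> u)^2 + (z \<bullet> v)^2 = 1" using z(1) by (simp add: norm_eq_1)
  then obtain t where t: "0 \<le> t" "z \<bullet> u = cos t" "z \<bullet> v = sin t"
    using sincos_total_2pi_le by metis
  \<comment> \<open>The centripetal acceleration on the circle of radius \<open>r\<close> with
    centre \<open>c *\<^sub>R a\<close>.\<close>
  define q where "q = - (1 / r) *\<^sub>R u"
  have circ: "circ (1 / r) x v q s = c *\<^sub>R a + r *\<^sub>R (cos (s / r) *\<^sub>R u + sin (s / r) *\<^sub>R v)"
    and circ': "circ_deriv (1 / r) v q s = cos (s / r) *\<^sub>R v - sin (s / r) *\<^sub>R u" for s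
    using cr(1) by (simp_all add: circ_def circ_deriv_def q_def u(3) algebra_simps power2_eq_square)
  have unit: "norm (cos s *\<^sub>R u + sin s *\<^sub>R v) = 1" "a \<bullet> (cos s *\<^sub>R u + sin s *\<^sub>R v) = 0" for s
    using inner u(2) sin_cos_squared_add2[of s]
    by (simp_all add: norm_eq_1 inner_add_left inner_add_right power2_eq_square)
  have "arc_to (parallel a c) (x, v) (circ (1 / r) x v q (r * t), circ_deriv (1 / r) v q (r * t))
     (r * t) (circ_integral (1 / r) x v q (r * t))"
  proof (rule arc_to_circ)
    show "circ (1 / r) x v q s \<in> parallel a c" for s
      unfolding circ parallel_iff[OF a cr] using unit by blast
    show "x \<bullet> x = 1" using assms(4) by (simp add: parallel_def norm_eq_1)
  qed (use cr t inner u(2) in \<open>simp_all add: u(3) q_def inner_add_left power2_eq_square\<close>)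
  moreover have "circ (1 / r) x v q (r * t) = y"
    unfolding circ z(3) using cr(1) z_exp t by simp
  moreover have "circ_deriv (1 / r) v q (r * t) = cross3 a z"
  proof -
    have "cross3 a z = cos t *\<^sub>R cross3 a u + sin t *\<^sub>R cross3 a v"
      by (subst z_exp) (simp add: t cross_add_right cross_mult_right)
    then show ?thesis using cr(1) on by (simp add: circ' v_def[symmetric])
  qed
  ultimately show ?thesis
    using state_parallel[OF a cr(1) u(1,2), of c] state_parallel[OF a cr(1) z(1,2), of c]
    by (metis u(3) v_def z(3))
qed

lemma parallel_subset_cball:
  assumes "norm a = 1" "2 - 2 * c \<le> \<rho>^2" "\<rho> > 0"
  shows "parallel a c \<subseteq> cball a \<rho>"
proof
  fix x assume "x \<in> parallel a c"
  then have "(norm (a - x))^2 = 2 - 2 * c"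
    using assms(1) by (simp add: parallel_def power2_norm_eq_inner inner_diff_left inner_diff_right inner_commute norm_eq_1)
  then have "(norm (a - x))^2 \<le> \<rho>^2" using assms by simp
  then have "norm (a - x) \<le> \<rho>" by (rule power2_le_imp_le) (use assms(3) in simp)
  then show "x \<in> cball a \<rho>" by (simp add: dist_norm)
qed

text \<open>Advancing at four points of the parallel, in opposite pairs, realizes every vector in an open
  cone around its axis \<open>a\<close>.\<close>
lemma arc_to_along_axis:
  assumes a: "norm a = 1" and cr: "c > 0" "r > 0" "c^2 + r^2 = 1"
    and \<rho>: "\<rho> > 0" "2 - 2 * c < \<rho>^2"
    and xy: "x \<in> parallel a c" "y \<in> parallel a c"
  shows "\<exists>t0. \<forall>t\<ge>t0. \<exists>l. arc_to (cball a \<rho>) (state a r x) (state a r y) l (t *\<^sub>R a - w)"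
proof -
  \<comment> \<open>The distance from \<open>a\<close> to the points of the parallel; the rest
    \<open>\<rho> - \<rho>'\<close> is the room for the figure eights.\<close>
  define \<rho>' where "\<rho>' = sqrt (2 - 2 * c)"
  have c1: "c < 1"
  proof -
    have "c^2 < 1^2" using cr(3) zero_less_power[OF cr(2), of 2] unfolding one_power2 by linarith
    then show ?thesis by (rule power_less_imp_less_base) simp
  qed
  then have \<rho>': "\<rho>' > 0" "2 - 2 * c \<le> \<rho>'^2" "\<rho>' < \<rho>"
    using \<rho> real_less_lsqrt[of \<rho> "2 - 2 * c"] by (simp_all add: \<rho>'_def)
  have par: "parallel a c \<subseteq> cball a \<rho>'"
    by (rule parallel_subset_cball[OF a \<rho>'(2,1)])
  have arc: "\<exists>l w. arc_to (cball a \<rho>) (state a r z) (state a r z') l w"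
    if "z \<in> parallel a c" "z' \<in> parallel a c" for z z'
  proof -
    have "parallel a c \<subseteq> cball a \<rho>" using par subset_cball[of \<rho>' \<rho> a] \<rho>'(3) by auto
    then show ?thesis using arc_to_parallel[OF a cr(2,3) that] arc_to_mono by blast
  qed
  have adv: "\<exists>l. arc_to (cball a \<rho>) (state a r z) (state a r z) l (X *\<^sub>R z)"
    if z: "z \<in> parallel a c" and X: "X > 0" for z X
  proof -
    obtain u where u: "norm u = 1" "a \<bullet> u = 0" "z = c *\<^sub>R a + r *\<^sub>R u"
      using z parallel_iff[OF a cr(2,3)] by blast
    have st: "state a r z = (z, cross3 a u)" using state_parallel[OF a cr(2) u(1,2)] u(3) by simp
    have "\<exists>l. arc_to (cball z (\<rho> - \<rho>')) (z, cross3 a u) (z, cross3 a u) l (X *\<^sub>R z)"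
    proof (rule arc_to_advance)
      show "norm z = 1" using z by (simp add: parallel_def)
      show "norm (cross3 a u) = 1" "z \<bullet> cross3 a u = 0"
        using orthonormal_cross3[OF a u(1,2)] by (simp_all add: u(3) inner_add_left)
    qed (use X \<rho>' in auto)
    moreover have "cball z (\<rho> - \<rho>') \<subseteq> cball a \<rho>"
      using par z by (auto simp: cball_subset_cball_iff dist_commute)
    ultimately show ?thesis using arc_to_mono st by metis
  qed
  obtain u where u: "norm u = 1" "a \<bullet> u = 0" "x = c *\<^sub>R a + r *\<^sub>R u"
    using xy(1) parallel_iff[OF a cr(2,3)] by blast
  define v where "v = cross3 a u"
  note on = orthonormal_cross3[OF a u(1,2), folded v_def]
  define p1 where "p1 = c *\<^sub>R a + r *\<^sub>R u"
  define p2 where "p2 = c *\<^sub>R a + r *\<^sub>R (- u)"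
  define p3 where "p3 = c *\<^sub>R a + r *\<^sub>R v"
  define p4 where "p4 = c *\<^sub>R a + r *\<^sub>R (- v)"
  have p: "p1 \<in> parallel a c" "p2 \<in> parallel a c" "p3 \<in> parallel a c" "p4 \<in> parallel a c"
    unfolding parallel_iff[OF a cr(2,3)] p1_def p2_def p3_def p4_def
    using u on by (metis inner_minus_right minus_zero norm_minus_cancel)+
  obtain l0 w0 where 0: "arc_to (cball a \<rho>) (state a r x) (state a r p1) l0 w0"
    using arc[OF xy(1) p(1)] by blast
  obtain l1 w1 where 1: "arc_to (cball a \<rho>) (state a r p1) (state a r p2) l1 w1"
    using arc[OF p(1,2)] by blast
  obtain l2 w2 where 2: "arc_to (cball a \<rho>) (state a r p2) (state a r p3) l2 w2"
    using arc[OF p(2,3)] by blast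
  obtain l3 w3 where 3: "arc_to (cball a \<rho>) (state a r p3) (state a r p4) l3 w3"
    using arc[OF p(3,4)] by blast
  obtain l4 w4 where 4: "arc_to (cball a \<rho>) (state a r p4) (state a r y) l4 w4"
    using arc[OF p(4) xy(2)] by blast
  have total: "\<exists>l. arc_to (cball a \<rho>) (state a r x) (state a r y) l
      (w0 + X1 *\<^sub>R p1 + w1 + X2 *\<^sub>R p2 + w2 + X3 *\<^sub>R p3 + w3 + X4 *\<^sub>R p4 + w4)"
    if X: "X1 > 0" "X2 > 0" "X3 > 0" "X4 > 0" for X1 X2 X3 X4
  proof -
    obtain m1 where 5: "arc_to (cball a \<rho>) (state a r p1) (state a r p1) m1 (X1 *\<^sub>R p1)"
      using adv[OF p(1) X(1)] by blast
    obtain m2 where 6: "arc_to (cball a \<rho>) (state a r p2) (state a r p2) m2 (X2 *\<^sub>R p2)"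
      using adv[OF p(2) X(2)] by blast
    obtain m3 where 7: "arc_to (cball a \<rho>) (state a r p3) (state a r p3) m3 (X3 *\<^sub>R p3)"
      using adv[OF p(3) X(3)] by blast
    obtain m4 where 8: "arc_to (cball a \<rho>) (state a r p4) (state a r p4) m4 (X4 *\<^sub>R p4)"
      using adv[OF p(4) X(4)] by blast
    note tr = arc_to_trans[OF _ _ order_refl order_refl]
    from tr[OF tr[OF tr[OF tr[OF tr[OF tr[OF tr[OF tr[OF 0 5] 1] 6] 2] 7] 3] 8] 4]
    show ?thesis by blast
  qed
  \<comment> \<open>All displacements that are not tuned: those of the five connecting arcs, and the
    prescribed \<open>w\<close>.\<close>
  define b where "b = w + w0 + w1 + w2 + w3 + w4"
  define t0 where "t0 = 1 + \<bar>b \<bullet> a\<bar> + 2 * c / r * (\<bar>b \<bullet> u\<bar> + \<bar>b \<bullet> v\<bar>)"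
  show ?thesis
  proof (rule exI[of _ t0], intro allI impI)
    fix t assume t: "t \<ge> t0"
    \<comment> \<open>The four advances add up to \<open>4 * A\<close>, which fixes the component
      along \<open>a\<close>; the differences within opposite pairs compensate the components of
      \<open>b\<close> along \<open>u\<close> and \<open>v\<close>. All four are positive because
      \<open>t \<ge> t0\<close> makes \<open>A\<close> dominate these corrections.\<close>
    define A where "A = (t - b \<bullet> a) / (4 * c)"
    have "\<bar>b \<bullet> u\<bar> + \<bar>b \<bullet> v\<bar> < 2 * r * A"
    proof -
      have "2 * c / r * (\<bar>b \<bullet> u\<bar> + \<bar>b \<bullet> v\<bar>) < t - b \<bullet> a" using t by (simp add: t0_def)
      then show ?thesis using cr by (simp add: A_def field_simps)
    qed
    then have "\<bar>(b \<bullet> u) / (2 * r)\<bar> < A" "\<bar>(b \<bullet> v) / (2 * r)\<bar> < A"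
      using cr by (simp_all add: abs_divide pos_divide_less_eq mult.commute)
    then have pos: "A - (b \<bullet> u) / (2 * r) > 0" "A + (b \<bullet> u) / (2 * r) > 0"
      "A - (b \<bullet> v) / (2 * r) > 0" "A + (b \<bullet> v) / (2 * r) > 0" by linarith+
    have "(A - (b \<bullet> u) / (2 * r)) *\<^sub>R p1 + (A + (b \<bullet> u) / (2 * r)) *\<^sub>R p2 +
        (A - (b \<bullet> v) / (2 * r)) *\<^sub>R p3 + (A + (b \<bullet> v) / (2 * r)) *\<^sub>R p4
      = (4 * c * A) *\<^sub>R a - (b \<bullet> u) *\<^sub>R u - (b \<bullet> v) *\<^sub>R v"
    proof -
      have *: "(A - d / (2 * r)) *\<^sub>R (c *\<^sub>R a + r *\<^sub>R e) + (A + d / (2 * r)) *\<^sub>R (c *\<^sub>R a + r *\<^sub>R (- e)) =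
        (2 * c * A) *\<^sub>R a - d *\<^sub>R e" for d e
      proof -
        have "(A - k) *\<^sub>R (c *\<^sub>R a + r *\<^sub>R e) + (A + k) *\<^sub>R (c *\<^sub>R a + r *\<^sub>R (- e)) =
          (2 * c * A) *\<^sub>R a - (2 * r * k) *\<^sub>R e" for k
          by (simp add: vec_eq_iff algebra_simps)
        from this[of "d / (2 * r)"] show ?thesis using cr by simp
      qed
      have "(4 * c * A) *\<^sub>R a = (2 * c * A) *\<^sub>R a + (2 * c * A) *\<^sub>R a"
        by (simp add: scaleR_add_left[symmetric])
      then show ?thesis
        using *[of "b \<bullet> u" u] *[of "b \<bullet> v" v] unfolding p1_def p2_def p3_def p4_def
        by (simp add: add.assoc)
    qed
    also have "4 * c * A = t - b \<bullet> a" using cr by (simp add: A_def)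
    also have "(t - b \<bullet> a) *\<^sub>R a - (b \<bullet> u) *\<^sub>R u - (b \<bullet> v) *\<^sub>R v = t *\<^sub>R a - b"
      by (subst (4) orthonormal_expansion[OF a u(1,2), of b]) (simp add: v_def scaleR_diff_left)
    finally have "t *\<^sub>R a - w = w0 + (A - (b \<bullet> u) / (2 * r)) *\<^sub>R p1 + w1 + (A + (b \<bullet> u) / (2 * r)) *\<^sub>R p2 + w2
        + (A - (b \<bullet> v) / (2 * r)) *\<^sub>R p3 + w3 + (A + (b \<bullet> v) / (2 * r)) *\<^sub>R p4 + w4"
      by (simp add: b_def algebra_simps)
    then show "\<exists>l. arc_to (cball a \<rho>) (state a r x) (state a r y) l (t *\<^sub>R a - w)"
      using total[OF pos] by simp
  qed
qed

subsection \<open>Curves along edges\<close>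

lemma parallel_nonempty:
  assumes a: "norm a = 1" and cr: "r > 0" "c^2 + r^2 = 1"
  shows "parallel a c \<noteq> {}"
proof -
  obtain y where y: "y \<noteq> 0" "orthogonal a y"
    using orthogonal_to_vector_exists[of a] by auto
  have "c *\<^sub>R a + r *\<^sub>R sgn y \<in> parallel a c"
    unfolding parallel_iff[OF a cr] using y
    by (intro exI[of _ "sgn y"]) (auto simp: norm_sgn orthogonal_def sgn_div_norm)
  then show ?thesis by blast
qed

text \<open>Two parallels of the same radius are connected by a great circle tangent to both, with its pole
  \<open>q\<close> at the same distance from both axes.\<close>
lemma arc_to_next_axis:
  assumes a: "norm a = 1" and b: "norm b = 1" and cr: "c > 0" "r > 0" "c^2 + r^2 = 1"
    and small: "2 * r^2 < 1 + a \<bullet> b"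
  shows "\<exists>x y l w. x \<in> parallel a c \<and> y \<in> parallel b c \<and>
    arc_to {z. z \<bullet> (a + b) > 0} (state a r x) (state b r y) l w"
proof (cases "a = b")
  \<comment> \<open>Equal directions need no turn, and there is no normal \<open>cross3 a b\<close>
    from which to build a pole; the arc of length 0 serves instead.\<close>
  case True
  obtain x where x: "x \<in> parallel a c" using parallel_nonempty[OF a cr(2,3)] by blast
  obtain u where u: "norm u = 1" "a \<bullet> u = 0" "x = c *\<^sub>R a + r *\<^sub>R u"
    using x parallel_iff[OF a cr(2,3)] by blast
  have "arc_to {z. z \<bullet> (a + b) > 0} (x, cross3 a u) (x, cross3 a u) 0 0"
  proof (rule arc_to_refl)
    have "x \<bullet> a = c" "x \<bullet> b = c" using x True by (simp_all add: parallel_def)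
    then show "x \<in> {z. z \<bullet> (a + b) > 0}"
      unfolding mem_Collect_eq inner_add_right using cr by linarith
    show "norm (cross3 a u) = 1" by (rule orthonormal_cross3(1)[OF a u(1,2)])
    show "norm x = 1" using x by (simp add: parallel_def)
  qed
  then have "arc_to {z. z \<bullet> (a + b) > 0} (state a r x) (state b r x) 0 0"
    using state_parallel[OF a cr(2) u(1,2), of c] u(3) True by simp
  then show ?thesis using x True by blast
next
  case False
  define k where "k = a \<bullet> b"
  have in_ab: "a \<bullet> a = 1" "b \<bullet> b = 1" "a \<bullet> b = k" "b \<bullet> a = k"
    using a b by (simp_all add: k_def norm_eq_1 inner_commute)
  have k1: "k < 1"
  proof -
    have "0 < (a - b) \<bullet> (a - b)" using False by simp
    then show ?thesis using in_ab by (simp add: inner_diff_left inner_diff_right)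
  qed
  have k0: "1 + k > 0" using small zero_le_power2[of r] unfolding k_def by linarith
  define n where "n = cross3 a b"
  have n: "n \<bullet> a = 0" "n \<bullet> b = 0" "a \<bullet> n = 0" "b \<bullet> n = 0"
    by (simp_all add: n_def dot_cross_self)
  have nn: "n \<bullet> n = 1 - k^2"
    using norm_cross_dot[of a b] a b by (simp add: n_def k_def power2_norm_eq_inner)
  have k2: "1 - k^2 > 0"
  proof -
    have "0 < (1 - k) * (1 + k)" using k0 k1 by simp
    then show ?thesis by (simp add: algebra_simps power2_eq_square)
  qed
  \<comment> \<open>The pole is sought in the form
    \<open>lam *\<^sub>R (a + b) + \<mu> *\<^sub>R n\<close>. The conditions
    \<open>q \<bullet> a = r\<close> and \<open>q \<bullet> b = r\<close> determine
    \<open>lam\<close>, and \<open>norm q = 1\<close> determines \<mu> up to sign. A solution exists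
    because \<open>small\<close> says that \<open>r\<close> is below the cosine of half the angle
    between \<open>a\<close> and \<open>b\<close>.\<close>
  define lam where "lam = r / (1 + k)"
  define \<mu> where "\<mu> = sqrt ((1 - 2 * r^2 / (1 + k)) / (1 - k^2))"
  have \<mu>: "\<mu> > 0" "\<mu>^2 * (1 - k^2) = 1 - 2 * r^2 / (1 + k)"
  proof -
    have *: "1 - 2 * r^2 / (1 + k) > 0" using small k0 by (simp add: k_def)
    then show "\<mu> > 0" using k2 by (simp add: \<mu>_def)
    show "\<mu>^2 * (1 - k^2) = 1 - 2 * r^2 / (1 + k)" using * k2 by (simp add: \<mu>_def)
  qed
  define q where "q = lam *\<^sub>R (a + b) + \<mu> *\<^sub>R n"
  have lam: "lam * (1 + k) = r" using k0 by (simp add: lam_def)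
  have qa: "q \<bullet> a = r" "a \<bullet> q = r" "q \<bullet> b = r" "b \<bullet> q = r"
    using in_ab n lam by (simp_all add: q_def inner_add_left inner_add_right algebra_simps)
  have qq: "q \<bullet> q = 1"
  proof -
    have "q \<bullet> q = 2 * lam * (lam * (1 + k)) + \<mu>^2 * (n \<bullet> n)"
      using in_ab n by (simp add: q_def inner_add_left inner_add_right algebra_simps power2_eq_square)
    also have "\<dots> = 1" unfolding lam nn \<mu>(2) by (simp add: lam_def power2_eq_square)
    finally show ?thesis .
  qed
  then have q1: "norm q = 1" by (simp add: norm_eq_1)
  \<comment> \<open>The great circle with pole \<open>q\<close> touches the parallel about
    \<open>d\<close> at the normalized projection of \<open>d\<close> to the plane orthogonal to
    \<open>q\<close>; the projection has length \<open>c\<close>. At this point both circles run in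
    the same direction.\<close>
  have tangent: "(1 / c) *\<^sub>R (d - r *\<^sub>R q) \<in> parallel d c" "q \<bullet> ((1 / c) *\<^sub>R (d - r *\<^sub>R q)) = 0"
    "(1 / r) *\<^sub>R cross3 d ((1 / c) *\<^sub>R (d - r *\<^sub>R q)) = cross3 q ((1 / c) *\<^sub>R (d - r *\<^sub>R q))"
    if d: "d \<bullet> d = 1" "q \<bullet> d = r" for d
  proof -
    have dq: "d \<bullet> q = r" using d(2) by (simp add: inner_commute)
    have c2: "1 - r * r = c * c" using cr(3) by (simp add: power2_eq_square)
    show "(1 / c) *\<^sub>R (d - r *\<^sub>R q) \<in> parallel d c"
      using d dq qq c2 cr(1) by (simp add: parallel_def norm_eq_1 inner_diff_left inner_diff_right)
    show "q \<bullet> ((1 / c) *\<^sub>R (d - r *\<^sub>R q)) = 0"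
      using d qq by (simp add: inner_diff_right)
    show "(1 / r) *\<^sub>R cross3 d ((1 / c) *\<^sub>R (d - r *\<^sub>R q)) = cross3 q ((1 / c) *\<^sub>R (d - r *\<^sub>R q))"
      using cr cross_skew[of d q]
      by (simp add: Cross3.right_diff_distrib cross_mult_right)
  qed
  define x where "x = (1 / c) *\<^sub>R (a - r *\<^sub>R q)"
  define y where "y = (1 / c) *\<^sub>R (b - r *\<^sub>R q)"
  define p where "p = cross3 q x"
  have x: "x \<in> parallel a c" "q \<bullet> x = 0" "state a r x = (x, p)"
    using tangent[OF in_ab(1) qa(1)] by (simp_all add: x_def p_def state_def)
  have y: "y \<in> parallel b c" "q \<bullet> y = 0" "state b r y = (y, cross3 q y)"
    using tangent[OF in_ab(2) qa(3)] by (simp_all add: y_def state_def)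
  have x1: "norm x = 1" "norm y = 1" using x y by (simp_all add: parallel_def)
  note on = orthonormal_cross3[OF q1 x1(1) x(2), folded p_def]
  have in_xp: "x \<bullet> x = 1" "p \<bullet> p = 1" "x \<bullet> p = 0" "p \<bullet> x = 0"
    using x1 on by (simp_all add: norm_eq_1 inner_commute)
  have y_exp: "y = (y \<bullet> x) *\<^sub>R x + (y \<bullet> p) *\<^sub>R p"
    using orthonormal_expansion[OF q1 x1(1) x(2), of y] y(2) by (simp add: p_def inner_commute)
  \<comment> \<open>The positive sign of \<mu> enters here: starting at \<open>x\<close> in the
    direction \<open>p\<close>, the great circle meets \<open>y\<close> within the first half
    turn.\<close>
  have yp: "y \<bullet> p > 0"
  proof -
    have "p = (1 / c) *\<^sub>R cross3 q a"
      by (simp add: p_def x_def Cross3.right_diff_distrib cross_mult_right)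
    then have "y \<bullet> p = (1 / c) * ((1 / c) * (b \<bullet> cross3 q a))"
      by (simp add: y_def inner_diff_left dot_cross_self)
    also have "b \<bullet> cross3 q a = q \<bullet> n"
      unfolding n_def by (metis cross_triple inner_commute)
    also have "q \<bullet> n = \<mu> * (1 - k^2)" using n nn by (simp add: q_def inner_add_left)
    finally show ?thesis using \<mu>(1) k2 cr(1) by simp
  qed
  have yy: "(y \<bullet> x)^2 + (y \<bullet> p)^2 = 1"
  proof -
    have "y \<bullet> y = (y \<bullet> x)^2 + (y \<bullet> p)^2"
      by (subst y_exp, subst (2) y_exp) (simp add: in_xp inner_add_left inner_add_right power2_eq_square)
    then show ?thesis using x1(2) by (simp add: norm_eq_1)
  qed
  define t where "t = arccos (y \<bullet> x)"
  have "(y \<bullet> x)^2 \<le> 1" using yy zero_le_power2[of "y \<bullet> p"] by linarith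
  then have "\<bar>y \<bullet> x\<bar> \<le> 1" by (simp add: abs_square_le_1)
  then have cos_t: "cos t = y \<bullet> x" and t: "0 \<le> t" "t \<le> pi"
    by (auto simp: t_def arccos_lbound arccos_ubound abs_le_iff)
  have "(sin t)^2 = (y \<bullet> p)^2" using yy sin_cos_squared_add[of t] cos_t by simp
  then have sin_t: "sin t = y \<bullet> p" using sin_ge_zero[OF t] yp by simp
  have t_pi: "t < pi" using t sin_t yp by (metis less_eq_real_def order_less_irrefl sin_pi)
  have circ: "circ 1 x p (- x) s = cos s *\<^sub>R x + sin s *\<^sub>R p" for s
    by (simp add: circ_def algebra_simps)
  have "arc_to {z. z \<bullet> (a + b) > 0} (x, p) (circ 1 x p (- x) t, circ_deriv 1 p (- x) t) t
      (circ_integral 1 x p (- x) t)"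
  proof (rule arc_to_circ)
    fix s assume s: "0 \<le> s" "s \<le> t"
    \<comment> \<open>A point on a great-circle arc shorter than a half turn is a nonnegative
      combination of the endpoints, here multiplied by \<open>sin t\<close>. Both endpoints have the
      same positive inner product with \<open>a + b\<close>.\<close>
    have "sin t *\<^sub>R circ 1 x p (- x) s = sin (t - s) *\<^sub>R x + sin s *\<^sub>R y"
      by (subst y_exp) (simp add: circ cos_t[symmetric] sin_t[symmetric] sin_diff algebra_simps)
    then have *: "sin t * (circ 1 x p (- x) s \<bullet> (a + b)) = sin (t - s) * (x \<bullet> (a + b)) + sin s * (y \<bullet> (a + b))"
      by (metis inner_add_left inner_scaleR_left)
    have "x \<bullet> (a + b) = (1 + k - 2 * r^2) / c" "y \<bullet> (a + b) = (1 + k - 2 * r^2) / c"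
      using in_ab qa by (simp_all add: x_def y_def inner_diff_left inner_add_right power2_eq_square algebra_simps
          diff_divide_distrib add_divide_distrib)
    then have "sin t * (circ 1 x p (- x) s \<bullet> (a + b)) = (sin (t - s) + sin s) * ((1 + k - 2 * r^2) / c)"
      unfolding * by (simp only: distrib_right)
    also have "\<dots> > 0"
    proof (rule mult_pos_pos)
      have "0 \<le> sin (t - s)" using s t by (intro sin_ge_zero) auto
      moreover have "0 \<le> sin s" using s t by (intro sin_ge_zero) auto
      moreover have "0 < sin s" if "s \<noteq> 0" using s t_pi that by (intro sin_gt_zero) auto
      ultimately show "0 < sin (t - s) + sin s" using sin_t yp by (cases "s = 0") auto
      show "0 < (1 + k - 2 * r^2) / c" using small cr by (simp add: k_def)
    qed
    finally have "0 < sin t * (circ 1 x p (- x) s \<bullet> (a + b))" .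
    then show "circ 1 x p (- x) s \<in> {z. z \<bullet> (a + b) > 0}"
      using sin_t yp by (simp add: zero_less_mult_iff)
  qed (use in_xp t in auto)
  moreover have "circ 1 x p (- x) t = y" unfolding circ cos_t sin_t using y_exp by simp
  moreover have "circ_deriv 1 p (- x) t = cross3 q y"
  proof -
    have "cross3 q y = cos t *\<^sub>R cross3 q x + sin t *\<^sub>R cross3 q p"
      by (subst y_exp) (simp add: cos_t sin_t cross_add_right cross_mult_right)
    then show ?thesis using on by (simp add: circ_deriv_def p_def[symmetric])
  qed
  ultimately show ?thesis using x y by metis
qed

lemma norm_diff_le_derivative_bound:
  fixes f :: "real \<Rightarrow> 'a::real_normed_vector"
  assumes f: "\<And>s. s \<in> {0..l} \<Longrightarrow> (f has_vector_derivative f' s) (at s within {0..l})"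
    and B: "\<And>s. s \<in> {0..l} \<Longrightarrow> norm (f' s) \<le> B" and "x \<in> {0..l}" "y \<in> {0..l}"
  shows "norm (f x - f y) \<le> B * \<bar>x - y\<bar>"
proof -
  have "norm (f x - f y) \<le> B * norm (x - y)"
  proof (rule differentiable_bound[where S = "{0..l}" and f' = "\<lambda>s h. h *\<^sub>R f' s"])
    fix s assume s: "s \<in> {0..l}"
    show "(f has_derivative (\<lambda>h. h *\<^sub>R f' s)) (at s within {0..l})"
      using f[OF s] by (simp add: has_vector_derivative_def)
    have "norm (h *\<^sub>R f' s) \<le> B * norm h" for h
      using mult_right_mono[OF B[OF s], of "\<bar>h\<bar>"] by (simp add: mult.commute)
    then show "onorm (\<lambda>h. h *\<^sub>R f' s) \<le> B" by (rule onorm_le)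
  qed (use assms in auto)
  then show ?thesis by simp
qed

text \<open>The edge has length \<open>k * len\<close> and direction \<open>a\<close>; \<open>b\<close> is the direction of the next edge.\<close>
definition edge_curve where
  "edge_curve k \<rho> \<epsilon> len a b x y l p T D \<longleftrightarrow>
    l > 0 \<and> unit_curvature_curve l p T D \<and>
    (T 0, D 0) = x \<and> (T l, D l) = y \<and> p 0 = 0 \<and> p l = (k * len) *\<^sub>R a \<and>
    (\<forall>s. 0 \<le> s \<longrightarrow> s \<le> l / 2 \<longrightarrow> norm (T s - a) \<le> \<rho>) \<and>
    (\<forall>s\<in>{0..l}. T s \<bullet> (a + b) > 0) \<and>
    (\<forall>s\<in>{0..l}. norm (p s - (s / l * (k * len)) *\<^sub>R a) \<le> k * \<epsilon>)"

text \<open>For small \<rho> a tangent near one edge direction still advances along the sum of both;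
  the factor 2 bounds \<open>norm (a + b)\<close>.\<close>

lemma inner_sum_near:
  assumes "norm a = 1" "norm b = 1" "norm (x - a) \<le> \<rho>"
  shows "x \<bullet> (a + b) \<ge> 1 + a \<bullet> b - 2 * \<rho>"
proof -
  have "- (norm (x - a) * norm (a + b)) \<le> (x - a) \<bullet> (a + b)"
    using Cauchy_Schwarz_ineq2[of "x - a" "a + b"] by linarith
  moreover have "norm (x - a) * norm (a + b) \<le> \<rho> * 2"
    using assms norm_triangle_ineq[of a b] order_trans[OF norm_ge_zero assms(3)] by (intro mult_mono) auto
  moreover have "(x - a) \<bullet> (a + b) = x \<bullet> (a + b) - (1 + a \<bullet> b)"
    using assms by (simp add: inner_diff_left inner_add_right norm_eq_1)
  ultimately show ?thesis by linarith
qed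

text \<open>The turn stands at the end, so the first half of the edge has tangents near
  \<open>a\<close>, and the control at the preceding vertex relies on this. The drift from uniform
  motion along \<open>a\<close> grows at rate at most \<rho> on the straight part and at most 2
  during the turn, whose length \<open>m\<close> is fixed. Relative to \<open>k\<close> the first
  contribution is of order \<open>\<rho> * len\<close> and the second becomes negligible.\<close>

lemma ex_edge_curve:
  assumes a: "norm a = 1" and b: "norm b = 1" and cr: "c > 0" "r > 0" "c^2 + r^2 = 1"
    and \<rho>: "\<rho> > 0" "2 - 2 * c < \<rho>^2" "2 * \<rho> < 1 + a \<bullet> b" "\<rho> \<le> 1/2"
    and xyz: "x \<in> parallel a c" "y \<in> parallel a c" "z \<in> parallel b c"
    and turn: "arc_to {z. z \<bullet> (a + b) > 0} (state a r y) (state b r z) m w"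
    and len: "len > 0" and \<epsilon>: "\<epsilon> > 0" "8 * \<rho> * len \<le> \<epsilon>"
  shows "\<exists>k0. \<forall>k\<ge>k0. \<exists>l p T D. edge_curve k \<rho> \<epsilon> len a b (state a r x) (state b r z) l p T D"
proof -
  obtain t0 where t0: "\<And>t. t \<ge> t0 \<Longrightarrow>
      \<exists>l. arc_to (cball a \<rho>) (state a r x) (state a r y) l (t *\<^sub>R a - w)"
    using arc_to_along_axis[OF a cr \<rho>(1,2) xyz(1,2), of w] by blast
  obtain q R E where q: "unit_curvature_curve m q R E" "(R 0, E 0) = state a r y" "(R m, E m) = state b r z"
     "q 0 = 0" "q m = w" "\<forall>s\<in>{0..m}. R s \<in> {z. z \<bullet> (a + b) > 0}"
    using turn unfolding arc_to_def by blast
  have m0: "m \<ge> 0" using q(1) by (simp add: unit_curvature_curve_def)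
  \<comment> \<open>The three bounds make the target reachable, make the straight part at least as
    long as the turn, and make the error \<open>8 * m\<close> due to the turn at most half of
    \<open>k * \<epsilon>\<close>.\<close>
  define k0 where "k0 = max (\<bar>t0\<bar> / len) (max ((norm w + m + 1) / len) (16 * m / \<epsilon>))"
  show ?thesis
  proof (rule exI[of _ k0], intro allI impI)
    fix k assume "k \<ge> k0"
    then have "\<bar>t0\<bar> / len \<le> k" "(norm w + m + 1) / len \<le> k" "16 * m / \<epsilon> \<le> k"
      by (simp_all add: k0_def)
    then have k: "t0 \<le> k * len" "norm w + m + 1 \<le> k * len" "16 * m \<le> k * \<epsilon>"
      using len \<epsilon> by (simp_all add: pos_divide_le_eq)
    obtain h where "arc_to (cball a \<rho>) (state a r x) (state a r y) h ((k * len) *\<^sub>R a - w)"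
      using t0[OF k(1)] by blast
    then obtain p T D where p: "unit_curvature_curve h p T D" "(T 0, D 0) = state a r x" "(T h, D h) = state a r y"
      "p 0 = 0" "p h = (k * len) *\<^sub>R a - w" "\<forall>s\<in>{0..h}. T s \<in> cball a \<rho>"
      unfolding arc_to_def by blast
    have h0: "h \<ge> 0" using p(1) by (simp add: unit_curvature_curve_def)
    have "norm (p h - p 0) \<le> 1 * \<bar>h - 0\<bar>"
      by (rule norm_diff_le_derivative_bound[where l = h and f' = T])
        (use p(1) h0 in \<open>auto simp: unit_curvature_curve_def\<close>)
    moreover have "k * len \<le> norm ((k * len) *\<^sub>R a - w) + norm w"
    proof -
      have "norm ((k * len) *\<^sub>R a) = \<bar>k * len\<bar>" using a by simp
      then show ?thesis using norm_triangle_sub[of "(k * len) *\<^sub>R a" w] by linarith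
    qed
    ultimately have hm: "h > 0" "h \<ge> m" using p h0 k(2) m0 by auto
    define l where "l = h + m"
    define P where "P = join h p (\<lambda>s. p h + q s)"
    define S where "S = join h T R"
    define F where "F = join h D E"
    have eq: "p h = p h + q 0" "T h = R 0" "D h = E 0"
    proof -
      have "(T h, D h) = (R 0, E 0)" using p(3) q(2) by simp
      then show "p h = p h + q 0" "T h = R 0" "D h = E 0" using q(4) by simp_all
    qed
    have curve: "unit_curvature_curve l P S F"
      unfolding l_def P_def S_def F_def
      by (rule unit_curvature_curve_join[OF p(1) unit_curvature_curve_translate[OF q(1)] eq])
    have S1: "S s = T s" if "s \<le> h" for s using that by (simp add: S_def join_def)
    have S2: "S s = R (s - h)" if "s \<ge> h" for s unfolding S_def by (rule join_simps(2)[where f = T and g = R, OF h0 eq(2) that])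
    have l0: "l > 0" using hm m0 by (simp add: l_def)
    have start: "(S 0, F 0) = state a r x" using p(2) h0 by (simp add: S_def F_def join_def)
    have fin: "(S l, F l) = state b r z"
      using q(3) m0 join_simps(2)[where f = T and g = R, OF h0 eq(2), of l] join_simps(2)[where f = D and g = E, OF h0 eq(3), of l]
      unfolding S_def F_def l_def by simp
    have P0: "P 0 = 0" using p(4) h0 by (simp add: P_def join_def)
    have Pl: "P l = (k * len) *\<^sub>R a"
      using p(5) q(5) m0 join_simps(2)[where f = p and g = "\<lambda>s. p h + q s", OF h0 eq(1), of l] unfolding P_def l_def by simp
    have near: "norm (S s - a) \<le> \<rho>" if "0 \<le> s" "s \<le> h" for s
      using p(6) that by (auto simp: S1 dist_norm norm_minus_commute)
    have half: "norm (S s - a) \<le> \<rho>" if "0 \<le> s" "s \<le> l / 2" for s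
      using near[of s] that hm by (simp add: l_def)
    have cone: "S s \<bullet> (a + b) > 0" if s: "s \<in> {0..l}" for s
    proof (cases "s \<le> h")
      case True
      then show ?thesis using inner_sum_near[OF a b near[of s]] s \<rho>(3) by auto
    next
      case False
      then show ?thesis using q(6) s S2[of s] by (auto simp: l_def)
    qed
    define G where "G = (\<lambda>s. P s - s *\<^sub>R a)"
    have G': "(G has_vector_derivative S s - a) (at s within {0..l})" if "s \<in> {0..l}" for s
      unfolding G_def using curve that
      by (auto simp: unit_curvature_curve_def intro!: derivative_eq_intros)
    have G2: "norm (S s - a) \<le> 2" if "s \<in> {0..l}" for s
      using curve that norm_triangle_ineq4[of "S s" a] a by (auto simp: unit_curvature_curve_def)
    have G_near: "norm (G s) \<le> \<rho> * s" if s: "s \<in> {0..h}" for s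
    proof -
      have "norm (G s - G 0) \<le> \<rho> * \<bar>s - 0\<bar>"
      proof (rule norm_diff_le_derivative_bound[where l = h and f' = "\<lambda>s. S s - a"])
        fix t assume t: "t \<in> {0..h}"
        then show "(G has_vector_derivative S t - a) (at t within {0..h})"
          using m0 has_vector_derivative_within_subset[OF G'[of t], of "{0..h}"] by (auto simp: l_def)
        show "norm (S t - a) \<le> \<rho>" using near t by auto
      qed (use s in auto)
      then show ?thesis using P0 s by (simp add: G_def)
    qed
    have G_all: "norm (G s) \<le> \<rho> * s + 2 * m" if s: "s \<in> {0..l}" for s
    proof (cases "s \<le> h")
      case True
      then show ?thesis using G_near[of s] s m0 by auto
    next
      case False
      have "norm (G s - G h) \<le> 2 * \<bar>s - h\<bar>"
        by (rule norm_diff_le_derivative_bound[where l = l and f' = "\<lambda>s. S s - a"])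
          (use G' G2 s h0 m0 in \<open>auto simp: l_def\<close>)
      moreover have "norm (G s) \<le> norm (G h) + norm (G s - G h)"
        by (rule norm_triangle_sub)
      moreover have "\<rho> * h \<le> \<rho> * s" using False \<rho>(1) by simp
      ultimately show ?thesis using G_near[of h] False h0 s by (auto simp: l_def)
    qed
    \<comment> \<open>The length of the piece differs from that of the edge; since
      \<open>P l\<close> is exact, the difference is the drift at the end. The comparison point
      moves with speed \<open>k * len / l\<close> instead of 1, so this difference enters the final
      estimate as well.\<close>
    have l_diff: "\<bar>k * len - l\<bar> \<le> \<rho> * l + 2 * m"
    proof -
      have "G l = (k * len - l) *\<^sub>R a" unfolding G_def Pl by (simp add: scaleR_diff_left)
      then have "norm (G l) = \<bar>k * len - l\<bar>" using a by simp
      then show ?thesis using G_all[of l] l0 by simp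
    qed
    have \<rho>l: "\<rho> * l \<le> l / 2" using \<rho>(4) l0 by simp
    then have l_le: "l \<le> 2 * (k * len) + 4 * m" using l_diff by linarith
    have "norm (P s - (s / l * (k * len)) *\<^sub>R a) \<le> k * \<epsilon>" if s: "s \<in> {0..l}" for s
    proof -
      have "P s - (s / l * (k * len)) *\<^sub>R a = G s + (s / l * (l - k * len)) *\<^sub>R a"
        using l0 by (simp add: G_def algebra_simps)
      then have "norm (P s - (s / l * (k * len)) *\<^sub>R a) \<le> norm (G s) + \<bar>s / l * (l - k * len)\<bar>"
        using norm_triangle_ineq[of "G s" "(s / l * (l - k * len)) *\<^sub>R a"] a by simp
      also have "\<dots> \<le> norm (G s) + 1 * \<bar>k * len - l\<bar>"
        unfolding abs_mult using s l0 by (intro add_left_mono mult_mono) (auto simp: abs_minus_commute)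
      also have "norm (G s) + 1 * \<bar>k * len - l\<bar> \<le> 2 * (\<rho> * l + 2 * m)"
      proof -
        have "\<rho> * s \<le> \<rho> * l" using s \<rho>(1) by simp
        then have "norm (G s) \<le> \<rho> * l + 2 * m" using G_all[OF s] by linarith
        then show ?thesis using l_diff unfolding mult_2[of "\<rho> * l + 2 * m"] mult_1 by (rule add_mono)
      qed
      also have "\<dots> \<le> 2 * (\<rho> * (2 * (k * len) + 4 * m) + 2 * m)"
        using mult_left_mono[OF l_le, of \<rho>] \<rho>(1) by simp
      also have "\<dots> \<le> (8 * \<rho> * len) * k / 2 + 8 * m"
      proof -
        have "\<rho> * m \<le> m / 2" using mult_right_mono[OF \<rho>(4) m0] by simp
        then show ?thesis by (simp add: algebra_simps)
      qed
      also have "\<dots> \<le> \<epsilon> * k / 2 + 8 * m"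
      proof -
        have "0 \<le> k * \<epsilon>" using k(3) m0 by linarith
        then have "k \<ge> 0" using \<epsilon>(1) by (simp add: zero_le_mult_iff)
        then show ?thesis using mult_right_mono[OF \<epsilon>(2), of k] by (simp add: algebra_simps)
      qed
      also have "\<dots> \<le> k * \<epsilon>" using k(3) by (simp add: algebra_simps)
      finally show ?thesis .
    qed
    then have "edge_curve k \<rho> \<epsilon> len a b (state a r x) (state b r z) l P S F"
      unfolding edge_curve_def using l0 curve start fin P0 Pl half cone by blast
    then show "\<exists>l p T D. edge_curve k \<rho> \<epsilon> len a b (state a r x) (state b r z) l p T D" by blast
  qed
qed

subsection \<open>Gluing\<close>

text \<open>\<open>Q (i + n)\<close> and \<open>Q i\<close> are the same predicate, so
  \<open>SOME\<close> picks the same witness for both. All pieces are chosen in this way, which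
  makes the curve close up.\<close>

lemma periodic_choice:
  fixes n :: int
  assumes "\<And>i. \<exists>x. Q i x" "\<And>i. Q (i + n) = Q i"
  shows "\<exists>f. \<forall>i. Q i (f i) \<and> f (i + n) = f i"
  using assms by (intro exI[of _ "\<lambda>i. SOME x. Q i x"]) (auto intro: someI_ex)

lemma periodic_int_mod:
  fixes n :: int
  assumes "n > 0" "\<And>i. f (i + n) = f i"
  shows "f i = f (i mod n)" and "i mod n \<in> {0..<n}"
proof -
  have "i = i mod n + i div n * n" by simp
  then show "f i = f (i mod n)" using shift_periodic_int[of f n "i mod n" "i div n"] assms(2) by simp
  show "i mod n \<in> {0..<n}" using assms(1) by simp
qed

lemma periodic_lower_bound:
  fixes n :: int and f :: "int \<Rightarrow> real"
  assumes "n > 0" "\<And>i. f (i + n) = f i" "\<And>i. f i > 0"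
  shows "\<exists>d>0. \<forall>i. d \<le> f i"
proof (intro exI conjI allI)
  have fin: "finite (f ` {0..<n})" "f ` {0..<n} \<noteq> {}" using assms(1) by auto
  show "Min (f ` {0..<n}) > 0" using fin assms(3) by (auto simp: Min_gr_iff)
  show "Min (f ` {0..<n}) \<le> f i" for i
    using fin periodic_int_mod[of n f i] assms by (metis Min_le image_eqI)
qed

lemma periodic_upper_bound:
  fixes n :: int and f :: "int \<Rightarrow> real"
  assumes "n > 0" "\<And>i. f (i + n) = f i"
  shows "\<exists>K>0. \<forall>i. f i \<le> K"
proof (intro exI conjI allI)
  have fin: "finite (f ` {0..<n})" "f ` {0..<n} \<noteq> {}" using assms(1) by auto
  show "max 1 (Max (f ` {0..<n})) > 0" by simp
  show "f i \<le> max 1 (Max (f ` {0..<n}))" for i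
    using fin periodic_int_mod[of n f i] assms by (metis Max_ge image_eqI max.coboundedI2)
qed

text \<open>For lengths \<open>l\<close> of the pieces these are the arclength parameters of the
  vertices; the sign for negative \<open>i\<close> makes one recursion valid on all
  integers.\<close>

definition partial_sums :: "(int \<Rightarrow> real) \<Rightarrow> int \<Rightarrow> real" where
  "partial_sums l i = (if i \<ge> 0 then \<Sum>j\<in>{0..<i}. l j else - (\<Sum>j\<in>{i..<0}. l j))"

lemma partial_sums_Suc: "partial_sums l (i + 1) = partial_sums l i + l i"
proof (cases "i \<ge> 0")
  case True
  then have "{0..<i + 1} = insert i {0..<i}" by auto
  then show ?thesis using True by (simp add: partial_sums_def)
next
  case False
  then have "{i..<0} = insert i {i + 1..<0}" by auto
  then show ?thesis using False by (auto simp: partial_sums_def)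
qed

lemma partial_sums_periodic:
  assumes "\<And>i. l (i + n) = l i"
  shows "partial_sums l (i + n) = partial_sums l i + partial_sums l n"
proof (induction i rule: int_induct[where k = 0])
  case base
  then show ?case by (simp add: partial_sums_def)
next
  case (step1 i)
  then show ?case using partial_sums_Suc[of l i] partial_sums_Suc[of l "i + n"] assms[of i]
    by (simp add: algebra_simps)
next
  case (step2 i)
  then show ?case using partial_sums_Suc[of l "i - 1"] partial_sums_Suc[of l "i - 1 + n"] assms[of "i - 1"]
    by (simp add: algebra_simps)
qed

lemma strict_mono_int:
  fixes S :: "int \<Rightarrow> 'a::linorder"
  assumes "\<And>i. S i < S (i + 1)"
  shows "strict_mono S"
proof (rule strict_monoI)
  fix i j :: int
  assume "i < j"
  then have "i + 1 \<le> j" by simp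
  then show "S i < S j"
  proof (induction j rule: int_ge_induct)
    case base
    show ?case by (rule assms)
  next
    case (step j)
    then show ?case using assms[of j] less_trans by blast
  qed
qed

lemma interval_index_unique:
  fixes S :: "int \<Rightarrow> real"
  assumes "strict_mono S" "S i \<le> s" "s < S (i + 1)" "S j \<le> s" "s < S (j + 1)"
  shows "i = j"
proof (rule ccontr)
  assume "i \<noteq> j"
  then have "i + 1 \<le> j \<or> j + 1 \<le> i" by auto
  then have "S (i + 1) \<le> S j \<or> S (j + 1) \<le> S i"
    using strict_mono_less_eq[OF assms(1)] by blast
  then show False using assms by linarith
qed

definition glue :: "(int \<Rightarrow> real) \<Rightarrow> (int \<Rightarrow> real \<Rightarrow> 'a) \<Rightarrow> real \<Rightarrow> 'a" where
  "glue S F s = (let i = (SOME i. S i \<le> s \<and> s < S (i + 1)) in F i (s - S i))"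

text \<open>The choice in \<open>glue\<close> is unique on half-open intervals; agreement at the
  right end extends the formula to closed ones, on which the one-sided derivatives of the pieces
  live.\<close>

lemma glue_eq:
  assumes S: "strict_mono S" and s: "S i \<le> s" "s \<le> S (i + 1)"
    and F: "F i (S (i + 1) - S i) = F (i + 1) 0"
  shows "glue S F s = F i (s - S i)"
proof -
  have *: "glue S F s = F j (s - S j)" if "S j \<le> s" "s < S (j + 1)" for j
  proof -
    have "(SOME i. S i \<le> s \<and> s < S (i + 1)) = j"
      using that interval_index_unique[OF S] by (intro some_equality) auto
    then show ?thesis by (simp add: glue_def)
  qed
  show ?thesis
  proof (cases "s = S (i + 1)")
    case True
    then show ?thesis using *[of "i + 1"] F strict_mono_less[OF S, of "i + 1" "i + 1 + 1"] by simp
  next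
    case False
    then show ?thesis using * s by simp
  qed
qed

text \<open>At a breakpoint the two pieces that meet there have the same one-sided derivative
  \<open>d\<close>, since \<open>der\<close> covers every closed piece that contains
  \<open>s\<close>.\<close>

lemma has_vector_derivative_at_if_pieces:
  fixes f :: "real \<Rightarrow> 'a::real_normed_vector" and S :: "int \<Rightarrow> real"
  assumes S: "strict_mono S" and s: "S i \<le> s" "s < S (i + 1)"
    and der: "\<And>j. s \<in> {S j..S (j + 1)} \<Longrightarrow> (f has_vector_derivative d) (at s within {S j..S (j + 1)})"
  shows "(f has_vector_derivative d) (at s)"
proof (cases "s = S i")
  case False
  then have "s \<in> interior {S i..S (i + 1)}" using s by (simp add: interior_atLeastAtMost_real)
  then show ?thesis using der[of i] s at_within_interior by fastforce
next
  case True
  have lt: "S (i - 1) < S i" "S i < S (i + 1)" using strict_mono_less[OF S] by auto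
  have "(f has_vector_derivative d) (at s within {S (i - 1)..S i})"
    "(f has_vector_derivative d) (at s within {S i..S (i + 1)})"
    using der[of "i - 1"] der[of i] True lt by auto
  then have "(f has_vector_derivative d) (at s within {S (i - 1)..S i} \<union> {S i..S (i + 1)})"
    by (auto simp: has_vector_derivative_def has_derivative_within Lim_Un)
  moreover have "s \<in> interior ({S (i - 1)..S i} \<union> {S i..S (i + 1)})"
  proof (rule interiorI)
    show "s \<in> {S (i - 1)<..<S (i + 1)}" using True lt by simp
  qed auto
  ultimately show ?thesis using at_within_interior by metis
qed

lemma isCont_if_pieces:
  fixes f :: "real \<Rightarrow> 'a::topological_space" and S :: "int \<Rightarrow> real"
  assumes S: "strict_mono S" and s: "S i \<le> s" "s < S (i + 1)"
    and cont: "\<And>j. continuous_on {S j..S (j + 1)} f"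
  shows "isCont f s"
proof -
  have lt: "S (i - 1) < S i" using strict_mono_less[OF S] by auto
  have "continuous_on ({S (i - 1)..S i} \<union> {S i..S (i + 1)}) f"
    using cont[of "i - 1"] cont[of i] by (intro continuous_on_closed_Un) auto
  then have "continuous_on {S (i - 1)<..<S (i + 1)} f"
    by (rule continuous_on_subset) auto
  then show ?thesis using s lt by (auto simp: continuous_on_eq_continuous_at)
qed

section \<open>Piecewise linear time changes\<close>

lemma isCont_broken_line:
  fixes v :: "int \<Rightarrow> 'a::real_normed_vector"
  shows "isCont (broken_line v) t"
proof (rule isCont_if_pieces[of "\<lambda>i. of_int i" "\<lfloor>t\<rfloor>"])
  show "strict_mono (\<lambda>i::int. real_of_int i)" by (rule strict_monoI) simp
  have "continuous_on {of_int j..of_int j + 1} (broken_line v)" for j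
  proof (rule continuous_on_eq)
    show "continuous_on {of_int j..of_int j + 1} (\<lambda>s. v j + (s - of_int j) *\<^sub>R (v (j + 1) - v j))"
      by (intro continuous_intros)
  qed (auto simp: broken_line_eq[symmetric])
  then show "continuous_on {of_int j..of_int (j + 1)} (broken_line v)" for j by simp
qed (auto intro: of_int_floor_le simp: floor_less_iff)

text \<open>From a point of edge \<open>i\<close> to a later point not beyond edge
  \<open>i + 1\<close> at most one vertex is crossed. The coefficients are the times spent on the
  two edges, so bounds for the edges become bounds for the increment.\<close>

lemma broken_line_increment:
  assumes "of_int i \<le> s" "s \<le> of_int i + 1" "s \<le> t" "t \<le> of_int i + 2"
  obtains \<alpha> \<beta> where "\<alpha> \<ge> 0" "\<beta> \<ge> 0" "\<alpha> + \<beta> = t - s"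
    "broken_line v t - broken_line v s = \<alpha> *\<^sub>R (v (i + 1) - v i) + \<beta> *\<^sub>R (v (i + 2) - v (i + 1))"
proof (cases "t \<le> of_int i + 1")
  case True
  have "broken_line v t - broken_line v s = (t - s) *\<^sub>R (v (i + 1) - v i) + 0 *\<^sub>R (v (i + 2) - v (i + 1))"
    using broken_line_eq[of i s v] broken_line_eq[of i t v] True assms
    by (simp add: scaleR_left.diff[symmetric] del: scaleR_left_diff_distrib)
  then show ?thesis using that[of "t - s" 0] assms by simp
next
  case False
  define e where "e = v (i + 1) - v i"
  define e' where "e' = v (i + 2) - v (i + 1)"
  have "broken_line v t = v (i + 1) + (t - (of_int i + 1)) *\<^sub>R e'"
    using broken_line_eq[of "i + 1" t v] False assms by (simp add: add.assoc e'_def)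
  moreover have "broken_line v s = v i + (s - of_int i) *\<^sub>R e" using broken_line_eq[of i s v] assms by (simp add: e_def)
  moreover have "v (i + 1) = v i + e" by (simp add: e_def)
  ultimately have "broken_line v t - broken_line v s =
      (v i + e + (t - (of_int i + 1)) *\<^sub>R e') - (v i + (s - of_int i) *\<^sub>R e)"
    by simp
  also have "\<dots> = (of_int i + 1 - s) *\<^sub>R e + (t - (of_int i + 1)) *\<^sub>R e'"
    by (simp add: algebra_simps)
  finally have "broken_line v t - broken_line v s = (of_int i + 1 - s) *\<^sub>R e + (t - (of_int i + 1)) *\<^sub>R e'" .
  then show ?thesis using that[of "of_int i + 1 - s" "t - (of_int i + 1)"] assms False
    unfolding e_def e'_def by simp
qed

lemma broken_line_lower_bound:
  fixes S :: "int \<Rightarrow> real"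
  assumes d: "\<And>i. d \<le> S (i + 1) - S i" and "s \<le> t"
  shows "d * (t - s) \<le> broken_line S t - broken_line S s"
proof -
  have step: "d * (t - s) \<le> broken_line S t - broken_line S s" if "of_int i \<le> s" "s \<le> t" "t \<le> of_int i + 1" for i s t
  proof -
    have "broken_line S t - broken_line S s = (t - s) * (S (i + 1) - S i)"
      using broken_line_eq[of i s S] broken_line_eq[of i t S] that by (simp add: algebra_simps)
    then show ?thesis using mult_left_mono[OF d[of i], of "t - s"] that by (simp add: mult.commute)
  qed
  have "\<forall>s\<le>t. t - s \<le> real m \<longrightarrow> d * (t - s) \<le> broken_line S t - broken_line S s" for m t
  proof (induction m arbitrary: t)
    case 0
    then show ?case by auto
  next
    case (Suc m)
    show ?case
    proof (intro allI impI)
      fix s assume s: "s \<le> t" "t - s \<le> real (Suc m)"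
      \<comment> \<open>The interval from \<open>s\<close> to \<open>w\<close> has length at most 1
        and at most one integer in its interior, where it is split at \<open>u\<close>; what remains
        has length at most \<open>m\<close>, as the induction needs.\<close>
      define u where "u = min t (of_int (\<lfloor>s\<rfloor> + 1))"
      define w where "w = min t (s + 1)"
      have u: "s \<le> u" "u \<le> w" "w \<le> t" using s by (auto simp: u_def w_def) linarith+
      have "d * (u - s) \<le> broken_line S u - broken_line S s"
        by (rule step[of "\<lfloor>s\<rfloor>"]) (use u in \<open>auto simp: u_def\<close>)
      moreover have "d * (w - u) \<le> broken_line S w - broken_line S u"
      proof (cases "t \<le> of_int (\<lfloor>s\<rfloor> + 1)")
        case True
        then have "w = u" using u by (auto simp: u_def min_def)
        then show ?thesis by simp
      next
        case False
        then have "u = of_int (\<lfloor>s\<rfloor> + 1)" by (simp add: u_def)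
        moreover have "w \<le> s + 1" by (simp add: w_def)
        then have "w \<le> of_int (\<lfloor>s\<rfloor> + 1) + 1" by linarith
        ultimately show ?thesis using u by (intro step[of "\<lfloor>s\<rfloor> + 1"]) auto
      qed
      moreover have "d * (t - w) \<le> broken_line S t - broken_line S w"
      proof (cases "t \<le> s + 1")
        case True
        then show ?thesis by (simp add: w_def min_def)
      next
        case False
        then show ?thesis using Suc.IH[of t] s by (auto simp: w_def)
      qed
      ultimately show "d * (t - s) \<le> broken_line S t - broken_line S s" by (simp add: algebra_simps)
    qed
  qed
  moreover obtain m :: nat where "t - s \<le> real m" using real_arch_simple by blast
  ultimately show ?thesis using assms(2) by blast
qed

lemma broken_line_bij:
  fixes S :: "int \<Rightarrow> real"
  assumes d: "d > 0" "\<And>i. d \<le> S (i + 1) - S i"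
  shows "strict_mono (broken_line S)" "surj (broken_line S)"
proof -
  show "strict_mono (broken_line S)"
  proof (rule strict_monoI)
    fix s t :: real assume "s < t"
    then have "0 < d * (t - s)" using d(1) by simp
    then show "broken_line S s < broken_line S t" using broken_line_lower_bound[where S = S and d = d, OF d(2), of s t] \<open>s < t\<close> by simp
  qed
  have "\<exists>t. broken_line S t = y" for y
  proof -
    \<comment> \<open>The slope is at least \<open>d\<close>, so the values at \<open>- b\<close>
      and \<open>b\<close> enclose \<open>y\<close>.\<close>
    define b where "b = \<bar>y - broken_line S 0\<bar> / d"
    have b: "b \<ge> 0" "d * b = \<bar>y - broken_line S 0\<bar>" using d(1) by (auto simp: b_def)
    have "broken_line S (- b) \<le> y" using broken_line_lower_bound[where S = S and d = d, OF d(2), of "-b" 0] b by simp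
    moreover have "y \<le> broken_line S b" using broken_line_lower_bound[where S = S and d = d, OF d(2), of 0 b] b by simp
    ultimately show ?thesis using IVT[of "broken_line S" "-b" y b] isCont_broken_line[where v = S] b by auto
  qed
  then show "surj (broken_line S)" by (metis surjI)
qed

subsection \<open>Approximation of polygons\<close>

text \<open>The straight-line homotopy from \<open>F\<close> to \<open>G\<close> keeps \<open>x\<close> and \<open>y\<close> apart, with a margin
  proportional to their relative displacement.\<close>
definition separated :: "real \<Rightarrow> ('i \<Rightarrow> 'a::real_normed_vector) \<Rightarrow> ('i \<Rightarrow> 'a) \<Rightarrow> 'i \<Rightarrow> 'i \<Rightarrow> bool" where
  "separated c F G x y \<longleftrightarrow> F x \<noteq> F y \<and> (\<forall>t. 0 \<le> t \<longrightarrow> t \<le> 1 \<longrightarrow>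
     c * norm ((G x - F x) - (G y - F y)) \<le> norm ((F x - F y) + t *\<^sub>R ((G x - F x) - (G y - F y))))"

lemma separated_sym:
  assumes "separated c F G x y"
  shows "separated c F G y x"
proof -
  have 1: "norm ((G y - F y) - (G x - F x)) = norm ((G x - F x) - (G y - F y))"
    by (rule norm_minus_commute)
  have 2: "norm ((F y - F x) + t *\<^sub>R ((G y - F y) - (G x - F x))) =
      norm ((F x - F y) + t *\<^sub>R ((G x - F x) - (G y - F y)))" for t
  proof -
    have "(F y - F x) + t *\<^sub>R ((G y - F y) - (G x - F x)) =
      - ((F x - F y) + t *\<^sub>R ((G x - F x) - (G y - F y)))"
      by (simp add: algebra_simps)
    then show ?thesis by (simp only: norm_minus_cancel)
  qed
  show ?thesis using assms unfolding separated_def 2 1 by auto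
qed

lemma separated_mono: "separated c F G x y \<Longrightarrow> d \<le> c \<Longrightarrow> separated d F G x y"
  unfolding separated_def by (meson mult_right_mono norm_ge_zero order_trans)

text \<open>During the homotopy the two points stay at least \<open>h / 2\<close> apart, while their
  relative displacement is at most \<open>h / 2\<close>. Where the images under \<open>G\<close> are
  far apart, closeness alone suffices.\<close>

lemma separated_far:
  assumes "norm (F x - G x) \<le> h / 4" "norm (F y - G y) \<le> h / 4" "norm (G x - G y) \<ge> h" "h > 0"
  shows "separated 1 F G x y"
proof -
  define d where "d = (G x - F x) - (G y - F y)"
  have d: "norm d \<le> h / 2"
    using norm_triangle_ineq4[of "G x - F x" "G y - F y"] assms(1,2)
    by (simp add: d_def norm_minus_commute)
  have low: "h / 2 \<le> norm ((F x - F y) + t *\<^sub>R d)" if "0 \<le> t" "t \<le> 1" for t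
  proof -
    have "G x - G y = ((F x - F y) + t *\<^sub>R d) + (1 - t) *\<^sub>R d" by (simp add: d_def algebra_simps)
    then have "norm (G x - G y) \<le> norm ((F x - F y) + t *\<^sub>R d) + norm ((1 - t) *\<^sub>R d)"
      by (metis norm_triangle_ineq)
    moreover have "norm ((1 - t) *\<^sub>R d) \<le> norm d" using that by (simp add: mult_left_le_one_le)
    ultimately show ?thesis using d assms(3) by linarith
  qed
  have "F x \<noteq> F y" using low[of 0] assms(4) by auto
  moreover have "1 * norm d \<le> norm ((F x - F y) + t *\<^sub>R d)" if "0 \<le> t" "t \<le> 1" for t
    using low[OF that] d by simp
  ultimately show ?thesis unfolding separated_def d_def by blast
qed

text \<open>Both increments have a component of at least \<open>c * s\<close> along
  \<open>e\<close>, hence so have all intermediate ones, which bounds the distance below by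
  \<open>c * s / 2\<close>. Dividing by the bound \<open>2 * M * s\<close> for the relative
  displacement gives \<open>c / (4 * M)\<close>.\<close>

lemma separated_near:
  assumes e: "norm e \<le> 2" and c: "c > 0" and s: "s > 0" and M: "M > 0"
    and "c * s \<le> (F x - F y) \<bullet> e" "c * s \<le> (G x - G y) \<bullet> e"
    and "norm (F x - F y) \<le> M * s" "norm (G x - G y) \<le> M * s"
  shows "separated (c / (4 * M)) F G x y"
proof -
  define d where "d = (G x - F x) - (G y - F y)"
  have d_eq: "d = (G x - G y) - (F x - F y)" by (simp add: d_def)
  have d: "norm d \<le> 2 * (M * s)"
    using norm_triangle_ineq4[of "G x - G y" "F x - F y"] assms(7,8) unfolding d_eq by linarith
  have low: "c * s / 2 \<le> norm ((F x - F y) + t *\<^sub>R d)" if t: "0 \<le> t" "t \<le> 1" for t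
  proof -
    have "c * s = (1 - t) * (c * s) + t * (c * s)" by (simp add: algebra_simps)
    also have "\<dots> \<le> (1 - t) * ((F x - F y) \<bullet> e) + t * ((G x - G y) \<bullet> e)"
      using t assms(5,6) by (intro add_mono mult_left_mono) auto
    also have "\<dots> = ((F x - F y) + t *\<^sub>R d) \<bullet> e"
      by (simp add: d_eq inner_add_left inner_diff_left algebra_simps)
    also have "\<dots> \<le> norm ((F x - F y) + t *\<^sub>R d) * norm e" by (rule norm_cauchy_schwarz)
    also have "\<dots> \<le> norm ((F x - F y) + t *\<^sub>R d) * 2" using e by (intro mult_left_mono) auto
    finally show ?thesis by simp
  qed
  have "F x \<noteq> F y" using low[of 0] mult_pos_pos[OF c s] by auto
  moreover have "c / (4 * M) * norm d \<le> norm ((F x - F y) + t *\<^sub>R d)" if "0 \<le> t" "t \<le> 1" for t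
  proof -
    have "c / (4 * M) * norm d \<le> c / (4 * M) * (2 * (M * s))"
      using d c M by (intro mult_left_mono) auto
    also have "\<dots> = c * s / 2" using M by simp
    finally show ?thesis using low[OF that] by simp
  qed
  ultimately show ?thesis unfolding separated_def d_def by blast
qed

text \<open>The number is half the square of \<open>norm (a + b)\<close>: only a reversal leaves no
  common direction of advance.\<close>

lemma sgn_turn_pos:
  fixes a b :: "'a::real_inner"
  assumes "norm a = 1" "norm b = 1" "b \<noteq> - a"
  shows "1 + a \<bullet> b > 0"
proof -
  have "0 < (a + b) \<bullet> (a + b)" using assms(3) by (simp add: add_eq_0_iff)
  also have "(a + b) \<bullet> (a + b) = 2 * (1 + a \<bullet> b)"
    using assms(1,2) by (simp add: inner_add_left inner_add_right norm_eq_1 inner_commute)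
  finally show ?thesis by simp
qed

lemma increment_ge_derivative_bound:
  fixes P :: "real \<Rightarrow> 'a::real_inner"
  assumes P: "\<And>s. (P has_vector_derivative T s) (at s)"
    and c: "\<And>s. x \<le> s \<Longrightarrow> s \<le> y \<Longrightarrow> c \<le> T s \<bullet> e" and "x \<le> y"
  shows "c * (y - x) \<le> (P y - P x) \<bullet> e"
proof -
  have "P x \<bullet> e - c * x \<le> P y \<bullet> e - c * y"
  proof (rule DERIV_nonneg_imp_nondecreasing[OF \<open>x \<le> y\<close>])
    fix s assume s: "x \<le> s" "s \<le> y"
    have "((\<lambda>s. P s \<bullet> e) has_real_derivative T s \<bullet> e) (at s)"
      using bounded_linear.has_vector_derivative[OF bounded_linear_inner_left P[of s], of e]
      by (simp add: has_real_derivative_iff_has_vector_derivative)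
    then have "((\<lambda>s. P s \<bullet> e - c * s) has_real_derivative T s \<bullet> e - c) (at s)"
      by (auto intro!: derivative_eq_intros)
    then show "\<exists>y. ((\<lambda>s. P s \<bullet> e - c * s) has_real_derivative y) (at s) \<and> 0 \<le> y"
      using c[OF s] by auto
  qed
  then show ?thesis by (simp add: inner_diff_left algebra_simps)
qed

text \<open>Shrinking by \<open>1 / k\<close> and running \<open>k\<close> times as fast keeps unit
  speed and multiplies the curvature by \<open>k\<close>.\<close>

lemma rescaled_unit_curvature:
  fixes P T D :: "real \<Rightarrow> real^3"
  assumes P: "\<And>s. (P has_vector_derivative T s) (at s)"
    and T: "\<And>s. (T has_vector_derivative D s) (at s)"
    and D: "\<And>s. isCont D s" and unit: "\<And>s. norm (T s) = 1" "\<And>s. norm (D s) = 1" and k: "k > 0"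
  defines "\<gamma> \<equiv> \<lambda>s. (1 / k) *\<^sub>R P (k * s)"
  shows "C2_curve \<gamma>" "norm (curve_deriv \<gamma> s) = 1" "norm (curve_deriv (curve_deriv \<gamma>) s) = k"
proof -
  have chain: "((\<lambda>s. f (k * s)) has_vector_derivative k *\<^sub>R f' (k * s)) (at s)"
    if "\<And>s. (f has_vector_derivative f' s) (at s)" for f f' :: "real \<Rightarrow> real^3" and s
  proof -
    have "((*) k has_vector_derivative k) (at s)" by (auto intro!: derivative_eq_intros)
    from vector_diff_chain_at[OF this that] show ?thesis by (simp add: o_def)
  qed
  have 1: "(\<gamma> has_vector_derivative T (k * s)) (at s)" for s
    unfolding \<gamma>_def using has_vector_derivative_scaleR[OF DERIV_const chain[OF P], of "1 / k" s] k by simp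
  have 2: "((\<lambda>s. T (k * s)) has_vector_derivative k *\<^sub>R D (k * s)) (at s)" for s
    by (rule chain[OF T])
  have d1: "curve_deriv \<gamma> = (\<lambda>s. T (k * s))" using vector_derivative_at[OF 1] by blast
  show "norm (curve_deriv \<gamma> s) = 1" using vector_derivative_at[OF 1] unit(1) by simp
  show "norm (curve_deriv (curve_deriv \<gamma>) s) = k" unfolding d1 using vector_derivative_at[OF 2] unit(2) k by simp
  have "continuous_on UNIV T" using T has_vector_derivative_continuous
    by (metis continuous_at_imp_continuous_on)
  then have c1: "continuous_on UNIV (\<lambda>s. T (k * s))"
    by (rule continuous_on_compose2) (auto intro!: continuous_intros)
  have "continuous_on UNIV D" using D by (simp add: continuous_at_imp_continuous_on)
  then have "continuous_on UNIV (\<lambda>s. D (k * s))"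
    by (rule continuous_on_compose2) (auto intro!: continuous_intros)
  then have c2: "continuous_on UNIV (\<lambda>s. k *\<^sub>R D (k * s))"
    by (rule continuous_on_scaleR[OF continuous_on_const])
  show "C2_curve \<gamma>"
    unfolding C2_curve_def d1 unfolding C1_differentiable_on_def
    by (intro conjI exI[of _ "\<lambda>s. T (k * s)"] exI[of _ "\<lambda>s. k *\<^sub>R D (k * s)"])
      (simp_all add: 1 2 c1 c2)
qed

text \<open>\<open>\<sigma>\<close> matches the parametrization \<open>broken_line v\<close> of the polygon, with period \<open>n\<close>, with the arclength of \<open>\<gamma>\<close>.\<close>
definition follows_polygon where
  "follows_polygon k n v \<epsilon> \<gamma> l \<sigma> c \<longleftrightarrow> l > 0 \<and> C2_curve \<gamma> \<and> (\<forall>s. \<gamma> (s + l) = \<gamma> s) \<and>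
    (\<forall>s. norm (curve_deriv \<gamma> s) = 1) \<and> (\<forall>s. norm (curve_deriv (curve_deriv \<gamma>) s) = k) \<and>
    surj \<sigma> \<and> (\<forall>t. \<sigma> (t + of_int n) = \<sigma> t + l) \<and>
    (\<forall>t. norm (\<gamma> (\<sigma> t) - broken_line v t) \<le> \<epsilon>) \<and> c > 0 \<and>
    (\<forall>s t. 0 \<le> s \<longrightarrow> s < of_int n \<longrightarrow> s < t \<longrightarrow> t \<le> s + 1/2 \<longrightarrow>
      separated c (\<lambda>t. \<gamma> (\<sigma> t)) (broken_line v) t s)"

lemma constant_curvature_near_polygon:
  fixes v :: "int \<Rightarrow> real^3" and n :: int
  assumes n: "n > 0" and per: "\<And>i. v (i + n) = v i" and ne: "\<And>i. v (i + 1) \<noteq> v i"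
    and turn: "\<And>i. sgn (v (i + 2) - v (i + 1)) \<noteq> - sgn (v (i + 1) - v i)" and \<epsilon>: "\<epsilon> > 0"
  shows "\<exists>k0>0. \<forall>k\<ge>k0. \<exists>\<gamma> l \<sigma> c. follows_polygon k n v \<epsilon> \<gamma> l \<sigma> c"
proof -
  define a where "a = (\<lambda>i. sgn (v (i + 1) - v i))"
  define b where "b = (\<lambda>i. a (i + 1))"
  define len where "len = (\<lambda>i. norm (v (i + 1) - v i))"
  have v1: "v (i + n + 1) = v (i + 1)" for i using per[of "i + 1"] by (simp add: algebra_simps)
  have a_per: "a (i + n) = a i" for i by (simp add: a_def per v1)
  have b_per: "b (i + n) = b i" for i using a_per[of "i + 1"] by (simp add: b_def algebra_simps)
  have len_per: "len (i + n) = len i" for i by (simp add: len_def per v1)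
  have a1: "norm (a i) = 1" and b1: "norm (b i) = 1" for i
    using ne[of i] ne[of "i + 1"] by (simp_all add: a_def b_def norm_sgn)
  have len0: "len i > 0" for i using ne by (simp add: len_def)
  have len_a: "len i *\<^sub>R a i = v (i + 1) - v i" for i
    using ne[of i] by (simp add: len_def a_def sgn_div_norm)
  have ab: "1 + a i \<bullet> b i > 0" for i
  proof (rule sgn_turn_pos[OF a1 b1])
    show "b i \<noteq> - a i" using turn[of i] by (simp add: a_def b_def add.assoc)
  qed
  \<comment> \<open>The first bound makes tangents near an edge direction advance along the sum of
    directions at the vertex, the second keeps the length of a piece comparable with its edge, and
    the third keeps the drift within \<epsilon>.\<close>
  obtain \<rho> where \<rho>: "\<rho> > 0" "\<And>i. \<rho> \<le> min (min ((1 + a i \<bullet> b i) / 4) (1/2)) (\<epsilon> / (8 * len i))"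
    using periodic_lower_bound[OF n, of "\<lambda>i. min (min ((1 + a i \<bullet> b i) / 4) (1/2)) (\<epsilon> / (8 * len i))"]
      ab \<epsilon> len0 a_per b_per len_per by auto
  have \<rho>_ab: "2 * \<rho> < 1 + a i \<bullet> b i" and \<rho>_half: "\<rho> \<le> 1/2" and \<rho>_len: "8 * \<rho> * len i \<le> \<epsilon>" for i
  proof -
    have "\<rho> \<le> (1 + a i \<bullet> b i) / 4" "\<rho> \<le> 1/2" "\<rho> \<le> \<epsilon> / (8 * len i)" using \<rho>(2)[of i] by auto
    then show "2 * \<rho> < 1 + a i \<bullet> b i" "\<rho> \<le> 1/2" "8 * \<rho> * len i \<le> \<epsilon>"
      using ab[of i] len0[of i] by (simp_all add: pos_le_divide_eq algebra_simps)
  qed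
  \<comment> \<open>Half of \<rho> leaves room: the squared distance \<open>2 - 2 * c\<close> of the
    parallel from its axis is at most \<open>2 * r^2 = \<rho>^2 / 2\<close>.\<close>
  define r where "r = \<rho> / 2"
  define c where "c = sqrt (1 - r^2)"
  have r: "r > 0" "r \<le> 1/4" using \<rho>(1) \<rho>_half by (simp_all add: r_def)
  have r2: "r^2 \<le> 1/4 * r" using r by (simp add: power2_eq_square mult_right_mono)
  have c: "c > 0" "c^2 + r^2 = 1" using r r2 by (simp_all add: c_def)
  have c_\<rho>: "2 - 2 * c < \<rho>^2"
  proof -
    have "c \<le> 1" using c(2) zero_le_power2[of r] by (simp add: c_def)
    then have "c^2 \<le> c" using c(1) by (simp add: power2_eq_square mult_left_le_one_le)
    then have "2 - 2 * c \<le> 2 * r^2" using c(2) by simp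
    also have "\<dots> < \<rho>^2" using \<rho>(1) by (simp add: r_def power2_eq_square)
    finally show ?thesis .
  qed
  have r_ab: "2 * r^2 < 1 + a i \<bullet> b i" for i
    using r2 r \<rho>_ab[of i] \<rho>(1) unfolding r_def by linarith

  have "\<exists>f. \<forall>i. (fst (f i) \<in> parallel (a i) c \<and> snd (f i) \<in> parallel (b i) c \<and>
      (\<exists>m w. arc_to {z. z \<bullet> (a i + b i) > 0} (state (a i) r (fst (f i))) (state (b i) r (snd (f i))) m w))
      \<and> f (i + n) = f i"
  proof (rule periodic_choice)
    fix i
    obtain x y m w where "x \<in> parallel (a i) c" "y \<in> parallel (b i) c"
      "arc_to {z. z \<bullet> (a i + b i) > 0} (state (a i) r x) (state (b i) r y) m w"
      using arc_to_next_axis[OF a1 b1 c(1) r(1) c(2) r_ab] by blast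
    then show "\<exists>f. fst f \<in> parallel (a i) c \<and> snd f \<in> parallel (b i) c \<and>
      (\<exists>m w. arc_to {z. z \<bullet> (a i + b i) > 0} (state (a i) r (fst f)) (state (b i) r (snd f)) m w)"
      by (intro exI[of _ "(x, y)"]) auto
  qed (simp add: a_per b_per)
  then obtain f where f: "\<And>i. fst (f i) \<in> parallel (a i) c" "\<And>i. snd (f i) \<in> parallel (b i) c"
      "\<And>i. \<exists>m w. arc_to {z. z \<bullet> (a i + b i) > 0} (state (a i) r (fst (f i))) (state (b i) r (snd (f i))) m w"
      "\<And>i. f (i + n) = f i"
    by blast
  \<comment> \<open>Edge \<open>i\<close> begins at the point where the turn of edge
    \<open>i - 1\<close> touches the parallel about \<open>b (i - 1) = a i\<close>; so the final
    state of each edge is the initial state of the next.\<close>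
  define A where "A = (\<lambda>i. state (a i) r (snd (f (i - 1))))"
  define B where "B = (\<lambda>i. state (b i) r (snd (f i)))"
  have f_per: "f (i + n - 1) = f (i - 1)" for i
    using f(4)[of "i - 1"] by (simp add: algebra_simps)
  have AB_per: "A (i + n) = A i" "B (i + n) = B i" for i
    by (simp_all add: A_def B_def a_per b_per f f_per)
  have AB: "B i = A (i + 1)" for i by (simp add: A_def B_def b_def)
  have "\<exists>k0. \<forall>i. (\<forall>k\<ge>k0 i. \<exists>l p T D. edge_curve k \<rho> \<epsilon> (len i) (a i) (b i) (A i) (B i) l p T D) \<and>
      k0 (i + n) = k0 i"
  proof (rule periodic_choice)
    fix i
    obtain m w where "arc_to {z. z \<bullet> (a i + b i) > 0} (state (a i) r (fst (f i))) (state (b i) r (snd (f i))) m w"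
      using f(3) by blast
    moreover have "snd (f (i - 1)) \<in> parallel (a i) c" using f(2)[of "i - 1"] by (simp add: b_def)
    ultimately show "\<exists>k0. \<forall>k\<ge>k0. \<exists>l p T D. edge_curve k \<rho> \<epsilon> (len i) (a i) (b i) (A i) (B i) l p T D"
      unfolding A_def B_def
      by (intro ex_edge_curve[OF a1 b1 c(1) r(1) c(2) \<rho>(1) c_\<rho> \<rho>_ab \<rho>_half _ f(1) f(2) _ len0 \<epsilon> \<rho>_len])
  qed (simp add: a_per b_per AB_per len_per)
  then obtain k0 where k0: "\<And>i k. k \<ge> k0 i \<Longrightarrow> \<exists>l p T D. edge_curve k \<rho> \<epsilon> (len i) (a i) (b i) (A i) (B i) l p T D"
    "\<And>i. k0 (i + n) = k0 i" by blast
  obtain K where K: "K > 0" "\<And>i. k0 i \<le> K" using periodic_upper_bound[OF n, of k0] k0(2) by auto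
  show ?thesis
  proof (rule exI[of _ K], rule conjI[OF K(1)], intro allI impI)
    fix k assume kK: "K \<le> k"
    then have k: "k > 0" using K by simp
    have "\<exists>E. \<forall>i. edge_curve k \<rho> \<epsilon> (len i) (a i) (b i) (A i) (B i) (fst (E i)) (fst (snd (E i))) (fst (snd (snd (E i)))) (snd (snd (snd (E i)))) \<and> E (i + n) = E i"
    proof (rule periodic_choice)
      fix i
      obtain l p T D where "edge_curve k \<rho> \<epsilon> (len i) (a i) (b i) (A i) (B i) l p T D"
        using k0(1)[of i k] K(2)[of i] kK by auto
      then show "\<exists>E. edge_curve k \<rho> \<epsilon> (len i) (a i) (b i) (A i) (B i) (fst E) (fst (snd E)) (fst (snd (snd E))) (snd (snd (snd E)))"
        by (intro exI[of _ "(l, p, T, D)"]) simp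
    qed (simp add: a_per b_per AB_per len_per)
    then obtain E where E: "\<And>i. edge_curve k \<rho> \<epsilon> (len i) (a i) (b i) (A i) (B i) (fst (E i)) (fst (snd (E i))) (fst (snd (snd (E i)))) (snd (snd (snd (E i))))"
      "\<And>i. E (i + n) = E i" by blast
    define l where "l = (\<lambda>i. fst (E i))"
    define p where "p = (\<lambda>i. fst (snd (E i)))"
    define T where "T = (\<lambda>i. fst (snd (snd (E i))))"
    define D where "D = (\<lambda>i. snd (snd (snd (E i))))"
    have edge: "edge_curve k \<rho> \<epsilon> (len i) (a i) (b i) (A i) (B i) (l i) (p i) (T i) (D i)" for i
      using E(1)[of i] by (simp add: l_def p_def T_def D_def)
    have E_per: "l (i + n) = l i" "p (i + n) = p i" for i
      using E(2) by (simp_all add: l_def p_def)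
    have l0: "l i > 0" for i using edge[of i] by (simp add: edge_curve_def)
    have ucc: "unit_curvature_curve (l i) (p i) (T i) (D i)" for i
      using edge[of i] by (simp add: edge_curve_def)
    have TD_match: "T i (l i) = T (i + 1) 0" "D i (l i) = D (i + 1) 0" for i
    proof -
      have "(T i (l i), D i (l i)) = B i" "(T (i + 1) 0, D (i + 1) 0) = A (i + 1)"
        using edge[of i] edge[of "i + 1"] by (simp_all add: edge_curve_def)
      then show "T i (l i) = T (i + 1) 0" "D i (l i) = D (i + 1) 0" using AB[of i] by (metis prod.inject)+
    qed
    define q where "q = (\<lambda>i s. k *\<^sub>R v i + p i s)"
    have q_match: "q i (l i) = q (i + 1) 0" for i
    proof -
      have "p i (l i) = k *\<^sub>R (len i *\<^sub>R a i)" "p (i + 1) 0 = 0"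
        using edge[of i] edge[of "i + 1"] by (simp_all add: edge_curve_def)
      then show ?thesis unfolding q_def len_a by (simp add: algebra_simps)
    qed
    define S where "S = partial_sums l"
    have S_Suc: "S (i + 1) = S i + l i" for i by (simp add: S_def partial_sums_Suc)
    have S_Suc2: "S (2 + i) = S (i + 1) + l (i + 1)" for i using S_Suc[of "i + 1"] by (simp add: add.commute)
    have S_per: "S (i + n) = S i + S n" for i
      unfolding S_def by (rule partial_sums_periodic) (rule E_per)
    have sm: "strict_mono S" by (rule strict_mono_int) (simp add: S_Suc l0)
    define \<Lambda> where "\<Lambda> = S n"
    have \<Lambda>: "\<Lambda> > 0"
      using strict_mono_less[OF sm, of 0 n] n by (simp add: \<Lambda>_def S_def partial_sums_def)
    obtain d where d: "d > 0" "\<And>i. d \<le> l i"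
      using periodic_lower_bound[OF n, of l] E_per l0 by blast
    have dS: "\<And>i. d \<le> S (i + 1) - S i" using d by (simp add: S_Suc)
    have bij: "strict_mono (broken_line S)" "surj (broken_line S)" using broken_line_bij[of d S] d(1) dS by blast+
    have idx: "\<exists>i. S i \<le> s \<and> s < S (i + 1)" for s
    proof -
      obtain t where t: "s = broken_line S t" using bij(2) by (metis surjD)
      have "broken_line S (of_int i) = S i" for i by (simp add: broken_line_def)
      then have "S \<lfloor>t\<rfloor> \<le> s" "s < S (\<lfloor>t\<rfloor> + 1)"
        unfolding t using strict_mono_less_eq[OF bij(1)] strict_mono_less[OF bij(1)]
        by (metis of_int_floor_le, metis floor_less_iff less_add_one)
      then show ?thesis by blast
    qed
    define P where "P = glue S q"
    define U where "U = glue S T"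
    define W where "W = glue S D"
    have glued: "P s = q i (s - S i)" "U s = T i (s - S i)" "W s = D i (s - S i)"
      if "S i \<le> s" "s \<le> S i + l i" for i s
      using that q_match TD_match unfolding P_def U_def W_def
      by (auto intro!: glue_eq[OF sm] simp: S_Suc)
    have unit: "norm (U s) = 1" "norm (W s) = 1" for s
    proof -
      obtain i where "S i \<le> s" "s < S i + l i" using idx[of s] S_Suc by metis
      then show "norm (U s) = 1" "norm (W s) = 1"
        using glued[of i s] ucc[of i] by (auto simp: unit_curvature_curve_def)
    qed
    have der: "(P has_vector_derivative U s) (at s within {S j..S (j + 1)})"
      "(U has_vector_derivative W s) (at s within {S j..S (j + 1)})" if s: "s \<in> {S j..S (j + 1)}" for j s
    proof -
      have s': "s - S j \<in> {0..l j}" using s by (auto simp: S_Suc)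
      have "unit_curvature_curve (l j) (q j) (T j) (D j)"
        unfolding q_def by (rule unit_curvature_curve_translate[OF ucc])
      then have "(q j has_vector_derivative T j (s - S j)) (at (s - S j) within {0..l j})"
        "(T j has_vector_derivative D j (s - S j)) (at (s - S j) within {0..l j})"
        using s' unfolding unit_curvature_curve_def by blast+
      then have 1: "((\<lambda>s. q j (s - S j)) has_vector_derivative T j (s - S j)) (at s within {S j..S (j + 1)})"
        "((\<lambda>s. T j (s - S j)) has_vector_derivative D j (s - S j)) (at s within {S j..S (j + 1)})"
        by (auto intro: has_vector_derivative_shift simp: S_Suc)
      have 2: "P x = q j (x - S j)" "U x = T j (x - S j)" "W x = D j (x - S j)" if "x \<in> {S j..S (j + 1)}" for x
        using glued[of j x] that by (simp_all add: S_Suc)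
      show "(P has_vector_derivative U s) (at s within {S j..S (j + 1)})"
        unfolding 2(2)[OF s] by (rule has_vector_derivative_transform[OF s 2(1) 1(1)])
      show "(U has_vector_derivative W s) (at s within {S j..S (j + 1)})"
        unfolding 2(3)[OF s] by (rule has_vector_derivative_transform[OF s 2(2) 1(2)])
    qed
    have P': "(P has_vector_derivative U s) (at s)" for s
      using idx[of s] has_vector_derivative_at_if_pieces[OF sm] der(1) by blast
    have U': "(U has_vector_derivative W s) (at s)" for s
      using idx[of s] has_vector_derivative_at_if_pieces[OF sm] der(2) by blast
    have contW: "isCont W s" for s
    proof -
      have "continuous_on {S j..S (j + 1)} W" for j
      proof (rule continuous_on_eq)
        have "continuous_on {0..l j} (D j)" using ucc[of j] by (simp add: unit_curvature_curve_def)
        then show "continuous_on {S j..S (j + 1)} (\<lambda>s. D j (s - S j))"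
          by (rule continuous_on_compose2) (auto intro!: continuous_intros simp: S_Suc)
      qed (auto simp: glued S_Suc)
      then show ?thesis using idx[of s] isCont_if_pieces[OF sm] by blast
    qed
    define \<gamma> where "\<gamma> = (\<lambda>s. (1 / k) *\<^sub>R P (k * s))"
    note curvature = rescaled_unit_curvature[OF P' U' contW unit k, folded \<gamma>_def]
    \<comment> \<open>The arclength \<open>l i / k\<close> of a piece is spread evenly over the unit
      of time that \<open>broken_line v\<close> takes for the edge. This is the matching for which
      \<open>edge_curve\<close> bounds the distance.\<close>
    define \<sigma> where "\<sigma> = (\<lambda>t. broken_line S t / k)"
    have \<gamma>\<sigma>: "\<gamma> (\<sigma> t) = (1 / k) *\<^sub>R P (broken_line S t)" for t using k by (simp add: \<gamma>_def \<sigma>_def)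
    have P_per: "P (s + \<Lambda>) = P s" for s
    proof -
      obtain i where i: "S i \<le> s" "s < S i + l i" using idx[of s] S_Suc by metis
      have "P (s + \<Lambda>) = q (i + n) (s + \<Lambda> - S (i + n))"
        by (rule glued(1)) (use i in \<open>simp_all add: S_per E_per \<Lambda>_def\<close>)
      also have "\<dots> = q i (s - S i)" by (simp add: S_per \<Lambda>_def q_def E_per per)
      also have "\<dots> = P s" using glued(1)[of i s] i by simp
      finally show ?thesis .
    qed
    have \<gamma>_per: "\<gamma> (s + \<Lambda> / k) = \<gamma> s" for s
      using P_per[of "k * s"] k by (simp add: \<gamma>_def distrib_left)
    have \<sigma>_surj: "surj \<sigma>"
    proof (rule surjI)
      fix y
      show "\<sigma> (SOME t. broken_line S t = k * y) = y"
        using someI_ex[of "\<lambda>t. broken_line S t = k * y"] bij(2) k by (metis \<sigma>_def nonzero_mult_div_cancel_left less_irrefl surjD)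
    qed
    have \<sigma>_per: "\<sigma> (t + of_int n) = \<sigma> t + \<Lambda> / k" for t
    proof -
      have fl: "\<lfloor>t + of_int n\<rfloor> = \<lfloor>t\<rfloor> + n" by simp
      have "S (\<lfloor>t\<rfloor> + n + 1) = S (\<lfloor>t\<rfloor> + 1) + S n" using S_per[of "\<lfloor>t\<rfloor> + 1"] by (simp add: algebra_simps)
      then have "broken_line S (t + of_int n) = broken_line S t + \<Lambda>" unfolding broken_line_def fl by (simp add: S_per \<Lambda>_def)
      then show ?thesis by (simp add: \<sigma>_def add_divide_distrib)
    qed
    have close: "norm (\<gamma> (\<sigma> t) - broken_line v t) \<le> \<epsilon>" for t
    proof -
      define i where "i = \<lfloor>t\<rfloor>"
      define s where "s = (t - of_int i) * l i"
      have t: "0 \<le> t - of_int i" "t - of_int i \<le> 1" unfolding i_def by linarith+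
      have s: "0 \<le> s" "s \<le> l i"
        using t l0[of i] mult_right_mono[of "t - of_int i" 1 "l i"] by (simp_all add: s_def)
      have "broken_line S t = S i + s" by (simp add: broken_line_def i_def[symmetric] S_Suc s_def)
      then have "P (broken_line S t) = q i s" using glued(1)[of i "broken_line S t"] s by simp
      then have "\<gamma> (\<sigma> t) = v i + (1 / k) *\<^sub>R p i s"
        using k by (simp add: \<gamma>\<sigma> q_def scaleR_add_right)
      moreover have "broken_line v t = v i + (1 / k) *\<^sub>R ((s / l i * (k * len i)) *\<^sub>R a i)"
        using k l0[of i] by (simp add: broken_line_def i_def[symmetric] s_def len_a[symmetric])
      ultimately have "\<gamma> (\<sigma> t) - broken_line v t = (1 / k) *\<^sub>R (p i s - (s / l i * (k * len i)) *\<^sub>R a i)"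
        by (simp add: scaleR_diff_right)
      then have "norm (\<gamma> (\<sigma> t) - broken_line v t) = (1 / k) * norm (p i s - (s / l i * (k * len i)) *\<^sub>R a i)"
        using k by simp
      also have "\<dots> \<le> (1 / k) * (k * \<epsilon>)"
        using edge[of i] s k by (intro mult_left_mono) (auto simp: edge_curve_def)
      finally show ?thesis using k by simp
    qed
    have contU: "continuous_on X U" for X
      using U' has_vector_derivative_continuous by (metis continuous_at_imp_continuous_on)
    have near: "\<exists>c>0. \<forall>s t. of_int i \<le> s \<longrightarrow> s \<le> of_int i + 1 \<longrightarrow> s < t \<longrightarrow> t \<le> s + 1/2 \<longrightarrow>
      separated c (\<lambda>t. \<gamma> (\<sigma> t)) (broken_line v) t s" for i
    proof -
      define e where "e = a i + b i"
      have e2: "norm e \<le> 2" using norm_triangle_ineq[of "a i" "b i"] a1[of i] b1[of i] by (simp add: e_def)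
      have bi: "a (i + 1) = b i" by (simp add: b_def)
      have ae: "a i \<bullet> e = 1 + a i \<bullet> b i" "a (i + 1) \<bullet> e = 1 + a i \<bullet> b i"
        using a1[of i] b1[of i] inner_commute[of "b i" "a i"] unfolding bi
        by (simp_all add: e_def inner_add_right norm_eq_1)
      \<comment> \<open>The middle of piece \<open>i + 1\<close> in the arclength of
        \<open>P\<close>: the control over the first half of a piece reaches exactly that
        far.\<close>
      define y where "y = S (i + 1) + l (i + 1) / 2"
      have Ue: "0 < U s \<bullet> e" if s: "s \<in> {S i..y}" for s
      proof (cases "s \<le> S i + l i")
        case True
        then show ?thesis using glued(2)[of i s] s edge[of i] by (auto simp: edge_curve_def e_def)
      next
        case False
        have "norm (T (i + 1) (s - S (i + 1)) - a (i + 1)) \<le> \<rho>"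
          using edge[of "i + 1"] s False unfolding edge_curve_def y_def by (auto simp: S_Suc)
        then have "norm (U s - b i) \<le> \<rho>"
          using glued(2)[of "i + 1" s] s False l0[of "i + 1"] by (simp add: y_def S_Suc b_def)
        then have "U s \<bullet> (b i + a i) \<ge> 1 + b i \<bullet> a i - 2 * \<rho>" by (rule inner_sum_near[OF b1 a1])
        then show ?thesis using \<rho>_ab[of i] by (simp add: e_def inner_commute add.commute)
      qed
      have "S i \<le> y" using l0[of i] l0[of "i + 1"] by (simp add: y_def S_Suc)
      then have "compact {S i..y}" "{S i..y} \<noteq> {}" by auto
      moreover have "continuous_on {S i..y} (\<lambda>s. U s \<bullet> e)" by (intro continuous_on_inner contU continuous_on_const)
      \<comment> \<open>Compactness turns the pointwise positive component along \<open>e\<close>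
        into a uniform lower bound.\<close>
      ultimately obtain s0 where s0: "s0 \<in> {S i..y}" "\<And>s. s \<in> {S i..y} \<Longrightarrow> U s0 \<bullet> e \<le> U s \<bullet> e"
        using continuous_attains_inf by metis
      define c0 where "c0 = U s0 \<bullet> e"
      have c0: "c0 > 0" using Ue[OF s0(1)] by (simp add: c0_def)
      define dl where "dl = min (len i) (len (i + 1))"
      \<comment> \<open>The smaller of two rates of advance along \<open>e\<close>. The curve covers
        arclength at least \<open>d / k\<close> per unit of time and gains at least
        \<open>c0\<close> per unit of arclength; the polygon moves with speed at least
        \<open>dl\<close>.\<close>
      define c1 where "c1 = min (c0 * d / k) (dl * (1 + a i \<bullet> b i))"
      have c1: "c1 > 0" using c0 d(1) k ab[of i] len0 by (simp add: c1_def dl_def)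
      define M where "M = max (max (len i) (len (i + 1))) (max (l i) (l (i + 1)) / k)"
      have M: "M > 0" "len i \<le> M" "len (i + 1) \<le> M" "l i \<le> k * M" "l (i + 1) \<le> k * M"
      proof -
        show "len i \<le> M" "len (i + 1) \<le> M" by (auto simp: M_def)
        then show "M > 0" using len0[of i] by simp
        have "l i / k \<le> M" "l (i + 1) / k \<le> M" using k by (auto simp: M_def le_max_iff_disj divide_right_mono)
        then show "l i \<le> k * M" "l (i + 1) \<le> k * M" using k by (simp_all add: pos_divide_le_eq mult.commute)
      qed
      have "separated (c1 / (4 * M)) (\<lambda>t. \<gamma> (\<sigma> t)) (broken_line v) t s"
        if st: "of_int i \<le> s" "s \<le> of_int i + 1" "s < t" "t \<le> s + 1/2" for s t
      proof (rule separated_near[OF e2 c1 _ M(1)])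
        have st': "of_int i \<le> s" "s \<le> of_int i + 1" "s \<le> t" "t \<le> of_int i + 2" using st by auto
        obtain \<alpha> \<beta> where \<alpha>\<beta>: "\<alpha> \<ge> 0" "\<beta> \<ge> 0" "\<alpha> + \<beta> = t - s"
          "broken_line S t - broken_line S s = \<alpha> *\<^sub>R (S (i + 1) - S i) + \<beta> *\<^sub>R (S (i + 2) - S (i + 1))"
          using broken_line_increment[OF st', of S] by blast
        obtain \<alpha>' \<beta>' where \<alpha>\<beta>': "\<alpha>' \<ge> 0" "\<beta>' \<ge> 0" "\<alpha>' + \<beta>' = t - s"
          "broken_line v t - broken_line v s = \<alpha>' *\<^sub>R (v (i + 1) - v i) + \<beta>' *\<^sub>R (v (i + 2) - v (i + 1))"
          using broken_line_increment[OF st', of v] by blast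
        have v_inc: "broken_line v t - broken_line v s = (\<alpha>' * len i) *\<^sub>R a i + (\<beta>' * len (i + 1)) *\<^sub>R a (i + 1)"
          using len_a[of i] len_a[of "i + 1"] by (simp add: \<alpha>\<beta>'(4) scaleR_scaleR[symmetric] add.assoc)
        have S_inc: "broken_line S t - broken_line S s = \<alpha> * l i + \<beta> * l (i + 1)"
          using S_Suc[of i] S_Suc[of "i + 1"] by (simp add: \<alpha>\<beta>(4) add.assoc)
        have lowS: "d * (t - s) \<le> broken_line S t - broken_line S s" using broken_line_lower_bound[where S = S and d = d, OF dS] st by simp
        have mono: "broken_line S s \<le> broken_line S t" using strict_mono_less_eq[OF bij(1)] st by simp
        show "t - s > 0" using st by simp
        show "c1 * (t - s) \<le> (broken_line v t - broken_line v s) \<bullet> e"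
        proof -
          have "dl * (t - s) \<le> \<alpha>' * len i + \<beta>' * len (i + 1)"
          proof -
            have "dl * \<alpha>' \<le> len i * \<alpha>'" "dl * \<beta>' \<le> len (i + 1) * \<beta>'"
              using \<alpha>\<beta>' by (auto simp: dl_def intro!: mult_right_mono)
            then show ?thesis unfolding \<alpha>\<beta>'(3)[symmetric] by (simp add: algebra_simps)
          qed
          then have "dl * (t - s) * (1 + a i \<bullet> b i) \<le> (\<alpha>' * len i + \<beta>' * len (i + 1)) * (1 + a i \<bullet> b i)"
            using ab[of i] by (intro mult_right_mono) auto
          also have "\<dots> = (broken_line v t - broken_line v s) \<bullet> e"
            by (simp add: v_inc inner_add_left ae distrib_right)
          finally have "dl * (1 + a i \<bullet> b i) * (t - s) \<le> (broken_line v t - broken_line v s) \<bullet> e" by (simp add: mult_ac)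
          moreover have "c1 * (t - s) \<le> dl * (1 + a i \<bullet> b i) * (t - s)"
            using st by (intro mult_right_mono) (auto simp: c1_def)
          ultimately show ?thesis by linarith
        qed
        show "norm (broken_line v t - broken_line v s) \<le> M * (t - s)"
        proof -
          have "norm (broken_line v t - broken_line v s) \<le> norm ((\<alpha>' * len i) *\<^sub>R a i) + norm ((\<beta>' * len (i + 1)) *\<^sub>R a (i + 1))"
            unfolding v_inc by (rule norm_triangle_ineq)
          also have "\<dots> = \<alpha>' * len i + \<beta>' * len (i + 1)"
            using a1 \<alpha>\<beta>' len0[of i] len0[of "i + 1"] by simp
          also have "\<dots> \<le> \<alpha>' * M + \<beta>' * M" using \<alpha>\<beta>' M by (intro add_mono mult_left_mono) auto
          also have "\<dots> = M * (t - s)" unfolding \<alpha>\<beta>'(3)[symmetric] by (simp add: algebra_simps)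
          finally show ?thesis .
        qed
        have \<gamma>_inc: "\<gamma> (\<sigma> t) - \<gamma> (\<sigma> s) = (1 / k) *\<^sub>R (P (broken_line S t) - P (broken_line S s))"
          by (simp add: \<gamma>\<sigma> scaleR_diff_right)
        show "norm (\<gamma> (\<sigma> t) - \<gamma> (\<sigma> s)) \<le> M * (t - s)"
        proof -
          have "norm (P (broken_line S t) - P (broken_line S s)) \<le> 1 * norm (broken_line S t - broken_line S s)"
          proof (rule differentiable_bound[of UNIV _ "\<lambda>s h. h *\<^sub>R U s"])
            show "(P has_derivative (\<lambda>h. h *\<^sub>R U s)) (at s within UNIV)" for s
              using P'[of s] by (simp add: has_vector_derivative_def)
            show "onorm (\<lambda>h. h *\<^sub>R U s) \<le> 1" for s by (rule onorm_le) (simp add: unit)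
          qed auto
          also have "\<dots> = \<alpha> * l i + \<beta> * l (i + 1)" using mono by (simp add: S_inc[symmetric])
          also have "\<dots> \<le> \<alpha> * (k * M) + \<beta> * (k * M)" using \<alpha>\<beta> M by (intro add_mono mult_left_mono) auto
          also have "\<dots> = k * (M * (t - s))" unfolding \<alpha>\<beta>(3)[symmetric] by (simp add: algebra_simps)
          finally show ?thesis unfolding \<gamma>_inc using k by (simp add: pos_divide_le_eq mult.commute)
        qed
        show "c1 * (t - s) \<le> (\<gamma> (\<sigma> t) - \<gamma> (\<sigma> s)) \<bullet> e"
        proof -
          have pl_int: "broken_line S (of_int i) = S i" by (simp add: broken_line_def)
          have pl_half: "broken_line S (of_int i + 3/2) = y"
            using broken_line_eq[of "i + 1" "of_int i + 3/2" S] by (simp add: y_def S_Suc2)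
          have "S i \<le> broken_line S s" "broken_line S t \<le> y"
            using st strict_mono_less_eq[OF bij(1)] pl_int pl_half by (metis, smt (verit) field_sum_of_halves)
          then have "c0 * (broken_line S t - broken_line S s) \<le> (P (broken_line S t) - P (broken_line S s)) \<bullet> e"
            by (intro increment_ge_derivative_bound[OF P' _ mono]) (auto simp: c0_def intro!: s0(2))
          moreover have "c0 * (d * (t - s)) \<le> c0 * (broken_line S t - broken_line S s)"
            using lowS c0 by (intro mult_left_mono) auto
          ultimately have "c0 * (d * (t - s)) / k \<le> (P (broken_line S t) - P (broken_line S s)) \<bullet> e / k"
            using k by (intro divide_right_mono) auto
          also have "\<dots> = (\<gamma> (\<sigma> t) - \<gamma> (\<sigma> s)) \<bullet> e" unfolding \<gamma>_inc by simp
          finally have "c0 * d / k * (t - s) \<le> (\<gamma> (\<sigma> t) - \<gamma> (\<sigma> s)) \<bullet> e" by (simp add: mult_ac)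
          moreover have "c1 * (t - s) \<le> c0 * d / k * (t - s)"
            using st by (intro mult_right_mono) (auto simp: c1_def)
          ultimately show ?thesis by linarith
        qed
      qed
      moreover have "c1 / (4 * M) > 0" using c1 M by simp
      ultimately show ?thesis by blast
    qed
    then obtain cs where cs: "\<And>i. cs i > 0" "\<And>i s t. of_int i \<le> s \<Longrightarrow> s \<le> of_int i + 1 \<Longrightarrow> s < t \<Longrightarrow>
      t \<le> s + 1/2 \<Longrightarrow> separated (cs i) (\<lambda>t. \<gamma> (\<sigma> t)) (broken_line v) t s"
      by metis
    \<comment> \<open>The claim concerns \<open>s\<close> in \<open>[0, n)\<close>, so only finitely
      many edges contribute a constant.\<close>
    define c' where "c' = Min (cs ` {0..<n})"
    have fin: "finite (cs ` {0..<n})" "cs ` {0..<n} \<noteq> {}" using n by auto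
    have c': "c' > 0" using fin cs(1) by (auto simp: c'_def Min_gr_iff)
    have "separated c' (\<lambda>t. \<gamma> (\<sigma> t)) (broken_line v) t s"
      if st: "0 \<le> s" "s < of_int n" "s < t" "t \<le> s + 1/2" for s t
    proof (rule separated_mono)
      show "separated (cs \<lfloor>s\<rfloor>) (\<lambda>t. \<gamma> (\<sigma> t)) (broken_line v) t s"
        by (rule cs(2)) (use st in linarith)+
      have "\<lfloor>s\<rfloor> \<in> {0..<n}" using st by (auto simp: floor_less_iff)
      then show "c' \<le> cs \<lfloor>s\<rfloor>" unfolding c'_def using fin by (intro Min_le) auto
    qed
    then have "follows_polygon k n v \<epsilon> \<gamma> (\<Lambda> / k) \<sigma> c'"
      unfolding follows_polygon_def using \<Lambda> k curvature \<gamma>_per \<sigma>_surj \<sigma>_per close c' by simp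
    then show "\<exists>\<gamma> l \<sigma> c. follows_polygon k n v \<epsilon> \<gamma> l \<sigma> c" by blast
  qed
qed

section \<open>Separation of whole curves and assembly of the link\<close>

lemma finite_positive_lower_bound:
  fixes f :: "'a \<Rightarrow> real"
  assumes "finite A" "\<And>x. x \<in> A \<Longrightarrow> f x > 0"
  shows "\<exists>d>0. \<forall>x\<in>A. d \<le> f x"
  using assms
proof (induction A)
  case empty
  show ?case by (rule exI[of _ 1]) simp
next
  case (insert x A)
  then obtain d where "d > 0" "\<forall>y\<in>A. d \<le> f y" by auto
  then show ?case using insert.prems[of x] by (intro exI[of _ "min d (f x)"]) auto
qed

text \<open>Such parameters are at distance at least 1/2 modulo \<open>n\<close>, so they give
  different points; the pairs form a compact set, on which the continuous distance has a positive
  minimum unless the set is empty.\<close>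

lemma broken_line_far:
  fixes v :: "int \<Rightarrow> 'a::real_normed_vector"
  assumes inj: "\<And>s t. broken_line v s = broken_line v t \<Longrightarrow> \<exists>k. s - t = of_int k * of_int n"
  shows "\<exists>h>0. \<forall>s t. 0 \<le> s \<longrightarrow> s \<le> of_int n \<longrightarrow> s + 1/2 \<le> t \<longrightarrow> t \<le> s + of_int n - 1/2 \<longrightarrow>
    h \<le> norm (broken_line v s - broken_line v t)"
proof -
  define K where "K = {x :: real \<times> real. 0 \<le> fst x \<and> fst x \<le> of_int n \<and> fst x + 1/2 \<le> snd x \<and> snd x \<le> fst x + of_int n - 1/2}"
  have "closed K"
    unfolding K_def by (intro closed_Collect_conj closed_Collect_le continuous_intros)
  moreover have "bounded K"
  proof (rule bounded_subset)
    show "bounded ({0..of_int n :: real} \<times> {0..2 * of_int n :: real})"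
      by (intro bounded_Times bounded_closed_interval)
    show "K \<subseteq> {0..of_int n} \<times> {0..2 * of_int n}" by (auto simp: K_def)
  qed
  ultimately have "compact K" by (simp add: compact_eq_bounded_closed)
  have cont: "continuous_on UNIV (broken_line v)"
    by (intro continuous_at_imp_continuous_on ballI isCont_broken_line)
  have cont_K: "continuous_on K (\<lambda>x. norm (broken_line v (fst x) - broken_line v (snd x)))"
    by (intro continuous_intros continuous_on_compose2[OF cont]) auto
  have pos: "0 < norm (broken_line v s - broken_line v t)" if "(s, t) \<in> K" for s t
  proof -
    have "broken_line v s \<noteq> broken_line v t"
    proof
      assume "broken_line v s = broken_line v t"
      then obtain k where k: "t - s = of_int k * of_int n" using inj[of t s] by auto
      then have kn: "(of_int (k * n) :: real) = t - s" by simp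
      have "0 < (of_int (k * n) :: real)" "(of_int (k * n) :: real) < of_int n"
        unfolding kn using that by (auto simp: K_def)
      then have kn: "0 < k * n" "k * n < n" by (simp_all only: of_int_0_less_iff of_int_less_iff)
      then have "n > 0" by linarith
      with kn(1) have "1 \<le> k" by (simp add: zero_less_mult_iff)
      then have "1 * n \<le> k * n" using \<open>n > 0\<close> by (intro mult_right_mono) auto
      then show False using kn(2) by simp
    qed
    then show ?thesis by simp
  qed
  show ?thesis
  proof (cases "K = {}")
    case True
    then have "(s, t) \<notin> K" for s t by simp
    then show ?thesis by (intro exI[of _ 1]) (auto simp: K_def)
  next
    case False
    then obtain x where x: "x \<in> K" "\<forall>y\<in>K.
        norm (broken_line v (fst x) - broken_line v (snd x)) \<le> norm (broken_line v (fst y) - broken_line v (snd y))"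
      using continuous_attains_inf[OF \<open>compact K\<close> False cont_K] by blast
    have "norm (broken_line v (fst x) - broken_line v (snd x)) > 0" using pos[of "fst x" "snd x"] x(1) by simp
    moreover have "norm (broken_line v (fst x) - broken_line v (snd x)) \<le> norm (broken_line v s - broken_line v t)" if "(s, t) \<in> K" for s t
      using bspec[OF x(2) that] by simp
    ultimately show ?thesis by (intro exI[of _ "norm (broken_line v (fst x) - broken_line v (snd x))"]) (auto simp: K_def)
  qed
qed

text \<open>Two parameters in one period are close, or close across the closing point, or at
  distance at least 1/2 modulo \<open>n\<close>. The first two cases use \<open>near\<close>, the
  last one uses only closeness of \<open>g\<close> to \<open>f\<close>.\<close>

lemma separated_closed_curve:
  fixes n :: int and g f :: "real \<Rightarrow> 'a::real_normed_vector"
  assumes per: "\<And>t. g (t + of_int n) = g t" "\<And>t. f (t + of_int n) = f t"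
    and h: "h > 0" "\<And>t. norm (g t - f t) \<le> h / 4"
    and far: "\<And>s t. 0 \<le> s \<Longrightarrow> s \<le> of_int n \<Longrightarrow> s + 1/2 \<le> t \<Longrightarrow> t \<le> s + of_int n - 1/2 \<Longrightarrow>
      h \<le> norm (f s - f t)"
    and near: "\<And>s t. 0 \<le> s \<Longrightarrow> s < of_int n \<Longrightarrow> s < t \<Longrightarrow> t \<le> s + 1/2 \<Longrightarrow> separated c g f t s"
    and c: "c \<le> 1"
    and st: "s \<in> {0..<of_int n}" "t \<in> {0..<of_int n}" "s \<noteq> t"
  shows "separated c g f s t"
proof -
  have *: "separated c g f s t" if st: "0 \<le> s" "s < t" "t < of_int n" for s t
  proof -
    consider "t \<le> s + 1/2" | "s + of_int n - 1/2 \<le> t" | "s + 1/2 \<le> t" "t \<le> s + of_int n - 1/2" by linarith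
    then show ?thesis
    proof cases
      case 1
      then show ?thesis using near[of s t] st separated_sym by auto
    next
      case 2
      \<comment> \<open>One period later, \<open>s\<close> comes shortly after
        \<open>t\<close>.\<close>
      then have "separated c g f (s + of_int n) t" using near[of t "s + of_int n"] st by auto
      then show ?thesis unfolding separated_def per .
    next
      case 3
      then have "separated 1 g f s t" using far[of s t] st h by (intro separated_far[where h = h]) auto
      then show ?thesis using c by (rule separated_mono)
    qed
  qed
  show ?thesis
  proof (cases "s < t")
    case True
    then show ?thesis using * st by auto
  next
    case False
    then show ?thesis using *[of t s] st separated_sym by auto
  qed
qed

text \<open>With \<open>b = 0\<close> this is periodicity; other \<open>b\<close> cover the time
  change, which gains the length of the curve in each period.\<close>

lemma shift_period_real:
  fixes g :: "real \<Rightarrow> 'a::real_vector"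
  assumes "\<And>t. g (t + a) = g t + b"
  shows "g (t + of_int k * a) = g t + of_int k *\<^sub>R b"
proof -
  define w where "w = (\<lambda>i::int. g (t + of_int i * a) - of_int i *\<^sub>R b)"
  have "w (i + 1) = w i" for i
    using assms[of "t + of_int i * a"] by (simp add: w_def algebra_simps)
  then have "w (0 + k * 1) = w 0" by (rule shift_periodic_int)
  then show ?thesis by (simp add: w_def algebra_simps)
qed

lemma reduce_mod_period:
  fixes t a :: real
  assumes "a > 0"
  obtains k where "t - of_int k * a \<in> {0..<a}"
proof
  have "of_int \<lfloor>t / a\<rfloor> \<le> t / a" "t / a < of_int \<lfloor>t / a\<rfloor> + 1" by linarith+
  then have "of_int \<lfloor>t / a\<rfloor> * a \<le> t" "t < (of_int \<lfloor>t / a\<rfloor> + 1) * a"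
    using pos_le_divide_eq[OF assms, of "of_int \<lfloor>t / a\<rfloor>" t]
      pos_divide_less_eq[OF assms, of t "of_int \<lfloor>t / a\<rfloor> + 1"] by blast+
  then show "t - of_int \<lfloor>t / a\<rfloor> * a \<in> {0..<a}" by (simp add: algebra_simps)
qed

theorem theorem1:
  fixes L :: "(real^3) set" and m :: nat
  assumes "m \<ge> 1" and "link m L" and "tame L"
  shows "\<exists>(\<kappa>::real) (l :: nat \<Rightarrow> real) (\<gamma> :: nat \<Rightarrow> real \<Rightarrow> real^3).
    \<kappa> > 0 \<and>
    (\<forall>i\<in>{1..m}.
       l i > 0 \<and>
       C2_curve (\<gamma> i) \<and>
       (\<forall>s. \<gamma> i (s + l i) = \<gamma> i s) \<and>
       (\<forall>s. norm (curve_deriv (\<gamma> i) s) = 1) \<and>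
       (\<forall>s. norm (curve_deriv (curve_deriv (\<gamma> i)) s) = \<kappa>) \<and>
       inj_on (\<gamma> i) {0..<l i}) \<and>
    disjoint_family_on (\<lambda>i. range (\<gamma> i)) {1..m} \<and>
    ambient_isotopic (\<Union>i\<in>{1..m}. range (\<gamma> i)) L"
proof -
  obtain \<P> where \<P>: "finite \<P>" "card \<P> = m" "\<And>P. P \<in> \<P> \<Longrightarrow> simple_closed_polygon P"
    "pairwise disjnt \<P>" "ambient_isotopic L (\<Union>\<P>)"
    using tame_link_polygons[OF assms(2,3)] by blast
  obtain Q where Q: "bij_betw Q {1..m} \<P>"
    using ex_bij_betw_nat_finite_1[OF \<P>(1)] \<P>(2) by auto
  have "\<forall>i\<in>{1..m}. \<exists>n v. n > 0 \<and> (\<forall>j. v (j + n) = v j) \<and> Q i = range (broken_line v) \<and>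
      (\<forall>s t. broken_line v s = broken_line v t \<longrightarrow> (\<exists>k. s - t = of_int k * of_int n))"
  proof
    fix i assume "i \<in> {1..m}"
    then have "simple_closed_polygon (Q i)" using bij_betwE[OF Q] \<P>(3) by blast
    then obtain n v where "n > 0" "\<And>j. v (j + n) = v j" "Q i = range (broken_line v)"
      "\<And>s t. broken_line v s = broken_line v t \<Longrightarrow> \<exists>k. s - t = of_int k * of_int n"
      by (rule simple_closed_polygon_broken_line) blast
    then show "\<exists>n v. n > 0 \<and> (\<forall>j. v (j + n) = v j) \<and> Q i = range (broken_line v) \<and>
      (\<forall>s t. broken_line v s = broken_line v t \<longrightarrow> (\<exists>k. s - t = of_int k * of_int n))" by blast
  qed
  then obtain n v where nv: "\<And>i. i \<in> {1..m} \<Longrightarrow> n i > 0" "\<And>i j. i \<in> {1..m} \<Longrightarrow> v i (j + n i) = v i j"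
      "\<And>i. i \<in> {1..m} \<Longrightarrow> Q i = range (broken_line (v i))"
      "\<And>i s t. i \<in> {1..m} \<Longrightarrow> broken_line (v i) s = broken_line (v i) t \<Longrightarrow> \<exists>k. s - t = of_int k * of_int (n i)"
    by metis
  have pl_per: "broken_line (v i) (t + of_int (n i)) = broken_line (v i) t" if "i \<in> {1..m}" for i t
    using broken_line_shift[of "v i" "n i" t 1] nv(2)[OF that] by simp
  \<comment> \<open>These numbers, later \<open>h1\<close>, bound distances within one polygon away
    from the diagonal; \<open>h2\<close> does the same between different polygons, with an arbitrary
    positive value for equal indices.\<close>
  have "\<forall>i\<in>{1..m}. \<exists>h>0. \<forall>s t. 0 \<le> s \<longrightarrow> s \<le> of_int (n i) \<longrightarrow> s + 1/2 \<le> t \<longrightarrow> t \<le> s + of_int (n i) - 1/2 \<longrightarrow>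
    h \<le> norm (broken_line (v i) s - broken_line (v i) t)"
    using broken_line_far nv(4) by blast
  then obtain h1 where h1: "\<And>i. i \<in> {1..m} \<Longrightarrow> h1 i > 0"
    "\<And>i s t. i \<in> {1..m} \<Longrightarrow> 0 \<le> s \<Longrightarrow> s \<le> of_int (n i) \<Longrightarrow> s + 1/2 \<le> t \<Longrightarrow> t \<le> s + of_int (n i) - 1/2 \<Longrightarrow>
    h1 i \<le> norm (broken_line (v i) s - broken_line (v i) t)"
    by metis
  have "\<forall>x\<in>{1..m} \<times> {1..m}. \<exists>h>0. fst x \<noteq> snd x \<longrightarrow> (\<forall>s t. h \<le> norm (broken_line (v (fst x)) s - broken_line (v (snd x)) t))"
  proof
    fix x assume x: "x \<in> {1..m} \<times> {1..m}"
    show "\<exists>h>0. fst x \<noteq> snd x \<longrightarrow> (\<forall>s t. h \<le> norm (broken_line (v (fst x)) s - broken_line (v (snd x)) t))"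
    proof (cases "fst x = snd x")
      case True
      then show ?thesis by (intro exI[of _ 1]) simp
    next
      case False
      have Q\<P>: "Q (fst x) \<in> \<P>" "Q (snd x) \<in> \<P>" "Q (fst x) \<noteq> Q (snd x)"
        using bij_betwE[OF Q] inj_on_contraD[OF bij_betw_imp_inj_on[OF Q] False] x by auto
      then have "Q (fst x) \<inter> Q (snd x) = {}"
        using \<P>(4) unfolding pairwise_def disjnt_def by blast
      moreover have "compact (Q (fst x))" "closed (Q (snd x))"
        using simple_closed_curve_topology[OF simple_closed_polygon_imp_curve[OF \<P>(3)]] Q\<P>(1,2)
          compact_imp_closed by auto
      ultimately obtain h where "h > 0" "\<forall>y\<in>Q (fst x). \<forall>z\<in>Q (snd x). h \<le> dist y z"
        using separate_compact_closed by metis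
      then show ?thesis using nv(3)[of "fst x"] nv(3)[of "snd x"] x
        by (intro exI[of _ h]) (auto simp: dist_norm)
    qed
  qed
  then obtain h2 where "\<forall>x\<in>{1..m} \<times> {1..m}. h2 x > 0 \<and>
      (fst x \<noteq> snd x \<longrightarrow> (\<forall>s t. h2 x \<le> norm (broken_line (v (fst x)) s - broken_line (v (snd x)) t)))"
    using bchoice[where Q = "\<lambda>x h. h > 0 \<and> (fst x \<noteq> snd x \<longrightarrow>
      (\<forall>s t. h \<le> norm (broken_line (v (fst x)) s - broken_line (v (snd x)) t)))"] by blast
  then have h2: "\<And>x. x \<in> {1..m} \<times> {1..m} \<Longrightarrow> h2 x > 0"
    "\<And>i j s t. i \<in> {1..m} \<Longrightarrow> j \<in> {1..m} \<Longrightarrow> i \<noteq> j \<Longrightarrow> h2 (i, j) \<le> norm (broken_line (v i) s - broken_line (v j) t)"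
    by auto
  obtain h where h: "h > 0" "\<And>i. i \<in> {1..m} \<Longrightarrow> h \<le> h1 i" "\<And>x. x \<in> {1..m} \<times> {1..m} \<Longrightarrow> h \<le> h2 x"
  proof -
    obtain d1 where "d1 > 0" "\<forall>i\<in>{1..m}. d1 \<le> h1 i"
      using finite_positive_lower_bound[of "{1..m}" h1] h1(1) by auto
    moreover obtain d2 where "d2 > 0" "\<forall>x\<in>{1..m} \<times> {1..m}. d2 \<le> h2 x"
      using finite_positive_lower_bound[of "{1..m} \<times> {1..m}" h2] h2(1) by auto
    ultimately show thesis using that[of "min d1 d2"] by (auto simp: min.coboundedI1 min.coboundedI2)
  qed
  \<comment> \<open>The deviation \<open>h / 4\<close> is the one at which
    \<open>separated_far\<close> applies to points at distance \<open>h\<close>.\<close>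
  have "\<exists>k0>0. \<forall>k\<ge>k0. \<exists>\<gamma> l \<sigma> c. follows_polygon k (n i) (v i) (h / 4) \<gamma> l \<sigma> c"
    if i: "i \<in> {1..m}" for i
  proof (rule constant_curvature_near_polygon)
    show "v i (j + 1) \<noteq> v i j" "sgn (v i (j + 2) - v i (j + 1)) \<noteq> - sgn (v i (j + 1) - v i j)" for j
      using broken_line_injective_edges[OF nv(1)[OF i] nv(4)[OF i]] by auto
  qed (use i nv h(1) in auto)
  then obtain k0 where k0: "\<And>i. i \<in> {1..m} \<Longrightarrow> k0 i > 0"
    "\<And>i k. i \<in> {1..m} \<Longrightarrow> k \<ge> k0 i \<Longrightarrow> \<exists>\<gamma> l \<sigma> c. follows_polygon k (n i) (v i) (h / 4) \<gamma> l \<sigma> c"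
    by metis
  \<comment> \<open>All components must have the same curvature; the sum of the positive thresholds
    dominates each of them.\<close>
  define \<kappa> where "\<kappa> = 1 + (\<Sum>i\<in>{1..m}. k0 i)"
  have \<kappa>: "\<kappa> \<ge> k0 i" if "i \<in> {1..m}" for i
    using member_le_sum[of i "{1..m}" k0] that k0(1) by (force simp: \<kappa>_def)
  have \<kappa>0: "\<kappa> > 0" using k0(1) sum_nonneg[of "{1..m}" k0] by (force simp: \<kappa>_def)
  have "\<exists>\<gamma> l \<sigma> c. follows_polygon \<kappa> (n i) (v i) (h / 4) \<gamma> l \<sigma> c" if "i \<in> {1..m}" for i
    using k0(2) \<kappa> that by blast
  then obtain \<gamma> l \<sigma> c where "\<And>i. i \<in> {1..m} \<Longrightarrow> follows_polygon \<kappa> (n i) (v i) (h / 4) (\<gamma> i) (l i) (\<sigma> i) (c i)"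
    by metis
  note curve = this[unfolded follows_polygon_def]
  \<comment> \<open>Capped at 1, the margin that \<open>separated_far\<close> provides.\<close>
  obtain c0 where c0: "c0 > 0" "c0 \<le> 1" "\<And>i. i \<in> {1..m} \<Longrightarrow> c0 \<le> c i"
  proof -
    obtain d where "d > 0" "\<forall>i\<in>{1..m}. d \<le> c i"
      using finite_positive_lower_bound[of "{1..m}" c] curve by auto
    then show thesis using that[of "min d 1"] by (simp add: min.coboundedI1)
  qed
  \<comment> \<open>All components are parametrized together by pairs of component and parameter, so
    that one straight-line homotopy moves the whole link. Half-open intervals make different pairs
    stand for different points.\<close>
  define X where "X = (SIGMA i:{1..m}. {0..<of_int (n i) :: real})"
  define F where "F = (\<lambda>(i, t). \<gamma> i (\<sigma> i t))"
  define G where "G = (\<lambda>(i, t). broken_line (v i) t)"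
  have sep: "separated c0 F G x y" if xy: "x \<in> X" "y \<in> X" "x \<noteq> y" for x y
  proof -
    obtain i s j t where x: "x = (i, s)" and y: "y = (j, t)" by (cases x, cases y) auto
    have i: "i \<in> {1..m}" "s \<in> {0..<of_int (n i)}" and j: "j \<in> {1..m}" "t \<in> {0..<of_int (n j)}"
      using xy by (auto simp: X_def x y)
    show ?thesis
    proof (cases "i = j")
      case False
      have "separated 1 F G x y"
      proof (rule separated_far[OF _ _ _ h(1)])
        show "norm (F x - G x) \<le> h / 4" "norm (F y - G y) \<le> h / 4"
          using curve[OF i(1)] curve[OF j(1)] by (auto simp: F_def G_def x y)
        show "h \<le> norm (G x - G y)"
          using h2(2)[OF i(1) j(1) False, of s t] h(3)[of "(i, j)"] i j by (auto simp: G_def x y)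
      qed
      then show ?thesis using c0(2) by (rule separated_mono)
    next
      case True
      have "separated c0 (\<lambda>t. \<gamma> i (\<sigma> i t)) (broken_line (v i)) s t"
      proof (rule separated_closed_curve[where h = h and n = "n i"])
        show "\<gamma> i (\<sigma> i (t + of_int (n i))) = \<gamma> i (\<sigma> i t)" for t using curve[OF i(1)] by simp
        show "broken_line (v i) (t + of_int (n i)) = broken_line (v i) t" for t by (rule pl_per[OF i(1)])
        show "norm (\<gamma> i (\<sigma> i t) - broken_line (v i) t) \<le> h / 4" for t using curve[OF i(1)] by simp
        show "h \<le> norm (broken_line (v i) s - broken_line (v i) t)"
          if "0 \<le> s" "s \<le> of_int (n i)" "s + 1/2 \<le> t" "t \<le> s + of_int (n i) - 1/2" for s t
          using h1(2)[OF i(1) that] h(2)[OF i(1)] by linarith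
        show "separated c0 (\<lambda>t. \<gamma> i (\<sigma> i t)) (broken_line (v i)) t s"
          if "0 \<le> s" "s < of_int (n i)" "s < t" "t \<le> s + 1/2" for s t
        proof -
          have "separated (c i) (\<lambda>t. \<gamma> i (\<sigma> i t)) (broken_line (v i)) t s" using curve[OF i(1)] that by blast
          then show ?thesis using c0(3)[OF i(1)] by (rule separated_mono)
        qed
      qed (use i j True xy h c0 in \<open>auto simp: x y\<close>)
      then show ?thesis by (simp add: separated_def F_def G_def x y True)
    qed
  qed
  have isotopic: "ambient_isotopic (F ` X) (G ` X)"
  proof (rule ambient_isotopic_linear_homotopy[OF c0(1)])
    fix x y :: "nat \<times> real" and t :: real
    assume xy: "x \<in> X" "y \<in> X" and t: "0 \<le> t" "t \<le> 1"
    show "c0 * norm ((G x - F x) - (G y - F y)) \<le> norm ((F x - F y) + t *\<^sub>R ((G x - F x) - (G y - F y)))"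
    proof (cases "x = y")
      case False
      then show ?thesis using sep[OF xy] t unfolding separated_def by blast
    qed simp
  qed
  have F_inj: "x = y" if "x \<in> X" "y \<in> X" "F x = F y" for x y
    using sep[OF that(1,2)] that(3) by (auto simp: separated_def)
  \<comment> \<open>Surjectivity of the time change and the two periodicities bring any arclength
    parameter into \<open>X\<close>, up to a multiple of the length. Images, disjointness and
    injectivity all follow from this.\<close>
  have reduce: "\<exists>t k. (i, t) \<in> X \<and> F (i, t) = \<gamma> i s \<and> s = \<sigma> i t + of_int k * l i" if i: "i \<in> {1..m}" for i s
  proof -
    obtain u where u: "s = \<sigma> i u" using curve[OF i] by (metis surjD)
    obtain k where k: "u - of_int k * of_int (n i) \<in> {0..<of_int (n i) :: real}"
      using reduce_mod_period[of "of_int (n i)" u] nv(1)[OF i] by auto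
    define t where "t = u - of_int k * of_int (n i)"
    have "s = \<sigma> i t + of_int k *\<^sub>R l i"
      using shift_period_real[of "\<sigma> i" "of_int (n i)" "l i" t k] curve[OF i] u by (simp add: t_def)
    moreover from this have "\<gamma> i s = \<gamma> i (\<sigma> i t)"
      using shift_period_real[of "\<gamma> i" "l i" 0 "\<sigma> i t" k] curve[OF i] by simp
    ultimately show ?thesis
      using k i by (intro exI[of _ t] exI[of _ k]) (auto simp: X_def F_def t_def)
  qed
  have FX: "F ` X = (\<Union>i\<in>{1..m}. range (\<gamma> i))"
  proof
    show "F ` X \<subseteq> (\<Union>i\<in>{1..m}. range (\<gamma> i))" by (auto simp: F_def X_def)
    show "(\<Union>i\<in>{1..m}. range (\<gamma> i)) \<subseteq> F ` X"
    proof clarify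
      fix i s assume "i \<in> {1..m}"
      then obtain t where "(i, t) \<in> X" "F (i, t) = \<gamma> i s" using reduce[of i s] by blast
      then show "\<gamma> i s \<in> F ` X" by (metis imageI)
    qed
  qed
  have GX: "G ` X = \<Union>\<P>"
  proof -
    have "range (broken_line (v i)) = broken_line (v i) ` {0..<of_int (n i)}" if i: "i \<in> {1..m}" for i
    proof
      show "range (broken_line (v i)) \<subseteq> broken_line (v i) ` {0..<of_int (n i)}"
      proof clarify
        fix u
        obtain k where k: "u - of_int k * of_int (n i) \<in> {0..<of_int (n i) :: real}"
          using reduce_mod_period[of "of_int (n i)" u] nv(1)[OF i] by auto
        have "broken_line (v i) (u - of_int k * of_int (n i)) = broken_line (v i) u"
          using broken_line_shift[of "v i" "n i" u "- k"] nv(2)[OF i] by simp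
        with k show "broken_line (v i) u \<in> broken_line (v i) ` {0..<of_int (n i)}" by (metis imageI)
      qed
    qed auto
    then have "G ` X = (\<Union>i\<in>{1..m}. Q i)" using nv(3) by (force simp: G_def X_def)
    also have "\<dots> = \<Union>\<P>" using Q by (auto simp: bij_betw_def)
    finally show ?thesis .
  qed
  have iso: "ambient_isotopic (\<Union>i\<in>{1..m}. range (\<gamma> i)) L"
    using isotopic ambient_isotopic_sym[OF \<P>(5)] ambient_isotopic_trans unfolding FX GX by blast
  have disj: "disjoint_family_on (\<lambda>i. range (\<gamma> i)) {1..m}"
    unfolding disjoint_family_on_def
  proof (intro ballI impI)
    fix i j assume ij: "i \<in> {1..m}" "j \<in> {1..m}" "i \<noteq> j"
    have "\<gamma> i s \<noteq> \<gamma> j t" for s t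
    proof
      assume eq: "\<gamma> i s = \<gamma> j t"
      obtain s' t' where "(i, s') \<in> X" "F (i, s') = \<gamma> i s" "(j, t') \<in> X" "F (j, t') = \<gamma> j t"
        using reduce[OF ij(1), of s] reduce[OF ij(2), of t] by blast
      then show False using F_inj[of "(i, s')" "(j, t')"] eq ij(3) by simp
    qed
    then show "range (\<gamma> i) \<inter> range (\<gamma> j) = {}" by blast
  qed
  have inj: "inj_on (\<gamma> i) {0..<l i}" if i: "i \<in> {1..m}" for i
  proof (rule inj_onI)
    fix s t assume st: "s \<in> {0..<l i}" "t \<in> {0..<l i}" "\<gamma> i s = \<gamma> i t"
    obtain s' k where s': "(i, s') \<in> X" "F (i, s') = \<gamma> i s" "s = \<sigma> i s' + of_int k * l i"
      using reduce[OF i, of s] by blast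
    obtain t' j where t': "(i, t') \<in> X" "F (i, t') = \<gamma> i t" "t = \<sigma> i t' + of_int j * l i"
      using reduce[OF i, of t] by blast
    \<comment> \<open>Different elements of \<open>X\<close> have different images under
      \<open>F\<close>, so equal points come from the same reduced parameter. Then
      \<open>s - t\<close> is a multiple of \<open>l i\<close> with absolute value below
      \<open>l i\<close>.\<close>
    have "s' = t'" using F_inj[OF s'(1) t'(1)] s'(2) t'(2) st(3) by simp
    then have eq: "s - t = of_int (k - j) * l i" using s'(3) t'(3) by (simp add: algebra_simps)
    have l: "l i > 0" using curve[OF i] by simp
    have "\<bar>of_int (k - j) * l i\<bar> < 1 * l i" using st(1,2) unfolding eq[symmetric] by auto
    then have "\<bar>of_int (k - j) :: real\<bar> < 1" using l by (simp add: abs_mult)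
    then have "k = j" by linarith
    then show "s = t" using eq by simp
  qed
  show ?thesis
  proof (intro exI conjI ballI)
    show "\<kappa> > 0" "disjoint_family_on (\<lambda>i. range (\<gamma> i)) {1..m}"
      "ambient_isotopic (\<Union>i\<in>{1..m}. range (\<gamma> i)) L"
      by (fact \<kappa>0 disj iso)+
    fix i assume i: "i \<in> {1..m}"
    show "l i > 0" "C2_curve (\<gamma> i)" "\<forall>s. \<gamma> i (s + l i) = \<gamma> i s"
      "\<forall>s. norm (curve_deriv (\<gamma> i) s) = 1" "\<forall>s. norm (curve_deriv (curve_deriv (\<gamma> i)) s) = \<kappa>"
      using curve[OF i] by blast+
    show "inj_on (\<gamma> i) {0..<l i}" by (rule inj[OF i])
  qed
qed

end
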